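(* The trigonometric degeneration of the bispectral qKZ equation of type $(C_n^\vee,C_n)$, i.e. the system for $\overline G\in\mathbb{C}[W_0]^{\overline{\mathbb K}}$ $$\overline C(1,\epsilon_m)\,\Delta_m\overline G=\overline G\quad(1\le m\le n),\qquad \Bigl(c\,x_a\frac{\partial}{\partial x_a}+L_a+c\,x_a\frac{\partial\log U(x)}{\partial x_a}\Bigr)\overline G=0\quad(1\le a\le n),$$ is equivalent, through the gauge transform $G(x\,|\,y)=U(x)\overline G(x\,|\,y)$ (and the identification of $\mathbb{C}[W_0]^{\overline{\mathbb K}}$ with $(V^{\otimes n})_0^{\overline{\mathbb K}}$ by the isomorphism $\phi$, $f=\phi(G)$), to the compatible system $$\Delta_mf=Q_m(x\,|\,y)f\quad(1\le m\le n),\qquad D_a(x\,|\,y)f=0\quad(1\le a\le n)$$ with $N=n$, restricted to $(V^{\otimes n})_0$.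
   Context: Let $n\ge1$, $N=n$, and $c,k,\alpha,\beta$ generic non-zero complex numbers; $x=(x_1,\dots,x_n)\in(\mathbb{C}^\times)^n$, $y=(y_1,\dots,y_n)\in\mathbb{C}^n$; $(\Delta_mF)(x\,|\,y)=F(x\,|\,y_1,\dots,y_m-c,\dots,y_n)$. $\overline{\mathbb K}$ is the field of meromorphic functions on $(\mathbb{C}^\times)^n\times\mathbb{C}^n$. Groups and algebras. $W_0=\langle s_1,\dots,s_n\rangle$ is the finite Weyl group of type $C_n$ (signed permutations, $s_n$ the sign change). $s_{ij}=s_{ji}=(s_i\cdots s_{j-1})(s_{j-2}\cdots s_i)$ for $i<j$, $r_i=(s_i\cdots s_n)(s_{n-1}\cdots s_i)$, $\tilde s_{ij}=r_ir_js_{ij}$. The affine Weyl group $W$ of type $C_n$ is generated by $W_0$ and commuting elements $x_1^{\pm1},\dots,x_n^{\pm1}$ with $s_ix_is_i=x_{i+1}$ $(i<n)$, $s_nx_ns_n=x_n^{-1}$, $s_ix_j=x_js_i$ for $j\notin\{i,i+1\}$; $s_0:=x_1^{-1}r_1$. Thus $\mathbb{C}[W]\simeq\mathbb{C}[x^{\pm1}]\otimes\mathbb{C}[W_0]$. The degenerate affine Hecke algebra $\overline H$ is generated by $s_1,\dots,s_n$ (with the relations of $W_0$) and commuting $y_1,\dots,y_n$ with $y_is_i=s_iy_{i+1}+k$ $(i<n)$, $y_ns_n=-s_ny_n+2\alpha$, and $[s_i,y_j]=0$ if $j\notin\{i,i+1\}$; $\overline H\simeq\mathbb{C}[W_0]\otimes\mathbb{C}[y]$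 as vector spaces. Actions. $\mathbb{C}[W_0]^{\overline{\mathbb K}}$ is the space of $\mathbb{C}[W_0]$-valued meromorphic functions on $(\mathbb{C}^\times)^n\times\mathbb{C}^n$, i.e. the $\overline{\mathbb K}$-vector space with basis $W_0$; $\Delta_m$ and $x_a\partial/\partial x_a$ act on coefficients. The following operators on it are $\overline{\mathbb K}$-linear. For $h\in\overline H$, $w\in W_0$, write $hw=\sum_{w'\in W_0}w'p_{w'}(y)$ in $\overline H$; then $\overline\eta_L(h)(w)=\sum_{w'}p_{w'}(y)\,w'$. For $\xi\in\mathbb{C}[W]$, write $w\xi=\sum_{w'}q_{w'}(x)w'$ in $\mathbb{C}[W]$; then $\overline\eta_R(\xi)(w)=\sum_{w'}q_{w'}(x)\,w'$. First system. For a scalar argument $z$, $$\overline{\mathcal K}_0(z)=\frac{(z+c/2)\overline\eta_R(x_1^{-1}r_1)+\beta}{z+\beta+c/2},\quad \overline{\mathcal R}_i(z)=\frac{z\,\overline\eta_R(s_i)+k}{z+k}\ (1\le i<n),\quad \overline{\mathcal K}_n(z)=\frac{z\,\overline\eta_R(s_n)-\alpha}{z-\alpha},$$ $$\begin{aligned}\overline C(1,\epsilon_m)=\;&\overline{\mathcal R}_m(y_{m+1}-y_m)\cdots\overline{\mathcal R}_{n-1}(y_n-y_m)\,\overline{\mathcal K}_n(y_m)\,\overline{\mathcal R}_{n-1}(-y_m-y_n)\cdots\overline{\mathcal R}_m(-y_m-y_{m+1})\\&\times\overline{\mathcal R}_{m-1}(-y_{m-1}-y_m)\cdots\overline{\mathcal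 R}_1(-y_1-y_m)\,\overline{\mathcal K}_0(-y_m)\,\overline{\mathcal R}_1(y_1-y_m+c)\cdots\overline{\mathcal R}_{m-1}(y_{m-1}-y_m+c),\end{aligned}$$ $$L_a=\overline\eta_L(y_a)+2\frac{\alpha+\beta x_a}{x_a^2-1}\overline\eta_L(r_a)+k\Bigl(\sum_{p=1}^{a-1}\frac{x_a}{x_a-x_p}\overline\eta_L(s_{pa})+\sum_{p=a+1}^n\frac{x_p}{x_a-x_p}\overline\eta_L(s_{ap})+\sum_{p\ne a}\frac1{x_ax_p-1}\overline\eta_L(\tilde s_{ap})\Bigr),$$ $$U(x)=\prod_{p=1}^n\Bigl(x_p^{\frac{k(n-1)+\alpha}c}(1+x_p)^{\frac{\beta-\alpha}c}(1-x_p)^{-\frac{\beta+\alpha}c}\Bigr)\prod_{1\le p<l\le n}\bigl((1-x_px_l)(x_p-x_l)\bigr)^{-\frac kc}.$$ The function $G=U\overline G$ is again regarded as an element of $\mathbb{C}[W_0]^{\overline{\mathbb K}}$. Second system. $V=\bigoplus_{a=1}^n(\mathbb{C}v_a\oplus\mathbb{C}v_{\bar a})$. $R(\lambda)=\frac{\lambda+kP}{\lambda+k}$ on $V^{\otimes2}$, $P(u\otimes v)=v\otimes u$; $T(x)v_a=x_a^{-1}v_{\bar a}$, $T(x)v_{\bar a}=x_av_a$; $K(\lambda\,|\,x,\beta)=\frac{\lambda T(x)+\beta}{\lambda+\beta}$; $\underline1=(1,\dots,1)$; subscripts/superscripts give tensor positions in $V^{\otimes n}$. $$\begin{aligned}Q_m(x\,|\,y)=\;&R_{m,m-1}(y_m-y_{m-1}-c)\cdots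 R_{m,1}(y_m-y_1-c)\,K_m(y_m-c/2\,|\,x,\beta)\\&\times R_{1,m}(y_1+y_m)\cdots R_{m-1,m}(y_{m-1}+y_m)\,R_{m,m+1}(y_m+y_{m+1})\cdots R_{m,n}(y_m+y_n)\\&\times K_m(y_m\,|\,\underline1,\alpha)\,R_{m,n}(y_m-y_n)\cdots R_{m,m+1}(y_m-y_{m+1}).\end{aligned}$$ With matrix units $e_{ab}v_p=\delta_{bp}v_a$, $E_{ab}=e_{ab}+e_{\bar a\bar b}$, $\overline E_{ab}=e_{a\bar b}+e_{\bar ab}$, $\mathbf X_{ab}=\sum_{i<j}(e_{ab}^{(i)}E_{ba}^{(j)}+e_{\bar b\bar a}^{(i)}E_{ab}^{(j)})$, $\mathbf Y_{ab}=\sum_{i<j}(e_{a\bar b}^{(i)}\overline E_{ba}^{(j)}+e_{b\bar a}^{(i)}\overline E_{ab}^{(j)})$, $\mathbf Z_{ab}=\sum_{i<j}(e_{\bar ab}^{(i)}\overline E_{ba}^{(j)}+e_{\bar ba}^{(i)}\overline E_{ab}^{(j)})$ (sums over $1\le i<j\le n$): $$A_a(y)=\sum_{j=1}^ny_j(e_{aa}^{(j)}-e_{\bar a\bar a}^{(j)})+2\alpha\sum_{j=1}^ne_{a\bar a}^{(j)}+k\Bigl(-\sum_{p<a}\mathbf X_{pa}+\sum_{p>a}\mathbf X_{ap}+\sum_{p=1}^n\mathbf Y_{ap}\Bigr),$$ $$B_a(x)=2\frac{\alpha+\beta x_a}{x_a^2-1}\sum_{j=1}^n\overline E_{aa}^{(j)}+k\Bigl\{\sum_{p<a}\frac{x_a}{x_a-x_p}(\mathbf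 X_{ap}+\mathbf X_{pa})+\sum_{p>a}\frac{x_p}{x_a-x_p}(\mathbf X_{ap}+\mathbf X_{pa})+\sum_{p=1}^n\frac1{x_ax_p-1}(\mathbf Y_{ap}+\mathbf Z_{ap})\Bigr\},$$ $D_a(x\,|\,y)=c\,x_a\frac{\partial}{\partial x_a}+A_a(y)+B_a(x)$. The map $\phi$. $W_0$ acts on $V$ by $s_iv_a=v_{\sigma_i(a)}$, $s_iv_{\bar a}=v_{\overline{\sigma_i(a)}}$ with $\sigma_i=(i,i+1)$ for $i<n$, and $s_n$ exchanges $v_n$ and $v_{\bar n}$ and fixes the other basis vectors; $W_0$ acts on $V^{\otimes n}$ diagonally. $(V^{\otimes n})_0=\mathbb{C}[W_0](v_1\otimes\cdots\otimes v_n)$, $(V^{\otimes n})_0^{\overline{\mathbb K}}=\overline{\mathbb K}\otimes_{\mathbb C}(V^{\otimes n})_0$, and $\phi:\mathbb{C}[W_0]^{\overline{\mathbb K}}\to(V^{\otimes n})_0^{\overline{\mathbb K}}$ is the $\overline{\mathbb K}$-linear isomorphism with $\phi(w)=w(v_1\otimes\cdots\otimes v_n)$ for $w\in W_0$. *)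

theory Defs
  imports "HOL-Analysis.Analysis" "HOL-Library.Poly_Mapping" "HOL-Combinatorics.Transposition"
begin

text \<open>
  The index set \<open>{1,\<dots>,n}\<close> is an arbitrary finite linearly ordered type \<open>'n\<close>: its least element
  plays the role of 1, its greatest element that of \<open>n = CARD('n)\<close>, and \<open>nxt i\<close> that of \<open>i + 1\<close>.
  The lists \<open>ilist {a..<b}\<close> are the increasing lists \<open>a, \<dots>, b - 1\<close>.
\<close>

definition nxt :: "'n::{finite,linorder} \<Rightarrow> 'n" where
  "nxt i = Min {i<..}"

abbreviation lastix :: "'n::{finite,linorder}" where
  "lastix \<equiv> Max UNIV"

abbreviation firstix :: "'n::{finite,linorder}" where
  "firstix \<equiv> Min UNIV"

abbreviation ilist :: "'n::{finite,linorder} set \<Rightarrow> 'n list" where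
  "ilist \<equiv> sorted_list_of_set"

lemma nxt_greater: "i \<noteq> lastix \<Longrightarrow> i < nxt i"
proof -
  assume "i \<noteq> lastix"
  then have "i < lastix" by (simp add: order.not_eq_order_implies_strict)
  then have "{i<..} \<noteq> {}" by auto
  then have "nxt i \<in> {i<..}" unfolding nxt_def by (intro Min_in) auto
  then show ?thesis by simp
qed


section \<open>The finite Weyl group\<close>

text \<open>\<open>Pos a\<close> and \<open>Neg a\<close> index the basis vectors \<open>v_a\<close> and \<open>v_{\bar a}\<close> of \<open>V\<close>.\<close>

datatype 'n bas = Pos 'n | Neg 'n

fun bar :: "'n bas \<Rightarrow> 'n bas" where
  "bar (Pos a) = Neg a"
| "bar (Neg a) = Pos a"

lemma bar_bar [simp]: "bar (bar b) = b"
  by (cases b) auto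

instance bas :: (finite) finite
proof
  have "(UNIV :: 'a bas set) \<subseteq> range Pos \<union> range Neg"
    by (auto simp: image_iff) (metis bas.exhaust)
  then show "finite (UNIV :: 'a bas set)"
    by (rule finite_subset) simp
qed

text \<open>\<open>W_0\<close> as the group of signed permutations; \<open>act\<close> is its action on the basis of \<open>V\<close>.\<close>

typedef 'n weyl = "{w :: 'n bas \<Rightarrow> 'n bas. bij w \<and> (\<forall>b. w (bar b) = bar (w b))}"
  morphisms act Weyl
  by (rule exI[of _ id]) auto

setup_lifting type_definition_weyl

instantiation weyl :: (type) monoid_mult
begin
lift_definition one_weyl :: "'a weyl" is id by auto
lift_definition times_weyl :: "'a weyl \<Rightarrow> 'a weyl \<Rightarrow> 'a weyl" is "\<lambda>u v. u \<circ> v"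
  by (auto intro: bij_comp)
instance by standard (transfer; auto simp: o_assoc)+
end

instance weyl :: (finite) finite
proof
  have "inj (act :: 'a weyl \<Rightarrow> _)" by (simp add: act_inject inj_def)
  then show "finite (UNIV :: 'a weyl set)"
    by (rule finite_imageD[rotated]) (rule finite)
qed

lift_definition srefl :: "'n::{finite,linorder} \<Rightarrow> 'n weyl" is
  "\<lambda>i b. if i = lastix then (if b = Pos i \<or> b = Neg i then bar b else b)
         else map_bas (Transposition.transpose i (nxt i)) b"
proof (intro conjI allI)
  fix i :: 'n and b :: "'n bas"
  let ?f = "\<lambda>b. if i = lastix then (if b = Pos i \<or> b = Neg i then bar b else b)
         else map_bas (Transposition.transpose i (nxt i)) b"
  have "?f (?f b) = b" for b by (cases b) auto
  then show "bij ?f" by (intro o_bij[of ?f]) (auto simp: fun_eq_iff)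
  show "?f (bar b) = bar (?f b)" by (cases b) auto
qed

definition sprod :: "'n::{finite,linorder} list \<Rightarrow> 'n weyl" where
  "sprod is = prod_list (map srefl is)"

definition refl_minus :: "'n::{finite,linorder} \<Rightarrow> 'n \<Rightarrow> 'n weyl" where
  \<comment> \<open>\<open>s_{ij}\<close>, for \<open>i \<noteq> j\<close> in either order\<close>
  "refl_minus i j = sprod (ilist {min i j..<max i j}) * sprod (rev (butlast (ilist {min i j..<max i j})))"

definition refl_long :: "'n::{finite,linorder} \<Rightarrow> 'n weyl" where
  \<comment> \<open>\<open>r_i\<close>\<close>
  "refl_long i = sprod (ilist {i..}) * sprod (rev (ilist {i..<lastix}))"

definition refl_plus :: "'n::{finite,linorder} \<Rightarrow> 'n \<Rightarrow> 'n weyl" where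
  \<comment> \<open>\<open>\<tilde> s_{ij}\<close>\<close>
  "refl_plus i j = refl_long i * refl_long j * refl_minus i j"


section \<open>The affine Weyl group\<close>

text \<open>
  \<open>W\<close> is realised as the semidirect product of \<open>W_0\<close> with the lattice of Laurent monomials:
  \<open>Aff \<mu> w\<close> is \<open>x^\<mu> w\<close>, and \<open>w x^\<mu> w\<inverse> = x^{w \<mu>}\<close>.  The defining relations are proved below.
\<close>

fun signed :: "('n \<Rightarrow> int) \<Rightarrow> 'n bas \<Rightarrow> int" where
  "signed \<mu> (Pos a) = \<mu> a"
| "signed \<mu> (Neg a) = - \<mu> a"

definition wact :: "'n weyl \<Rightarrow> ('n \<Rightarrow> int) \<Rightarrow> 'n \<Rightarrow> int" where
  "wact w \<mu> a = signed \<mu> (inv (act w) (Pos a))"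

datatype 'n aff = Aff (lattice_part: "'n \<Rightarrow> int") (weyl_part: "'n weyl")

lemma signed_bar: "signed \<mu> (bar b) = - signed \<mu> b"
  by (cases b) auto

lemma bij_act: "bij (act w)" and act_bar: "act w (bar b) = bar (act w b)"
  using act[of w] by auto

lemma inv_act_bar: "inv (act w) (bar b) = bar (inv (act w) b)"
  by (metis act_bar bij_act bij_inv_eq_iff)

lemma signed_wact: "signed (wact w \<mu>) b = signed \<mu> (inv (act w) b)"
  by (cases b) (auto simp: wact_def signed_bar inv_act_bar simp flip: bar.simps(1))

lemma wact_one: "wact 1 \<mu> = \<mu>"
  by (auto simp: wact_def one_weyl.rep_eq fun_eq_iff)

lemma wact_times: "wact (u * v) \<mu> = wact u (wact v \<mu>)"
  by (auto simp: wact_def[of "u * v"] wact_def[of u] signed_wact times_weyl.rep_eq fun_eq_iff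
      o_inv_distrib bij_act)

lemma signed_plus: "signed (\<lambda>a. \<kappa> a + \<mu> a) b = signed \<kappa> b + signed \<mu> b"
  by (cases b) auto

lemma wact_plus: "wact w (\<lambda>a. \<kappa> a + \<mu> a) a = wact w \<kappa> a + wact w \<mu> a"
  by (simp add: wact_def signed_plus)

instantiation aff :: (type) monoid_mult
begin
definition "1 = Aff (\<lambda>_. 0) 1"
definition "g * h = Aff (\<lambda>a. lattice_part g a + wact (weyl_part g) (lattice_part h) a)
                        (weyl_part g * weyl_part h)"
instance
proof
  fix f g h :: "'a aff"
  have wact_zero: "wact w (\<lambda>_. 0) = (\<lambda>_. 0)" for w :: "'a weyl"
  proof -
    have "signed (\<lambda>_. 0) b = 0" for b :: "'a bas" by (cases b) auto
    then show ?thesis by (simp add: wact_def fun_eq_iff)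
  qed
  show "f * g * h = f * (g * h)"
    by (simp add: times_aff_def wact_times wact_plus mult.assoc add.assoc)
  show "1 * f = f" "f * 1 = f"
    by (cases f; simp add: times_aff_def one_aff_def wact_one wact_zero)+
qed
end

definition xaff :: "'n \<Rightarrow> int \<Rightarrow> 'n aff" where
  "xaff i e = Aff (\<lambda>a. if a = i then e else 0) 1"

definition waff :: "'n weyl \<Rightarrow> 'n aff" where
  "waff w = Aff (\<lambda>_. 0) w"

lemma waff_times: "waff (u * v) = waff u * waff v"
proof -
  have "signed (\<lambda>_. 0) b = 0" for b :: "'a bas" by (cases b) auto
  then show ?thesis by (simp add: waff_def times_aff_def wact_def)
qed

lemma srefl_srefl: "srefl i * srefl i = 1"
proof -
  have "act (srefl i) (act (srefl i) b) = b" for b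
    by (cases b) (auto simp: srefl.rep_eq)
  then show ?thesis
    by (simp add: one_weyl.rep_eq times_weyl.rep_eq fun_eq_iff flip: act_inject)
qed

lemma inv_act_srefl: "inv (act (srefl i)) = act (srefl i)"
  by (metis inv_unique_comp one_weyl.rep_eq srefl_srefl times_weyl.rep_eq)

lemma wact_srefl: "wact (srefl i) \<mu> a = signed \<mu> (act (srefl i) (Pos a))"
  by (simp add: wact_def inv_act_srefl)

lemma act_srefl_Pos: "act (srefl i) (Pos a) =
    (if i = lastix then if a = i then Neg a else Pos a else Pos (Transposition.transpose i (nxt i) a))"
  by (auto simp: srefl.rep_eq)

lemma affine_relations:
  fixes i j :: "'n::{finite,linorder}"
  shows "xaff i d * xaff j e = xaff j e * xaff i d"
    and "xaff i 1 * xaff i (-1) = 1"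
    and "i \<noteq> lastix \<Longrightarrow> waff (srefl i) * xaff i 1 * waff (srefl i) = xaff (nxt i) 1"
    and "waff (srefl lastix) * xaff lastix 1 * waff (srefl lastix) = xaff (lastix :: 'n) (-1)"
    and "\<lbrakk>j \<noteq> i; i \<noteq> lastix \<longrightarrow> j \<noteq> nxt i\<rbrakk> \<Longrightarrow>
           waff (srefl i) * xaff j 1 = xaff j 1 * waff (srefl i)"
  using nxt_greater[of i]
  by (auto simp: times_aff_def xaff_def waff_def one_aff_def wact_one srefl_srefl wact_srefl
      act_srefl_Pos fun_eq_iff Transposition.transpose_def)

definition s0 :: "'n::{finite,linorder} aff" where
  "s0 = xaff firstix (-1) * waff (refl_long firstix)"


section \<open>The degenerate affine Hecke algebra\<close>

text \<open>
  \<open>'n free\<close> is the free associative unital algebra on generators \<open>w \<in> W_0\<close> and \<open>y_j\<close>, that is the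
  monoid algebra of the free monoid.  The degenerate affine Hecke algebra is its quotient by the
  two-sided ideal \<open>hecke_ideal k \<alpha>\<close>; the first two families of relations (the multiplication table
  of \<open>W_0\<close>) are the relations of \<open>W_0\<close>.
\<close>

datatype 'n hgen = GW "'n weyl" | GY 'n

datatype 'a fmon = FMon "'a list"

instantiation fmon :: (type) monoid_add
begin
definition "0 = FMon []"
fun plus_fmon where "plus_fmon (FMon u) (FMon v) = FMon (u @ v)"
instance
proof
  fix a b c :: "'a fmon"
  show "a + b + c = a + (b + c)" by (cases a; cases b; cases c) simp
  show "0 + a = a" "a + 0 = a" by (cases a; simp add: zero_fmon_def)+
qed
end

type_synonym 'n free = "'n hgen fmon \<Rightarrow>\<^sub>0 complex"

definition hgen :: "'n hgen \<Rightarrow> 'n free" where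
  "hgen g = Poly_Mapping.single (FMon [g]) 1"

abbreviation hw :: "'n weyl \<Rightarrow> 'n free" where "hw w \<equiv> hgen (GW w)"
abbreviation hy :: "'n \<Rightarrow> 'n free" where "hy j \<equiv> hgen (GY j)"

definition scal :: "complex \<Rightarrow> 'n free" where
  "scal z = Poly_Mapping.single 0 z"

inductive_set hecke_ideal :: "complex \<Rightarrow> complex \<Rightarrow> 'n::{finite,linorder} free set"
  for k \<alpha> :: complex where
  rel_one: "hw 1 - 1 \<in> hecke_ideal k \<alpha>"
| rel_mult: "hw u * hw v - hw (u * v) \<in> hecke_ideal k \<alpha>"
| rel_yy: "hy i * hy j - hy j * hy i \<in> hecke_ideal k \<alpha>"
| rel_ys: "i \<noteq> lastix \<Longrightarrow>
    hy i * hw (srefl i) - (hw (srefl i) * hy (nxt i) + scal k) \<in> hecke_ideal k \<alpha>"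
| rel_ys_last:
    "hy lastix * hw (srefl lastix) - (- (hw (srefl lastix) * hy lastix) + scal (2 * \<alpha>))
       \<in> hecke_ideal k \<alpha>"
| rel_far: "\<lbrakk>j \<noteq> i; i \<noteq> lastix \<longrightarrow> j \<noteq> nxt i\<rbrakk> \<Longrightarrow>
    hw (srefl i) * hy j - hy j * hw (srefl i) \<in> hecke_ideal k \<alpha>"
| ideal_add: "\<lbrakk>a \<in> hecke_ideal k \<alpha>; b \<in> hecke_ideal k \<alpha>\<rbrakk> \<Longrightarrow> a + b \<in> hecke_ideal k \<alpha>"
| ideal_mult: "a \<in> hecke_ideal k \<alpha> \<Longrightarrow> r * a * s \<in> hecke_ideal k \<alpha>"

type_synonym 'n cvec = "(complex, 'n) vec"

type_synonym 'n ypoly = "('n \<Rightarrow>\<^sub>0 nat) \<Rightarrow>\<^sub>0 complex"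

definition ypoly_eval :: "'n::finite ypoly \<Rightarrow> 'n cvec \<Rightarrow> complex" where
  "ypoly_eval p y = (\<Sum>\<mu>\<in>Poly_Mapping.keys p.
     Poly_Mapping.lookup p \<mu> * (\<Prod>i\<in>UNIV. (y $ i) ^ Poly_Mapping.lookup \<mu> i))"

definition ypoly_free :: "'n::{finite,linorder} ypoly \<Rightarrow> 'n free" where
  \<comment> \<open>\<open>p(y_1, \<dots>, y_n)\<close>; modulo \<open>hecke_ideal\<close> the order of the commuting factors is immaterial\<close>
  "ypoly_free p = (\<Sum>\<mu>\<in>Poly_Mapping.keys p. scal (Poly_Mapping.lookup p \<mu>) *
     prod_list (map (\<lambda>i. hy i ^ Poly_Mapping.lookup \<mu> i) (ilist UNIV)))"

definition normal_form ::
    "complex \<Rightarrow> complex \<Rightarrow> 'n::{finite,linorder} free \<Rightarrow> 'n weyl \<Rightarrow> 'n ypoly" where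
  \<comment> \<open>the \<open>p_{w'}\<close> with \<open>h = \<Sum> w' p_{w'}(y)\<close> in the Hecke algebra; unique by its vector space
      isomorphism with \<open>\<complex>[W_0] \<otimes> \<complex>[y]\<close>\<close>
  "normal_form k \<alpha> h = (THE p. h - (\<Sum>w\<in>UNIV. hw w * ypoly_free (p w)) \<in> hecke_ideal k \<alpha>)"


section \<open>Meromorphic functions\<close>

type_synonym 'n pt = "'n cvec \<times> 'n cvec"

definition torus :: "('n::finite cvec) set" where
  "torus = {x. \<forall>i. x $ i \<noteq> 0}"

definition holomorphic_pt :: "('n::finite pt \<Rightarrow> complex) \<Rightarrow> 'n pt set \<Rightarrow> bool" where
  "holomorphic_pt f S \<longleftrightarrow> (\<forall>p\<in>S. \<exists>f'. (f has_derivative f') (at p) \<and>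
     (\<forall>t u v. f' (t *s u, t *s v) = t * f' (u, v)))"

text \<open>
  A meromorphic function on \<open>D \<times> \<complex>^n\<close> is represented by a total function which locally is a
  quotient \<open>g / h\<close> of holomorphic functions, \<open>h\<close> vanishing on no nonempty open set; its values at the
  zeros of \<open>h\<close> are irrelevant.  Accordingly, identities between meromorphic functions are
  identities that hold on a dense open subset (\<open>generic\<close>).  For \<open>D = torus\<close> this gives the field
  of meromorphic functions on the whole space.
\<close>

definition mero :: "('n::finite cvec) set \<Rightarrow> ('n pt \<Rightarrow> complex) \<Rightarrow> bool" where
  "mero D f \<longleftrightarrow> (\<forall>p \<in> D \<times> UNIV. \<exists>S g h. open S \<and> p \<in> S \<and> S \<subseteq> D \<times> UNIV \<and>
     holomorphic_pt g S \<and> holomorphic_pt h S \<and> S \<subseteq> closure {q \<in> S. h q \<noteq> 0} \<and>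
     (\<forall>q\<in>S. h q \<noteq> 0 \<longrightarrow> f q = g q / h q))"

definition generic :: "('n::finite cvec) set \<Rightarrow> ('n pt \<Rightarrow> bool) \<Rightarrow> bool" where
  "generic D P \<longleftrightarrow> (\<exists>S. open S \<and> S \<subseteq> D \<times> UNIV \<and> D \<times> UNIV \<subseteq> closure S \<and> (\<forall>p\<in>S. P p))"

text \<open>Vectors with meromorphic coordinates with respect to a basis indexed by \<open>'b\<close>; for
  \<open>'b = 'n weyl\<close> this is \<open>\<complex>[W_0]\<close> with meromorphic coefficients.\<close>

definition mero_vec :: "('n::finite cvec) set \<Rightarrow> ('n pt \<Rightarrow> 'b \<Rightarrow> complex) \<Rightarrow> bool" where
  "mero_vec D F \<longleftrightarrow> (\<forall>b. mero D (\<lambda>p. F p b))"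

definition upd :: "'n::finite cvec \<Rightarrow> 'n \<Rightarrow> complex \<Rightarrow> 'n cvec" where
  "upd x a t = (\<chi> i. if i = a then t else x $ i)"

definition shift :: "complex \<Rightarrow> 'n \<Rightarrow> ('n::finite pt \<Rightarrow> 'b) \<Rightarrow> 'n pt \<Rightarrow> 'b" where
  "shift c m F p = F (fst p, upd (snd p) m (snd p $ m - c))"

definition pd :: "'n::finite \<Rightarrow> ('n cvec \<Rightarrow> complex) \<Rightarrow> 'n cvec \<Rightarrow> complex" where
  "pd a u x = deriv (\<lambda>t. u (upd x a t)) (x $ a)"


section \<open>The function \<open>U\<close>\<close>

text \<open>
  \<open>U\<close> is multivalued.  \<open>U_det c k \<alpha> \<beta> D U\<close> says that \<open>U\<close> is a (single-valued) determination of it on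
  \<open>D\<close>: a meromorphic function which, near every point of \<open>D\<close> where none of the powers degenerates,
  is given by the defining product for some continuous choice of the logarithms in
  \<open>z^e = exp (e log z)\<close>.
\<close>

definition regular_pt :: "'n::{finite,linorder} cvec \<Rightarrow> bool" where
  "regular_pt x \<longleftrightarrow> (\<forall>p. x $ p \<noteq> 0 \<and> 1 + x $ p \<noteq> 0 \<and> 1 - x $ p \<noteq> 0) \<and>
     (\<forall>p l. p < l \<longrightarrow> (1 - x $ p * x $ l) * (x $ p - x $ l) \<noteq> 0)"

definition U_det :: "complex \<Rightarrow> complex \<Rightarrow> complex \<Rightarrow> complex \<Rightarrow>
    ('n::{finite,linorder} cvec) set \<Rightarrow> ('n cvec \<Rightarrow> complex) \<Rightarrow> bool" where
  "U_det c k \<alpha> \<beta> D U \<longleftrightarrow> mero D (\<lambda>p. U (fst p)) \<and>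
    (\<forall>x\<in>D. regular_pt x \<longrightarrow> (\<exists>S l0 l1 l2 l3. open S \<and> x \<in> S \<and> S \<subseteq> D \<and>
      (\<forall>p. continuous_on S (l0 p) \<and> (\<forall>z\<in>S. exp (l0 p z) = z $ p)) \<and>
      (\<forall>p. continuous_on S (l1 p) \<and> (\<forall>z\<in>S. exp (l1 p z) = 1 + z $ p)) \<and>
      (\<forall>p. continuous_on S (l2 p) \<and> (\<forall>z\<in>S. exp (l2 p z) = 1 - z $ p)) \<and>
      (\<forall>p l. p < l \<longrightarrow> continuous_on S (l3 p l) \<and>
         (\<forall>z\<in>S. exp (l3 p l z) = (1 - z $ p * z $ l) * (z $ p - z $ l))) \<and>
      (\<forall>z\<in>S. U z =
         (\<Prod>p\<in>UNIV. exp ((k * (of_nat CARD('n) - 1) + \<alpha>) / c * l0 p z)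
                  * exp ((\<beta> - \<alpha>) / c * l1 p z)
                  * exp (- (\<beta> + \<alpha>) / c * l2 p z))
         * (\<Prod>(p, l) | p < l. exp (- k / c * l3 p l z)))))"

definition gauge_transform :: "('n::finite cvec \<Rightarrow> complex) \<Rightarrow> ('n pt \<Rightarrow> 'b \<Rightarrow> complex) \<Rightarrow> 'n pt \<Rightarrow> 'b \<Rightarrow> complex" where
  "gauge_transform U F p b = U (fst p) * F p b"


section \<open>The first system\<close>

text \<open>
  Linear operators over the field of meromorphic functions are given by their values at a point
  \<open>(x, y)\<close>.  \<open>lin M\<close> is the linear map sending the \<open>a\<close>-th basis vector to \<open>\<Sum> b. M a b \<cdot> b\<close>.
\<close>

definition lin :: "('a::finite \<Rightarrow> 'b \<Rightarrow> complex) \<Rightarrow> ('a \<Rightarrow> complex) \<Rightarrow> 'b \<Rightarrow> complex" where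
  "lin M F b = (\<Sum>a\<in>UNIV. F a * M a b)"

definition comp_list :: "('a \<Rightarrow> 'a) list \<Rightarrow> 'a \<Rightarrow> 'a" where
  \<comment> \<open>\<open>comp_list [A, B, C] = A \<circ> B \<circ> C\<close>\<close>
  "comp_list fs = foldr (\<circ>) fs id"

definition etaL :: "complex \<Rightarrow> complex \<Rightarrow> 'n::{finite,linorder} free \<Rightarrow> 'n cvec \<Rightarrow>
    ('n weyl \<Rightarrow> complex) \<Rightarrow> 'n weyl \<Rightarrow> complex" where
  "etaL k \<alpha> h y = lin (\<lambda>w w'. ypoly_eval (normal_form k \<alpha> (h * hw w) w') y)"

definition xmonom :: "('n::finite \<Rightarrow> int) \<Rightarrow> 'n cvec \<Rightarrow> complex" where
  "xmonom \<mu> x = (\<Prod>i\<in>UNIV. (x $ i) powi \<mu> i)"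

definition etaR :: "('n::{finite,linorder} aff \<Rightarrow>\<^sub>0 complex) \<Rightarrow> 'n cvec \<Rightarrow>
    ('n weyl \<Rightarrow> complex) \<Rightarrow> 'n weyl \<Rightarrow> complex" where
  \<comment> \<open>the inner sum is \<open>q_{w'}(x)\<close> for \<open>w \<xi> = \<Sum> q_{w'}(x) w'\<close> in \<open>\<complex>[W]\<close>\<close>
  "etaR \<xi> x = lin (\<lambda>w w'. \<Sum>g | g \<in> Poly_Mapping.keys \<xi> \<and> weyl_part (waff w * g) = w'.
     Poly_Mapping.lookup \<xi> g * xmonom (lattice_part (waff w * g)) x)"

definition gel :: "'n aff \<Rightarrow> 'n aff \<Rightarrow>\<^sub>0 complex" where
  "gel g = Poly_Mapping.single g 1"

definition K0bar :: "complex \<Rightarrow> complex \<Rightarrow> 'n::{finite,linorder} cvec \<Rightarrow> complex \<Rightarrow>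
    ('n weyl \<Rightarrow> complex) \<Rightarrow> 'n weyl \<Rightarrow> complex" where
  "K0bar c \<beta> x z F w = ((z + c/2) * etaR (gel s0) x F w + \<beta> * F w) / (z + \<beta> + c/2)"

definition Rbar :: "complex \<Rightarrow> 'n::{finite,linorder} cvec \<Rightarrow> 'n \<Rightarrow> complex \<Rightarrow>
    ('n weyl \<Rightarrow> complex) \<Rightarrow> 'n weyl \<Rightarrow> complex" where
  "Rbar k x i z F w = (z * etaR (gel (waff (srefl i))) x F w + k * F w) / (z + k)"

definition Knbar :: "complex \<Rightarrow> 'n::{finite,linorder} cvec \<Rightarrow> complex \<Rightarrow>
    ('n weyl \<Rightarrow> complex) \<Rightarrow> 'n weyl \<Rightarrow> complex" where
  "Knbar \<alpha> x z F w = (z * etaR (gel (waff (srefl lastix))) x F w - \<alpha> * F w) / (z - \<alpha>)"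

definition Cbar :: "complex \<Rightarrow> complex \<Rightarrow> complex \<Rightarrow> complex \<Rightarrow> 'n::{finite,linorder} \<Rightarrow> 'n pt \<Rightarrow>
    ('n weyl \<Rightarrow> complex) \<Rightarrow> 'n weyl \<Rightarrow> complex" where
  "Cbar c k \<alpha> \<beta> m p = (let x = fst p; y = ($) (snd p); R = Rbar k x in
       comp_list (map (\<lambda>i. R i (y (nxt i) - y m)) (ilist {m..<lastix}))
     \<circ> Knbar \<alpha> x (y m)
     \<circ> comp_list (map (\<lambda>i. R i (- y m - y (nxt i))) (rev (ilist {m..<lastix})))
     \<circ> comp_list (map (\<lambda>i. R i (- y i - y m)) (rev (ilist {..<m})))
     \<circ> K0bar c \<beta> x (- y m)
     \<circ> comp_list (map (\<lambda>i. R i (y i - y m + c)) (ilist {..<m})))"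

definition Lop :: "complex \<Rightarrow> complex \<Rightarrow> complex \<Rightarrow> 'n::{finite,linorder} \<Rightarrow> 'n pt \<Rightarrow>
    ('n weyl \<Rightarrow> complex) \<Rightarrow> 'n weyl \<Rightarrow> complex" where
  "Lop k \<alpha> \<beta> a p F w = (let x = ($) (fst p); \<eta> = (\<lambda>h. etaL k \<alpha> h (snd p) F w) in
     \<eta> (hy a) + 2 * ((\<alpha> + \<beta> * x a) / ((x a)^2 - 1)) * \<eta> (hw (refl_long a))
     + k * ((\<Sum>j | j < a. x a / (x a - x j) * \<eta> (hw (refl_minus j a)))
          + (\<Sum>j | a < j. x j / (x a - x j) * \<eta> (hw (refl_minus a j)))
          + (\<Sum>j | j \<noteq> a. 1 / (x a * x j - 1) * \<eta> (hw (refl_plus a j)))))"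

text \<open>The logarithmic derivative of \<open>U\<close> does not depend on the determination.\<close>

definition first_system :: "complex \<Rightarrow> complex \<Rightarrow> complex \<Rightarrow> complex \<Rightarrow>
    ('n::{finite,linorder} cvec) set \<Rightarrow> ('n cvec \<Rightarrow> complex) \<Rightarrow>
    ('n pt \<Rightarrow> 'n weyl \<Rightarrow> complex) \<Rightarrow> bool" where
  "first_system c k \<alpha> \<beta> D U G \<longleftrightarrow>
     (\<forall>m. generic D (\<lambda>p. Cbar c k \<alpha> \<beta> m p (shift c m G p) = G p)) \<and>
     (\<forall>a. generic D (\<lambda>(x, y). \<forall>w.
        c * x $ a * pd a (\<lambda>x'. G (x', y) w) x
        + Lop k \<alpha> \<beta> a (x, y) (G (x, y)) w
        + c * x $ a * (pd a U x / U x) * G (x, y) w = 0))"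


section \<open>The second system\<close>

text \<open>
  An element of \<open>V^{\<otimes>n}\<close> is given by its coordinates: \<open>u \<iota>\<close> is the coefficient of
  \<open>v_{\<iota>(1)} \<otimes> \<dots> \<otimes> v_{\<iota>(n)}\<close>.  An operator \<open>M\<close> on \<open>V\<close> is given by its matrix, \<open>M a b\<close> being the
  coefficient of \<open>v_a\<close> in \<open>M v_b\<close>; \<open>at_pos j M\<close> is \<open>M\<close> acting on the \<open>j\<close>-th tensor factor.
\<close>

type_synonym 'n tens = "('n \<Rightarrow> 'n bas) \<Rightarrow> complex"
type_synonym 'n mat1 = "'n bas \<Rightarrow> 'n bas \<Rightarrow> complex"

definition at_pos :: "'n::finite \<Rightarrow> 'n mat1 \<Rightarrow> 'n tens \<Rightarrow> 'n tens" where
  "at_pos j M u \<iota> = (\<Sum>b\<in>UNIV. M (\<iota> j) b * u (\<iota>(j := b)))"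

definition flip :: "'n \<Rightarrow> 'n \<Rightarrow> 'n tens \<Rightarrow> 'n tens" where
  "flip i j u \<iota> = u (\<iota> \<circ> Transposition.transpose i j)"

definition Rmat :: "complex \<Rightarrow> 'n \<Rightarrow> 'n \<Rightarrow> complex \<Rightarrow> 'n tens \<Rightarrow> 'n tens" where
  "Rmat k i j z u \<iota> = (z * u \<iota> + k * flip i j u \<iota>) / (z + k)"

fun Tmat :: "'n::finite cvec \<Rightarrow> 'n mat1" where
  "Tmat x (Neg a) (Pos b) = (if a = b then inverse (x $ b) else 0)"
| "Tmat x (Pos a) (Neg b) = (if a = b then x $ b else 0)"
| "Tmat x _ _ = 0"

definition Kmat :: "complex \<Rightarrow> 'n::finite cvec \<Rightarrow> complex \<Rightarrow> 'n mat1" where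
  "Kmat z x b = (\<lambda>p q. (z * Tmat x p q + (if p = q then b else 0)) / (z + b))"

definition Qop :: "complex \<Rightarrow> complex \<Rightarrow> complex \<Rightarrow> complex \<Rightarrow> 'n::{finite,linorder} \<Rightarrow> 'n pt \<Rightarrow>
    'n tens \<Rightarrow> 'n tens" where
  "Qop c k \<alpha> \<beta> m p = (let x = fst p; y = ($) (snd p); R = Rmat k in
       comp_list (map (\<lambda>i. R m i (y m - y i - c)) (rev (ilist {..<m})))
     \<circ> at_pos m (Kmat (y m - c/2) x \<beta>)
     \<circ> comp_list (map (\<lambda>i. R i m (y i + y m)) (ilist {..<m}))
     \<circ> comp_list (map (\<lambda>i. R m i (y m + y i)) (ilist {m<..}))
     \<circ> at_pos m (Kmat (y m) (\<chi> i. 1) \<alpha>)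
     \<circ> comp_list (map (\<lambda>i. R m i (y m - y i)) (rev (ilist {m<..}))))"

definition unit :: "'n bas \<Rightarrow> 'n bas \<Rightarrow> 'n mat1" where
  "unit a b = (\<lambda>p q. if p = a \<and> q = b then 1 else 0)"

definition Emat :: "'n \<Rightarrow> 'n \<Rightarrow> 'n mat1" where
  "Emat a b = (\<lambda>p q. unit (Pos a) (Pos b) p q + unit (Neg a) (Neg b) p q)"

definition Ebarmat :: "'n \<Rightarrow> 'n \<Rightarrow> 'n mat1" where
  "Ebarmat a b = (\<lambda>p q. unit (Pos a) (Neg b) p q + unit (Neg a) (Pos b) p q)"

definition Xop :: "'n::{finite,linorder} \<Rightarrow> 'n \<Rightarrow> 'n tens \<Rightarrow> 'n tens" where
  "Xop a b u \<iota> = (\<Sum>(i, j) | i < j.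
      at_pos i (unit (Pos a) (Pos b)) (at_pos j (Emat b a) u) \<iota>
    + at_pos i (unit (Neg b) (Neg a)) (at_pos j (Emat a b) u) \<iota>)"

definition Yop :: "'n::{finite,linorder} \<Rightarrow> 'n \<Rightarrow> 'n tens \<Rightarrow> 'n tens" where
  "Yop a b u \<iota> = (\<Sum>(i, j) | i < j.
      at_pos i (unit (Pos a) (Neg b)) (at_pos j (Ebarmat b a) u) \<iota>
    + at_pos i (unit (Pos b) (Neg a)) (at_pos j (Ebarmat a b) u) \<iota>)"

definition Zop :: "'n::{finite,linorder} \<Rightarrow> 'n \<Rightarrow> 'n tens \<Rightarrow> 'n tens" where
  "Zop a b u \<iota> = (\<Sum>(i, j) | i < j.
      at_pos i (unit (Neg a) (Pos b)) (at_pos j (Ebarmat b a) u) \<iota>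
    + at_pos i (unit (Neg b) (Pos a)) (at_pos j (Ebarmat a b) u) \<iota>)"

definition Aop :: "complex \<Rightarrow> complex \<Rightarrow> 'n::{finite,linorder} \<Rightarrow> 'n cvec \<Rightarrow>
    'n tens \<Rightarrow> 'n tens" where
  "Aop k \<alpha> a y u \<iota> =
      (\<Sum>j\<in>UNIV. y $ j * (at_pos j (unit (Pos a) (Pos a)) u \<iota> - at_pos j (unit (Neg a) (Neg a)) u \<iota>))
    + 2 * \<alpha> * (\<Sum>j\<in>UNIV. at_pos j (unit (Pos a) (Neg a)) u \<iota>)
    + k * (- (\<Sum>p | p < a. Xop p a u \<iota>) + (\<Sum>p | a < p. Xop a p u \<iota>) + (\<Sum>p\<in>UNIV. Yop a p u \<iota>))"

definition Bop :: "complex \<Rightarrow> complex \<Rightarrow> complex \<Rightarrow> 'n::{finite,linorder} \<Rightarrow> 'n cvec \<Rightarrow>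
    'n tens \<Rightarrow> 'n tens" where
  "Bop k \<alpha> \<beta> a x u \<iota> =
      2 * ((\<alpha> + \<beta> * x $ a) / ((x $ a)^2 - 1)) * (\<Sum>j\<in>UNIV. at_pos j (Ebarmat a a) u \<iota>)
    + k * ((\<Sum>p | p < a. x $ a / (x $ a - x $ p) * (Xop a p u \<iota> + Xop p a u \<iota>))
         + (\<Sum>p | a < p. x $ p / (x $ a - x $ p) * (Xop a p u \<iota> + Xop p a u \<iota>))
         + (\<Sum>p\<in>UNIV. 1 / (x $ a * x $ p - 1) * (Yop a p u \<iota> + Zop a p u \<iota>)))"

definition Dop :: "complex \<Rightarrow> complex \<Rightarrow> complex \<Rightarrow> complex \<Rightarrow> 'n::{finite,linorder} \<Rightarrow>
    ('n pt \<Rightarrow> 'n tens) \<Rightarrow> 'n pt \<Rightarrow> 'n tens" where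
  "Dop c k \<alpha> \<beta> a f p \<iota> =
      c * fst p $ a * pd a (\<lambda>x'. f (x', snd p) \<iota>) (fst p)
    + Aop k \<alpha> a (snd p) (f p) \<iota> + Bop k \<alpha> \<beta> a (fst p) (f p) \<iota>"

definition second_system :: "complex \<Rightarrow> complex \<Rightarrow> complex \<Rightarrow> complex \<Rightarrow>
    ('n::{finite,linorder} cvec) set \<Rightarrow> ('n pt \<Rightarrow> 'n tens) \<Rightarrow> bool" where
  "second_system c k \<alpha> \<beta> D f \<longleftrightarrow>
     (\<forall>m. generic D (\<lambda>p. shift c m f p = Qop c k \<alpha> \<beta> m p (f p))) \<and>
     (\<forall>a. generic D (\<lambda>p. Dop c k \<alpha> \<beta> a f p = (\<lambda>_. 0)))"


section \<open>The space \<open>(V^{\<otimes>n})_0\<close> and the map \<open>\<phi>\<close>\<close>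

definition tact :: "'n weyl \<Rightarrow> 'n tens \<Rightarrow> 'n tens" where
  \<comment> \<open>diagonal action: \<open>w (v_{\<iota>(1)} \<otimes> \<dots>) = v_{w \<iota>(1)} \<otimes> \<dots>\<close>\<close>
  "tact w u \<iota> = u (inv (act w) \<circ> \<iota>)"

definition vtop :: "'n tens" where
  \<comment> \<open>\<open>v_1 \<otimes> \<dots> \<otimes> v_n\<close>\<close>
  "vtop \<iota> = (if \<iota> = Pos then 1 else 0)"

definition phi :: "('n::{finite,linorder} weyl \<Rightarrow> complex) \<Rightarrow> 'n tens" where
  "phi = lin (\<lambda>w. tact w vtop)"

definition V0 :: "'n::{finite,linorder} tens set" where
  "V0 = {(\<lambda>\<iota>. \<Sum>w\<in>UNIV. a w * tact w vtop \<iota>) | a. True}"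

definition mero_V0 :: "('n::{finite,linorder} cvec) set \<Rightarrow> ('n pt \<Rightarrow> 'n tens) \<Rightarrow> bool" where
  "mero_V0 D f \<longleftrightarrow> mero_vec D f \<and> generic D (\<lambda>p. f p \<in> V0)"

end

theory Submission
  imports Defs
begin

text \<open>
  The gauge factor only removes the term with the logarithmic derivative of \<open>U\<close>, so everything rests
  on two pointwise operator identities on \<open>(V^{\<otimes>n})_0\<close>.

  For the differential equations: in the degenerate affine Hecke algebra \<open>y_b w\<close> equals
  \<open>w y_{w\<inverse> b}\<close> plus the multiples \<open>\<pm> k\<close>, \<open>\<pm> 2 \<alpha>\<close> of \<open>s w\<close>, for the reflections \<open>s\<close> not fixing
  \<open>b\<close> whose positive root is made negative by \<open>w\<inverse>\<close>.  In terms of the position and sign at which the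
  letters of the root occur in \<open>w (v_1 \<otimes> \<dots> \<otimes> v_n)\<close>, this is precisely what the operators \<open>X\<close>, \<open>Y\<close>,
  \<open>Z\<close> record, so that \<open>A_a + B_a = \<phi> L_a \<phi>\<inverse>\<close>.  That this expansion is the normal form needs the
  linear independence of the \<open>w y^\<mu>\<close>, which follows from letting the algebra act on
  \<open>\<complex>[W_0] \<otimes> \<complex>[y]\<close> by the same formula.

  For the difference equations: right multiplication by reflections becomes permutation of tensor
  factors.  Every factor of \<open>C(1, \<epsilon>_m)\<close> is inverted by reversing its spectral parameter, and moving
  all flips in the product of the inverses to one side yields \<open>Q_m\<close>.
\<close>

section \<open>Reflections and generation of the finite Weyl group\<close>

text \<open>Signed letters remove most case distinctions: \<open>refl b b'\<close> is the reflection
  in the root e_b - e_b', where a barred letter has e_{bar b} = - e_b, so short, long and sum-type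
  roots, and likewise X, Y and Z, differ only in the signs of two letters. The delicate point on the
  algebraic side is that \<open>normal_form\<close> is a definite description: uniqueness is needed
  besides the expansion of y_b w modulo the ideal. It requires the candidate formula to define a
  representation, and the hard relation there is the commutation of the y's. Both the representation
  and the expansion rest on one cocycle rule, \<open>gcoef_srefl\<close>. On the analytic side,
  total division and arbitrary values at poles are the obstacle: C is inverted only away from the
  hyperplanes in y where a factor degenerates, and the product rule is applied only where the
  representing functions are differentiable. These conditions hold on dense open sets, and there the
  equivalence is proved point by point.\<close>

lemma weyl_eqI: "(\<And>b. act u b = act v b) \<Longrightarrow> u = v"
  by (metis act_inject ext)

lemma act_one [simp]: "act 1 b = b"
  by (simp add: one_weyl.rep_eq)

lemma act_times [simp]: "act (u * v) b = act u (act v b)"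
  by (simp add: times_weyl.rep_eq)

lemma act_eq_iff [simp]: "act w b = act w b' \<longleftrightarrow> b = b'"
  using bij_act[of w] by (meson bij_betw_imp_inj_on inj_eq)

lemma bar_eq_iff [simp]: "bar b = bar b' \<longleftrightarrow> b = b'"
  by (metis bar_bar)

lemma bar_neq [simp]: "bar b \<noteq> b" "b \<noteq> bar b"
  by (cases b; simp)+

lift_definition winv :: "'n weyl \<Rightarrow> 'n weyl" is inv
  by (metis bij_imp_bij_inv bij_inv_eq_iff)

lemma act_winv [simp]: "act w (act (winv w) b) = b" "act (winv w) (act w b) = b"
  by (simp_all add: winv.rep_eq bij_act bij_is_surj surj_f_inv_f bij_is_inj)

lemma winv_mult [simp]: "winv w * w = 1" "w * winv w = 1"
  by (rule weyl_eqI; simp)+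

lemma winv_mult_assoc [simp]: "winv w * (w * v) = v" "w * (winv w * v) = v"
  by (rule weyl_eqI; simp)+

lemma winv_times: "winv (u * v) = winv v * winv u"
  by (rule weyl_eqI) (metis act_times act_winv)

lemma winv_one [simp]: "winv 1 = 1"
  by (metis mult_1 winv_mult(2))

lemma act_winv_eq: "act (winv w) b = b' \<longleftrightarrow> b = act w b'"
  by (metis act_winv)

lemma act_winv_bar: "act (winv w) (bar b) = bar (act (winv w) b)"
  by (simp add: act_bar)

lemma inv_act: "inv (act w) = act (winv w)"
  by (simp add: winv.rep_eq)

text \<open>The pairs (\<open>Pos i\<close>, \<open>Pos j\<close>), (\<open>Pos i\<close>,
  \<open>Neg j\<close>) and (\<open>Pos i\<close>, \<open>Neg i\<close>) give s_{ij}, its tilde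
  version and r_i. Equal letters give the identity, so that sums may run over all letters b' without
  exceptions.\<close>

lift_definition refl :: "'n bas \<Rightarrow> 'n bas \<Rightarrow> 'n weyl" is
  "\<lambda>b b' x. if x = b then b' else if x = b' then b
     else if x = bar b then bar b' else if x = bar b' then bar b else x"
proof (intro conjI allI)
  fix b b' x :: "'n bas"
  let ?f = "\<lambda>x. if x = b then b' else if x = b' then b
     else if x = bar b then bar b' else if x = bar b' then bar b else x"
  have "?f (?f x) = x" for x
    by (auto dest: arg_cong[of _ _ bar])
  then show "bij ?f" by (intro o_bij[of ?f]) (auto simp: fun_eq_iff)
  show "?f (bar x) = bar (?f x)"
    by (auto dest: arg_cong[of _ _ bar])
qed

lemma refl_refl [simp]: "refl b b' * refl b b' = 1"
  by (rule weyl_eqI) (auto simp: refl.rep_eq dest: arg_cong[of _ _ bar])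

lemma refl_refl_assoc [simp]: "refl b b' * (refl b b' * w) = w"
  by (simp flip: mult.assoc)

lemma winv_refl [simp]: "winv (refl b b') = refl b b'"
  by (metis mult.right_neutral refl_refl winv_mult_assoc(1))

lemma refl_commute: "refl b b' = refl b' b"
  by (rule weyl_eqI) (auto simp: refl.rep_eq dest: arg_cong[of _ _ bar])

lemma refl_bar: "refl (bar b) (bar b') = refl b b'"
  by (rule weyl_eqI) (auto simp: refl.rep_eq dest: arg_cong[of _ _ bar])

lemma act_refl_left [simp]: "act (refl b b') b = b'" and act_refl_right [simp]: "act (refl b b') b' = b"
  by (auto simp: refl.rep_eq)

lemma refl_conj: "w * refl b b' = refl (act w b) (act w b') * w"
  by (rule weyl_eqI) (auto simp: refl.rep_eq simp flip: act_bar)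

lemma srefl_last: "srefl lastix = refl (Pos lastix) (Neg lastix)"
  by (rule weyl_eqI) (auto simp: srefl.rep_eq refl.rep_eq)

lemma srefl_nonlast: "i \<noteq> lastix \<Longrightarrow> srefl i = refl (Pos i) (Pos (nxt i))"
proof (rule weyl_eqI)
  fix b assume "i \<noteq> lastix"
  then show "act (srefl i) b = act (refl (Pos i) (Pos (nxt i))) b"
    by (cases b) (auto simp: srefl.rep_eq refl.rep_eq Transposition.transpose_def)
qed

lemma winv_srefl [simp]: "winv (srefl i) = srefl i"
  by (metis mult.right_neutral srefl_srefl winv_mult_assoc(1))

lemma srefl_srefl_assoc [simp]: "srefl i * (srefl i * w) = w"
  by (simp add: srefl_srefl flip: mult.assoc)

lemma act_srefl_srefl [simp]: "act (srefl i) (act (srefl i) b) = b"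
  by (metis act_one act_times srefl_srefl)

section \<open>Successors, induction and sorted intervals in a finite linear order\<close>

lemma nxt_le: "i < j \<Longrightarrow> nxt i \<le> j"
  unfolding nxt_def by (intro Min_le) auto

lemma le_lastix [simp]: "i \<le> lastix"
  by simp

lemma less_imp_nonlast: "i < j \<Longrightarrow> i \<noteq> lastix"
  using le_lastix[of j] by auto

text \<open>The index type carries no arithmetic, so this and \<open>nxt_induct_up\<close> stand in
  for induction on the index; the measure is the number of elements above, respectively
  below.\<close>

lemma nxt_induct_down [case_names last step]:
  fixes m :: "'n::{finite,linorder}"
  assumes "P lastix" "\<And>m. m \<noteq> lastix \<Longrightarrow> P (nxt m) \<Longrightarrow> P m"
  shows "P m"
proof (induction "card {m<..}" arbitrary: m rule: less_induct)
  case less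
  show ?case
  proof (cases "m = lastix")
    case False
    then have "card {nxt m<..} < card {m<..}"
      using nxt_greater[OF False] by (intro psubset_card_mono) auto
    then show ?thesis using assms(2)[OF False] less by blast
  qed (use assms(1) in simp)
qed

lemma nxt_induct_up [case_names first step]:
  fixes m :: "'n::{finite,linorder}"
  assumes "P firstix" "\<And>m. m \<noteq> lastix \<Longrightarrow> P m \<Longrightarrow> P (nxt m)"
  shows "P m"
proof (induction "card {..<m}" arbitrary: m rule: less_induct)
  case less
  show ?case
  proof (cases "m = firstix")
    case False
    then have "firstix < m" by (simp add: order.not_eq_order_implies_strict)
    then have ne: "{..<m} \<noteq> {}" by auto
    define l where "l = Max {..<m}"
    have l: "l < m" using Max_in[OF _ ne] by (auto simp: l_def)
    have "nxt l = m"
    proof (rule antisym)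
      show "nxt l \<le> m" using l by (rule nxt_le)
      show "m \<le> nxt l"
      proof (rule ccontr)
        assume "\<not> m \<le> nxt l"
        then have "nxt l \<le> l" unfolding l_def by (intro Max_ge) auto
        then show False using nxt_greater[OF less_imp_nonlast[OF l]] by simp
      qed
    qed
    moreover have "card {..<l} < card {..<m}"
      using l by (intro psubset_card_mono) auto
    ultimately show ?thesis using assms(2)[OF less_imp_nonlast[OF l]] less by blast
  qed (use assms(1) in simp)
qed

lemma nxt_le_iff: "i \<noteq> lastix \<Longrightarrow> nxt i \<le> j \<longleftrightarrow> i < j"
  using nxt_le nxt_greater by (metis less_le_trans)

lemma less_nxt_iff: "i \<noteq> lastix \<Longrightarrow> j < nxt i \<longleftrightarrow> j \<le> i"
  using nxt_le_iff by (metis not_less)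

lemma ilist_Cons:
  fixes A :: "'n::{finite,linorder} set"
  assumes "a \<in> A" "\<And>b. b \<in> A \<Longrightarrow> a \<le> b"
  shows "ilist A = a # ilist (A - {a})"
proof -
  have "Min A = a" using assms by (intro Min_eqI) auto
  then show ?thesis using assms by (subst sorted_list_of_set_nonempty) auto
qed

lemma ilist_snoc:
  fixes A :: "'n::{finite,linorder} set"
  assumes "a \<in> A" "\<And>b. b \<in> A \<Longrightarrow> b \<le> a"
  shows "ilist A = ilist (A - {a}) @ [a]"
  by (rule sorted_distinct_set_unique)
     (use assms in \<open>auto simp: sorted_append\<close>)

lemma ilist_atLeast: "m \<noteq> lastix \<Longrightarrow> ilist {m..} = m # ilist {nxt m..}"
proof -
  assume m: "m \<noteq> lastix"
  have "{m..} - {m} = {nxt m..}"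
    by (auto simp: nxt_le_iff[OF m])
  then show ?thesis using ilist_Cons[of m "{m..}"] by simp
qed

lemma ilist_greaterThan: "m \<noteq> lastix \<Longrightarrow> ilist {m<..} = nxt m # ilist {nxt m<..}"
proof -
  assume m: "m \<noteq> lastix"
  have "{m<..} - {nxt m} = {nxt m<..}"
    using nxt_greater[OF m] nxt_le[of m] by (fastforce simp: order.strict_iff_order)
  then show ?thesis using ilist_Cons[of "nxt m" "{m<..}"] nxt_greater[OF m] nxt_le[of m] by simp
qed

lemma ilist_atLeastLessThan: "m < l \<Longrightarrow> ilist {m..<l} = m # ilist {nxt m..<l}"
proof -
  assume m: "m < l"
  have "{m..<l} - {m} = {nxt m..<l}"
    by (auto simp: nxt_le_iff[OF less_imp_nonlast[OF m]])
  then show ?thesis using ilist_Cons[of m "{m..<l}"] m by simp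
qed

lemma ilist_lessThan: "m \<noteq> lastix \<Longrightarrow> ilist {..<nxt m} = ilist {..<m} @ [m]"
proof -
  assume m: "m \<noteq> lastix"
  have "{..<nxt m} - {m} = {..<m}"
    by (auto simp: less_nxt_iff[OF m])
  then show ?thesis using ilist_snoc[of m "{..<nxt m}"] by (simp add: less_nxt_iff[OF m])
qed

section \<open>Words in simple reflections and the reflections they represent\<close>

lemma sprod_Nil [simp]: "sprod [] = 1"
  and sprod_Cons [simp]: "sprod (i # is) = srefl i * sprod is"
  and sprod_append [simp]: "sprod (is @ js) = sprod is * sprod js"
  by (simp_all add: sprod_def)

lemma srefl_conj: "srefl i * refl b b' * srefl i = refl (act (srefl i) b) (act (srefl i) b')"
  using refl_conj[of "srefl i" b b'] by (simp add: mult.assoc srefl_srefl)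

lemma act_srefl_gt: "i < j \<Longrightarrow> nxt i \<noteq> j \<Longrightarrow> act (srefl i) (Pos j) = Pos j"
  using less_imp_nonlast[of i j] by (auto simp: act_srefl_Pos Transposition.transpose_def)

lemma act_srefl_nxt: "i \<noteq> lastix \<Longrightarrow> act (srefl i) (Pos (nxt i)) = Pos i"
  by (auto simp: act_srefl_Pos)

lemma act_srefl_self: "i \<noteq> lastix \<Longrightarrow> act (srefl i) (Pos i) = Pos (nxt i)"
  by (auto simp: act_srefl_Pos)

text \<open>The word for s_{ij} is the word for s_{i+1,j} enclosed by two copies of
  \<open>srefl i\<close>, and conjugation by \<open>srefl i\<close> moves the letter
  \<open>Pos (nxt i)\<close> to \<open>Pos i\<close> while fixing \<open>Pos j\<close>.\<close>

lemma refl_minus_less: "i < j \<Longrightarrow> refl_minus i j = refl (Pos i) (Pos j)"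
proof (induction i rule: nxt_induct_down)
  case last
  then show ?case using le_lastix[of j] by (metis not_less)
next
  case (step i)
  note l = ilist_atLeastLessThan[OF step.prems]
  show ?case
  proof (cases "nxt i = j")
    case True
    then show ?thesis using l step.prems srefl_nonlast[OF step.hyps]
      by (simp add: refl_minus_def)
  next
    case False
    then have lt: "nxt i < j" using nxt_le[OF step.prems] by simp
    have ne: "ilist {nxt i..<j} \<noteq> []" using ilist_atLeastLessThan[OF lt] by simp
    have "refl_minus i j = srefl i * refl_minus (nxt i) j * srefl i"
      using l lt step.prems ne by (simp add: refl_minus_def mult.assoc)
    also have "\<dots> = srefl i * refl (Pos (nxt i)) (Pos j) * srefl i"
      using step.IH[OF lt] by simp
    also have "\<dots> = refl (Pos i) (Pos j)"
      using act_srefl_gt[OF step.prems False] act_srefl_nxt[OF step.hyps]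
      by (simp add: srefl_conj)
    finally show ?thesis .
  qed
qed

lemma refl_minus_eq: "i \<noteq> j \<Longrightarrow> refl_minus i j = refl (Pos i) (Pos j)"
proof (cases "i < j")
  case False
  assume "i \<noteq> j"
  then have "j < i" using False by simp
  moreover have "refl_minus i j = refl_minus j i"
    by (simp add: refl_minus_def min.commute max.commute)
  ultimately show ?thesis using refl_minus_less[of j i] refl_commute by metis
qed (simp add: refl_minus_less)

lemma refl_long_eq: "refl_long i = refl (Pos i) (Neg i)"
proof (induction i rule: nxt_induct_down)
  case last
  have "{lastix..} = {lastix :: 'a}" by (auto simp: antisym)
  then show ?case using srefl_last by (simp add: refl_long_def)
next
  case (step i)
  then have "i < lastix" by (simp add: order.not_eq_order_implies_strict)
  then have "refl_long i = srefl i * refl_long (nxt i) * srefl i"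
    using step.hyps by (simp add: refl_long_def ilist_atLeast ilist_atLeastLessThan mult.assoc)
  also have "\<dots> = refl (Pos i) (Neg i)"
    unfolding step.IH srefl_conj
    using act_srefl_nxt[OF step.hyps] act_bar[of "srefl i" "Pos (nxt i)"] by simp
  finally show ?case .
qed

lemma refl_plus_eq: "i \<noteq> j \<Longrightarrow> refl_plus i j = refl (Pos i) (Neg j)"
  unfolding refl_plus_def refl_long_eq refl_minus_eq
  by (rule weyl_eqI) (auto simp: refl_minus_eq refl.rep_eq)

text \<open>No length function is used: every reflection is a word in simple ones, and an element is
  reduced to 1 by reflections that each decrease the number of moved letters.\<close>

lemma weyl_induct [case_names one step]:
  fixes w :: "'n::{finite,linorder} weyl"
  assumes one: "P 1" and step: "\<And>i w. P w \<Longrightarrow> P (srefl i * w)"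
  shows "P w"
proof -
  \<comment> \<open>The step hypothesis prefixes only simple reflections. The monoid S collects the
    blocks that may be prefixed, hence contains all reflections in two distinct letters.\<close>
  define S where "S = {u. \<forall>w. P w \<longrightarrow> P (u * w)}"
  have S_mult: "u * v \<in> S" if "u \<in> S" "v \<in> S" for u v
    using that by (auto simp: S_def mult.assoc)
  have S_sprod: "sprod is \<in> S" for "is"
  proof (induction "is")
    case (Cons i "is")
    then show ?case using step by (auto simp: S_def mult.assoc)
  qed (simp add: S_def)
  have S_pm: "refl (Pos i) (Pos j) \<in> S" if "i \<noteq> j" for i j
    unfolding refl_minus_eq[OF that, symmetric] refl_minus_def by (intro S_mult S_sprod)
  have S_long: "refl_long i \<in> S" for i
    unfolding refl_long_def by (intro S_mult S_sprod)
  have S_plus: "refl (Pos i) (Neg j) \<in> S" for i j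
  proof (cases "i = j")
    case False
    then show ?thesis using S_long S_pm[OF False] refl_plus_eq[OF False] refl_minus_eq[OF False] S_mult
      by (metis refl_plus_def)
  qed (use S_long in \<open>simp add: refl_long_eq flip: refl_long_eq\<close>)
  have S_refl: "refl b b' \<in> S" if "b \<noteq> b'" for b b'
    using that S_pm S_plus refl_bar[of b b'] refl_commute[of b b']
    by (cases b; cases b'; simp; metis bar.simps)
  show ?thesis
  proof (induction "card {b. act w b \<noteq> b}" arbitrary: w rule: less_induct)
    case less
    show ?case
    proof (cases "\<forall>b. act w b = b")
      case True
      then have "w = 1" by (intro weyl_eqI) simp
      then show ?thesis using one by simp
    next
      case False
      then obtain b where b: "act w b \<noteq> b" by auto
      \<comment> \<open>This v fixes b and every letter that w fixes, so it moves strictly fewer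
        letters than w.\<close>
      define v where "v = refl b (act w b) * w"
      have "{x. act v x \<noteq> x} \<subset> {x. act w x \<noteq> x}"
      proof
        show "{x. act v x \<noteq> x} \<subseteq> {x. act w x \<noteq> x}"
        proof (rule subsetI, rule ccontr)
          fix x assume x: "x \<in> {x. act v x \<noteq> x}" "x \<notin> {x. act w x \<noteq> x}"
          then have wx: "act w x = x" by simp
          then have "x \<noteq> b" "x \<noteq> bar b" using b by (auto simp: act_bar)
          moreover have "x \<noteq> act w b" "x \<noteq> bar (act w b)"
            using wx \<open>x \<noteq> b\<close> \<open>x \<noteq> bar b\<close> by (metis act_eq_iff, metis act_bar act_eq_iff)
          ultimately show False using x(1) wx by (simp add: v_def refl.rep_eq)
        qed
        have "b \<notin> {x. act v x \<noteq> x}" "b \<in> {x. act w x \<noteq> x}" using b by (auto simp: v_def)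
        then show "{x. act v x \<noteq> x} \<noteq> {x. act w x \<noteq> x}" by blast
      qed
      then have "P v" by (intro less psubset_card_mono) auto
      moreover have "w = refl b (act w b) * v" by (simp add: v_def)
      ultimately show ?thesis using S_refl[of b "act w b"] b by (simp add: S_def) (metis)
    qed
  qed
qed


section \<open>The regular representation of the degenerate affine Hecke algebra\<close>

lemma act_srefl_Neg: "act (srefl i) (Neg a) = bar (act (srefl i) (Pos a))"
  using act_bar[of "srefl i" "Pos a"] by simp

text \<open>The order \<open>v_1, \<dots>, v_n, v_{\bar n}, \<dots>, v_{\bar 1}\<close>; \<open>prec b b'\<close> says that the root attached to
  the reflection \<open>refl b b'\<close> is positive.\<close>

fun prec :: "'n::linorder bas \<Rightarrow> 'n bas \<Rightarrow> bool" where
  "prec (Pos i) (Pos j) \<longleftrightarrow> i < j"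
| "prec (Pos i) (Neg j) \<longleftrightarrow> True"
| "prec (Neg i) (Pos j) \<longleftrightarrow> False"
| "prec (Neg i) (Neg j) \<longleftrightarrow> j < i"

lemma prec_irrefl [simp]: "\<not> prec b b"
  by (cases b) auto

lemma prec_asym: "prec b b' \<Longrightarrow> \<not> prec b' b"
  by (cases b; cases b') auto

lemma prec_total: "b \<noteq> b' \<Longrightarrow> prec b b' \<or> prec b' b"
  by (cases b; cases b') auto

lemma prec_bar [simp]: "prec (bar b) (bar b') \<longleftrightarrow> prec b' b"
  by (cases b; cases b') auto

lemma transpose_nxt_less:
  fixes i :: "'n::{finite,linorder}"
  assumes "i \<noteq> lastix" "\<not> (a = i \<and> b = nxt i)" "\<not> (a = nxt i \<and> b = i)"
  shows "Transposition.transpose i (nxt i) a < Transposition.transpose i (nxt i) b \<longleftrightarrow> a < b"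
  using assms nxt_greater[OF assms(1)] nxt_le_iff[OF assms(1)] less_nxt_iff[OF assms(1)]
  by (auto simp: Transposition.transpose_def order.strict_iff_order)

lemma lastix_not_less [simp]: "\<not> lastix < (a :: 'n::{finite,linorder})"
  by (metis le_lastix not_less)

text \<open>A simple reflection permutes the positive roots other than its own; the hypothesis rules
  out the pair of letters that \<open>srefl i\<close> exchanges.\<close>

lemma prec_srefl:
  fixes b b' :: "'n::{finite,linorder} bas"
  assumes "act (srefl i) b \<noteq> b'"
  shows "prec (act (srefl i) b) (act (srefl i) b') = prec b b'"
proof (cases "i = lastix")
  case True
  then show ?thesis using assms
    by (cases b; cases b') (auto simp: act_srefl_Neg act_srefl_Pos order.not_eq_order_implies_strict)
next
  case False
  let ?t = "Transposition.transpose i (nxt i)"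
  have less: "?t a < ?t a' \<longleftrightarrow> a < a'" if "?t a \<noteq> a'" for a a'
    by (rule transpose_nxt_less[OF False]) (use that in auto)
  have less': "?t a < ?t a' \<longleftrightarrow> a < a'" if "?t a' \<noteq> a" for a a'
    by (rule transpose_nxt_less[OF False]) (use that in auto)
  show ?thesis using assms False less less'
    by (cases b; cases b') (simp_all add: act_srefl_Neg act_srefl_Pos)
qed

text \<open>A simple reflection is determined by any letter it moves. This identifies the extra term
  of \<open>gcoef_srefl\<close>, at b' = s_i b, as a term without reflection once s_i is
  cancelled.\<close>

lemma srefl_eq_refl: "act (srefl i) b \<noteq> b \<Longrightarrow> srefl i = refl b (act (srefl i) b)"
proof (cases "i = lastix")
  case True
  moreover assume "act (srefl i) b \<noteq> b"
  ultimately have "b = Pos lastix \<or> b = Neg lastix"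
    by (cases b) (auto simp: act_srefl_Neg act_srefl_Pos split: if_splits)
  then show ?thesis using True refl_commute
    by (auto simp: srefl_last)
next
  case False
  moreover assume "act (srefl i) b \<noteq> b"
  ultimately have "b \<in> {Pos i, Pos (nxt i), Neg i, Neg (nxt i)}"
    by (cases b) (auto simp: act_srefl_Neg act_srefl_Pos Transposition.transpose_def split: if_splits)
  moreover have "act (srefl i) (Neg i) = Neg (nxt i)" "act (srefl i) (Neg (nxt i)) = Neg i"
    using act_srefl_nxt[OF False] act_srefl_self[OF False] by (simp_all add: act_srefl_Neg)
  ultimately show ?thesis
    using act_srefl_nxt[OF False] act_srefl_self[OF False] srefl_nonlast[OF False]
      refl_commute[of "Pos i"] refl_bar[of "Pos i" "Pos (nxt i)"] refl_bar[of "Pos (nxt i)" "Pos i"]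
    by (elim insertE emptyE) (simp_all only: bar.simps)
qed

lemma poly_mapping_add_induct [case_names zero single add]:
  assumes "P 0" "\<And>a z. P (Poly_Mapping.single a z)" "\<And>f g. P f \<Longrightarrow> P g \<Longrightarrow> P (f + g)"
  shows "P (f :: _ \<Rightarrow>\<^sub>0 _::comm_monoid_add)"
proof (induction f rule: update_induct)
  case const
  then show ?case by (rule assms(1))
next
  case (update f a b)
  have "Poly_Mapping.update a b f = f + Poly_Mapping.single a b"
    using update(1) by (intro poly_mapping_eqI)
      (auto simp: lookup_update lookup_add lookup_single not_in_keys_iff_lookup_eq_zero)
  then show ?case using assms(2,3) update by simp
qed

abbreviation cst :: "complex \<Rightarrow> 'n ypoly" where
  "cst z \<equiv> Poly_Mapping.single 0 z"

lemma cst_add: "cst (z + z') = cst z + cst z'"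
  by (simp add: single_add)

lemma cst_mult: "cst (z * z') = cst z * cst z'"
  by (simp add: mult_single)

fun ywt :: "'n bas \<Rightarrow> 'n ypoly" where
  "ywt (Pos a) = Poly_Mapping.single (Poly_Mapping.single a 1) 1"
| "ywt (Neg a) = - Poly_Mapping.single (Poly_Mapping.single a 1) 1"

lemma ywt_bar [simp]: "ywt (bar b) = - ywt b"
  by (cases b) auto

text \<open>\<open>\<complex>[W_0] \<otimes> \<complex>[y]\<close>, which carries the left regular representation of the Hecke algebra.\<close>

type_synonym 'n reg = "'n weyl \<Rightarrow> 'n ypoly"

definition delta :: "'n weyl \<Rightarrow> 'n ypoly \<Rightarrow> 'n reg" where
  "delta w f = (\<lambda>v. if v = w then f else 0)"

definition Sact :: "'n weyl \<Rightarrow> 'n reg \<Rightarrow> 'n reg" where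
  "Sact u F = (\<lambda>w. F (winv u * w))"

context
  fixes k \<alpha> :: complex
begin

text \<open>The multiplicity of the root of \<open>refl b b'\<close>: 2 \<alpha> for long roots and
  k for the others, as dictated by the relations of y_n with s_n and of y_i with s_i. It is constant
  on W_0-orbits, see \<open>kap_act\<close>.\<close>

definition kap :: "'n bas \<Rightarrow> 'n bas \<Rightarrow> complex" where
  "kap b b' = (if b' = bar b then 2 * \<alpha> else k)"

lemma kap_bar [simp]: "kap (bar b) (bar b') = kap b b'"
  unfolding kap_def by (simp only: bar_eq_iff)

lemma kap_act [simp]: "kap (act w b) (act w b') = kap b b'"
  by (simp add: kap_def flip: act_bar)

lemma kap_commute: "kap b b' = kap b' b"
  unfolding kap_def by (metis bar_bar)

text \<open>\<open>gcoef b b' w\<close> is the coefficient of \<open>refl b b' * w\<close> in \<open>y_b w\<close>: the reflections that occur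
  are those whose positive root is made negative by \<open>w\<inverse>\<close>.\<close>

definition gcoef :: "'n::linorder bas \<Rightarrow> 'n bas \<Rightarrow> 'n weyl \<Rightarrow> complex" where
  "gcoef b b' w = (if prec b b' \<and> prec (act (winv w) b') (act (winv w) b) then kap b b'
     else if prec b' b \<and> prec (act (winv w) b) (act (winv w) b') then - kap b b' else 0)"

text \<open>\<open>scoef i b\<close> is the constant in \<open>y_b s_i = s_i y_{s_i b} + scoef i b\<close>.\<close>

definition scoef :: "'n::{finite,linorder} \<Rightarrow> 'n bas \<Rightarrow> complex" where
  "scoef i b = (if act (srefl i) b = b then 0 else if prec b (act (srefl i) b)
     then kap b (act (srefl i) b) else - kap b (act (srefl i) b))"

lemma gcoef_one [simp]: "gcoef b b' 1 = 0"
  by (auto simp: gcoef_def dest: prec_asym)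

lemma gcoef_bar: "gcoef (bar b) (bar b') w = - gcoef b b' w"
  by (auto simp: gcoef_def act_winv_bar dest: prec_asym)

text \<open>Cocycle rule for inversion sets. By \<open>prec_srefl\<close> all signs are transported
  by s_i except for the simple root itself; if s_i moves b, exactly one of s_i w and w inverts that
  root, so exactly one of the two \<open>gcoef\<close> terms is nonzero and the discrepancy is
  always \<open>scoef\<close>.\<close>

lemma gcoef_srefl:
  "gcoef b b' (srefl i * w) = gcoef (act (srefl i) b) (act (srefl i) b') w
     + (if b' = act (srefl i) b then scoef i b else 0)"
proof (cases "b' = act (srefl i) b")
  case True
  let ?b = "act (winv w) b" and ?b' = "act (winv w) b'"
  show ?thesis
  proof (cases "b' = b")
    case False
    then have "?b \<noteq> ?b'" by simp
    then have "prec ?b ?b' \<noteq> prec ?b' ?b" "prec b b' \<noteq> prec b' b"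
      using prec_total prec_asym False by metis+
    then show ?thesis using True False
      by (auto simp: gcoef_def scoef_def winv_times kap_commute[of b])
  qed (use True in \<open>simp add: gcoef_def scoef_def\<close>)
next
  case False
  then have "prec (act (srefl i) b) (act (srefl i) b') = prec b b'"
    "prec (act (srefl i) b') (act (srefl i) b) = prec b' b"
    using prec_srefl[of i b b'] prec_srefl[of i b' b] by (metis act_srefl_srefl)+
  then show ?thesis using False by (simp add: gcoef_def winv_times)
qed

lemma act_bij_sum: "(\<Sum>b\<in>UNIV. f (act w b)) = (\<Sum>b\<in>UNIV. f b)" for w :: "'n::finite weyl"
  using sum.reindex_bij_betw[OF bij_act] .

text \<open>The expansion of y_b v as w-coefficient: w receives a contribution from v = w and from v
  = \<open>refl b b' * w\<close>, which is why \<open>gcoef\<close> is evaluated at the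
  latter.\<close>

definition Yact :: "'n::{finite,linorder} bas \<Rightarrow> 'n reg \<Rightarrow> 'n reg" where
  "Yact b F = (\<lambda>w. ywt (act (winv w) b) * F w
     + (\<Sum>b'\<in>UNIV. cst (gcoef b b' (refl b b' * w)) * F (refl b b' * w)))"

lemma refl_srefl_mult: "refl b b' * (srefl i * w) = srefl i * (refl (act (srefl i) b) (act (srefl i) b') * w)"
  using refl_conj[of "srefl i" "act (srefl i) b" "act (srefl i) b'"]
  by (simp flip: mult.assoc)

text \<open>The relation between y_b and s_i in the representation. After the letters b' are
  reindexed by s_i, the two sums differ precisely by the extra term of
  \<open>gcoef_srefl\<close>.\<close>

lemma Yact_Sact:
  "Yact b (Sact (srefl i) F) w = Sact (srefl i) (Yact (act (srefl i) b) F) w + cst (scoef i b) * F w"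
proof -
  let ?s = "srefl i"
  have *: "cst (gcoef b b' (refl b b' * w)) * Sact ?s F (refl b b' * w) =
      cst (gcoef (act ?s b) (act ?s b') (refl (act ?s b) (act ?s b') * (?s * w)))
          * F (refl (act ?s b) (act ?s b') * (?s * w))
      + (if b' = act ?s b then cst (scoef i b) * F w else 0)" for b'
  proof -
    have 1: "?s * (refl b b' * w) = refl (act ?s b) (act ?s b') * (?s * w)"
      using refl_srefl_mult[of "act ?s b" "act ?s b'" i w] by simp
    have 2: "gcoef b b' (refl b b' * w) = gcoef (act ?s b) (act ?s b') (refl (act ?s b) (act ?s b') * (?s * w))
        + (if b' = act ?s b then scoef i b else 0)"
      using gcoef_srefl[of b b' i "?s * (refl b b' * w)"] by (simp add: 1[symmetric])
    \<comment> \<open>If s_i moves b, then \<open>refl b b'\<close> is s_i itself and cancels; if it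
      fixes b, the coefficient \<open>scoef i b\<close> is 0.\<close>
    have 3: "cst (scoef i b) * F (?s * (refl b b' * w)) = cst (scoef i b) * F w" if "b' = act ?s b"
    proof (cases "act ?s b = b")
      case False
      then show ?thesis using srefl_eq_refl[OF False] that by (metis refl_refl_assoc)
    qed (simp add: scoef_def)
    show ?thesis unfolding 2
      using 3 by (auto simp: Sact_def 1[symmetric] cst_add algebra_simps)
  qed
  show ?thesis
    unfolding Yact_def * sum.distrib
    by (subst act_bij_sum[of "\<lambda>b'. cst (gcoef (act ?s b) b' (refl (act ?s b) b' * (?s * w)))
          * F (refl (act ?s b) b' * (?s * w))" ?s])
       (simp add: Sact_def winv_times algebra_simps)
qed

lemma Yact_bar: "Yact (bar b) F w = - Yact b F w"
proof -
  have "(\<Sum>b'\<in>UNIV. cst (gcoef (bar b) b' (refl (bar b) b' * w)) * F (refl (bar b) b' * w)) =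
    (\<Sum>b'\<in>UNIV. cst (gcoef (bar b) (bar b') (refl (bar b) (bar b') * w)) * F (refl (bar b) (bar b') * w))"
    by (rule sum.reindex_bij_witness[of _ bar bar]) auto
  then show ?thesis
    by (simp add: Yact_def act_winv_bar gcoef_bar refl_bar single_uminus sum_negf)
qed

lemma Yact_add: "Yact b (\<lambda>w. F w + G w) w = Yact b F w + Yact b G w"
  by (simp add: Yact_def algebra_simps sum.distrib)

lemma Yact_scale: "Yact b (\<lambda>w. cst z * F w) w = cst z * Yact b F w"
  by (simp add: Yact_def algebra_simps sum_distrib_left)

lemma Yact_sum: "finite A \<Longrightarrow> Yact b (\<lambda>w. \<Sum>a\<in>A. F a w) w = (\<Sum>a\<in>A. Yact b (F a) w)"
proof (induction A rule: finite_induct)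
  case empty
  then show ?case by (simp add: Yact_def)
next
  case (insert a A)
  then show ?case by (simp add: Yact_add)
qed

text \<open>Only the terms with \<open>refl b b' * w = 1\<close> could survive, and there
  \<open>gcoef\<close> is evaluated at 1, which inverts no root. So y_b acts by multiplication on
  the component of 1, which starts the commutator induction and later separates polynomials.\<close>

lemma Yact_delta_one: "Yact b (delta 1 f) = delta 1 (ywt b * f)"
proof
  fix w
  have "cst (gcoef b b' (refl b b' * w)) * delta 1 f (refl b b' * w) = 0" for b'
    by (simp add: delta_def)
  then show "Yact b (delta 1 f) w = delta 1 (ywt b * f) w"
    by (simp only: Yact_def sum.neutral_const) (auto simp: delta_def)
qed

lemma Sact_delta: "Sact u (delta w f) = delta (u * w) f"
  by (auto simp: Sact_def delta_def fun_eq_iff)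

text \<open>The terms left over when \<open>s_i\<close> is moved through the commutator of \<open>y_b\<close> and \<open>y_d\<close> cancel;
  hence the vanishing of the commutator on the basis element \<open>1\<close> propagates to all of \<open>W_0\<close>.\<close>

lemma scoef_Yact:
  "cst (scoef i b) * (Yact (act (srefl i) d) F w - Yact d F w) =
   cst (scoef i d) * (Yact (act (srefl i) b) F w - Yact b F w)"
proof -
  \<comment> \<open>As functions of the letter b, both \<open>scoef i b\<close> and the difference
    of the two \<open>Yact\<close> values are multiples of the same e in {0, 1, -1}, the sign with
    which b enters the simple root. Their cross products therefore agree.\<close>
  have "\<exists>z D. \<forall>b. (\<exists>e. scoef i b = e * z \<and>
      Yact (act (srefl i) b) F w - Yact b F w = cst e * D)"
  proof (cases "i = lastix")
    case True
    have *: "\<exists>e. scoef i b = e * (2 * \<alpha>) \<and> 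
      Yact (act (srefl i) b) F w - Yact b F w = cst e * (-2 * Yact (Pos lastix) F w)" for b
    proof -
      have "act (srefl i) b = b" if "b \<noteq> Pos lastix" "b \<noteq> Neg lastix"
        using True that by (cases b) (auto simp: act_srefl_Neg act_srefl_Pos)
      then consider "b = Pos lastix" | "b = Neg lastix" | "act (srefl i) b = b" by blast
      then show ?thesis
      proof cases
        case 1
        then show ?thesis using True Yact_bar[of "Pos lastix" F w]
          by (intro exI[of _ 1]) (simp add: scoef_def act_srefl_Pos kap_def)
      next
        case 2
        then show ?thesis using True Yact_bar[of "Pos lastix" F w]
          by (intro exI[of _ "-1"]) (simp add: scoef_def act_srefl_Neg act_srefl_Pos kap_def single_uminus)
      qed (auto simp: scoef_def intro!: exI[of _ 0])
    qed
    then show ?thesis by blast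
  next
    case False
    note gt = nxt_greater[OF False]
    have *: "\<exists>e. scoef i b = e * k \<and> 
      Yact (act (srefl i) b) F w - Yact b F w = cst e * (Yact (Pos (nxt i)) F w - Yact (Pos i) F w)" for b
    proof -
      note Ybar = Yact_bar[of "Pos i" F w] Yact_bar[of "Pos (nxt i)" F w]
      note sr = act_srefl_nxt[OF False] act_srefl_self[OF False]
      have "act (srefl i) b = b" if "b \<notin> {Pos i, Neg i, Pos (nxt i), Neg (nxt i)}"
        using False that by (cases b) (auto simp: act_srefl_Neg act_srefl_Pos Transposition.transpose_def)
      then consider "b = Pos i \<or> b = Neg (nxt i)" | "b = Neg i \<or> b = Pos (nxt i)" | "act (srefl i) b = b"
        by blast
      then show ?thesis
      proof cases
        case 1
        then show ?thesis using gt Ybar sr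
          by (intro exI[of _ 1]) (auto simp: scoef_def act_srefl_Neg kap_def)
      next
        case 2
        then show ?thesis using gt Ybar sr
          by (intro exI[of _ "-1"]) (auto simp: scoef_def act_srefl_Neg kap_def single_uminus)
      qed (auto simp: scoef_def intro!: exI[of _ 0])
    qed
    then show ?thesis by blast
  qed
  then obtain z D where zD: "\<And>b. \<exists>e. scoef i b = e * z \<and>
      Yact (act (srefl i) b) F w - Yact b F w = cst e * D" by blast
  obtain e e' where "scoef i b = e * z" "Yact (act (srefl i) b) F w - Yact b F w = cst e * D"
    "scoef i d = e' * z" "Yact (act (srefl i) d) F w - Yact d F w = cst e' * D"
    using zD by metis
  then show ?thesis by (simp add: cst_mult algebra_simps)
qed

lemma Yact_Sact': "Yact b (Sact (srefl i) F) =
   (\<lambda>w. Sact (srefl i) (Yact (act (srefl i) b) F) w + cst (scoef i b) * F w)"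
  by (rule ext) (rule Yact_Sact)

lemma Yact_commute_delta: "Yact b (Yact d (delta v f)) w = Yact d (Yact b (delta v f)) w"
proof (induction v arbitrary: b d w rule: weyl_induct)
  case one
  show ?case by (simp add: Yact_delta_one mult.left_commute)
next
  case (step i v)
  let ?s = "srefl i" and ?F = "delta v f"
  have *: "Yact b (Yact d (Sact ?s ?F)) w =
     Sact ?s (Yact (act ?s b) (Yact (act ?s d) ?F)) w + cst (scoef i b) * Yact (act ?s d) ?F w
     + cst (scoef i d) * Yact b ?F w" for b d
    unfolding Yact_Sact' Yact_add Yact_scale ..
  have "Yact (act ?s b) (Yact (act ?s d) ?F) = Yact (act ?s d) (Yact (act ?s b) ?F)"
    by (rule ext) (rule step)
  then show ?case
    unfolding Sact_delta[symmetric] * using scoef_Yact[of i b d ?F w]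
    by (simp add: algebra_simps)
qed

lemma Yact_commute: "Yact b (Yact d F) = Yact d (Yact b F)"
proof
  fix w
  have F: "F = (\<lambda>w. \<Sum>v\<in>UNIV. delta v (F v) w)"
    by (simp add: delta_def)
  have expand: "Yact b (Yact d F) w = (\<Sum>v\<in>UNIV. Yact b (Yact d (delta v (F v))) w)" for b d
  proof -
    have "Yact d F = (\<lambda>w. \<Sum>v\<in>UNIV. Yact d (delta v (F v)) w)" for d
      by (rule ext, subst F) (simp add: Yact_sum)
    then show ?thesis by (simp add: Yact_sum)
  qed
  then have "Yact b (Yact d F) w = (\<Sum>v\<in>UNIV. Yact d (Yact b (delta v (F v))) w)"
    by (simp add: Yact_commute_delta)
  also have "\<dots> = Yact d (Yact b F) w" by (rule expand[symmetric])
  finally show "Yact b (Yact d F) w = Yact d (Yact b F) w" .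
qed

end


section \<open>Normal forms\<close>

context
  fixes k \<alpha> :: complex
begin

section \<open>The free algebra acting on the regular representation\<close>

lemma Sact_add: "Sact u (\<lambda>w. F w + G w) = (\<lambda>w. Sact u F w + Sact u G w)"
  and Sact_scale: "Sact u (\<lambda>w. f * F w) = (\<lambda>w. f * Sact u F w)"
  by (simp_all add: Sact_def)

fun gact :: "'n::{finite,linorder} hgen \<Rightarrow> 'n reg \<Rightarrow> 'n reg" where
  "gact (GW u) = Sact u"
| "gact (GY j) = Yact k \<alpha> (Pos j)"

lemma gact_add: "gact g (\<lambda>w. F w + G w) = (\<lambda>w. gact g F w + gact g G w)"
  and gact_scale: "gact g (\<lambda>w. cst z * F w) = (\<lambda>w. cst z * gact g F w)"
  by (cases g; simp add: Sact_add Sact_scale Yact_add Yact_scale fun_eq_iff)+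

fun lact :: "'n::{finite,linorder} hgen fmon \<Rightarrow> 'n reg \<Rightarrow> 'n reg" where
  "lact (FMon l) F = foldr gact l F"

lemma lact_zero [simp]: "lact 0 F = F"
  by (simp add: zero_fmon_def)

lemma lact_plus: "lact (u + v) F = lact u (lact v F)"
  by (cases u; cases v) simp

lemma lact_add: "lact u (\<lambda>w. F w + G w) = (\<lambda>w. lact u F w + lact u G w)"
proof (cases u)
  case (FMon l)
  have "foldr gact l (\<lambda>w. F w + G w) = (\<lambda>w. foldr gact l F w + foldr gact l G w)"
    by (induction l) (simp_all add: gact_add)
  then show ?thesis by (simp add: FMon)
qed

lemma lact_scale: "lact u (\<lambda>w. cst z * F w) = (\<lambda>w. cst z * lact u F w)"
proof (cases u)
  case (FMon l)
  have "foldr gact l (\<lambda>w. cst z * F w) = (\<lambda>w. cst z * foldr gact l F w)"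
    by (induction l) (simp_all add: gact_scale)
  then show ?thesis by (simp add: FMon)
qed

definition rho :: "'n::{finite,linorder} free \<Rightarrow> 'n reg \<Rightarrow> 'n reg" where
  "rho h F = (\<lambda>w. \<Sum>u\<in>Poly_Mapping.keys h. cst (Poly_Mapping.lookup h u) * lact u F w)"

lemma rho_plus: "rho (a + b) F w = rho a F w + rho b F w"
  unfolding rho_def
  by (rule setsum_keys_plus_distrib[of "\<lambda>u z. cst z * lact u F w"])
     (simp_all add: cst_add algebra_simps)

lemma rho_single: "rho (Poly_Mapping.single u z) F = (\<lambda>w. cst z * lact u F w)"
  by (simp add: rho_def)

lemma rho_zero [simp]: "rho 0 F w = 0"
  by (simp add: rho_def)

lemma rho_uminus: "rho (- a) F w = - rho a F w"
  using rho_plus[of a "- a" F w] by (simp add: eq_neg_iff_add_eq_0 add.commute)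

lemma rho_diff: "rho (a - b) F w = rho a F w - rho b F w"
  using rho_plus[of a "- b" F w] by (simp add: rho_uminus)

lemma rho_sum: "finite A \<Longrightarrow> rho (sum h A) F w = (\<Sum>a\<in>A. rho (h a) F w)"
  by (induction A rule: finite_induct) (simp_all add: rho_plus)

lemma rho_add: "rho h (\<lambda>w. F w + G w) = (\<lambda>w. rho h F w + rho h G w)"
  by (simp add: rho_def lact_add algebra_simps sum.distrib)

lemma rho_scale: "rho h (\<lambda>w. cst z * F w) = (\<lambda>w. cst z * rho h F w)"
  by (simp add: rho_def lact_scale sum_distrib_left mult.left_commute)

lemma rho_null: "rho h (\<lambda>_. 0) = (\<lambda>_. 0)"
  using rho_scale[of h 0 "\<lambda>_. 0"] by simp

lemma rho_mult: "rho (a * b) F = rho a (rho b F)"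
proof (induction a rule: poly_mapping_add_induct)
  case (single u z)
  show ?case
  proof (induction b rule: poly_mapping_add_induct)
    case (single v z')
    then show ?case
      by (simp add: mult_single rho_single lact_plus lact_scale flip: mult.assoc)
  next
    case (add f g)
    have "rho (Poly_Mapping.single u z * (f + g)) F =
      (\<lambda>w. rho (Poly_Mapping.single u z * f) F w + rho (Poly_Mapping.single u z * g) F w)"
      by (simp add: distrib_left rho_plus fun_eq_iff)
    also have "\<dots> = rho (Poly_Mapping.single u z) (rho (f + g) F)"
      unfolding add rho_plus[abs_def] rho_add ..
    finally show ?case .
  qed (simp add: rho_null rho_def[of 0])
next
  case (add f g)
  have "rho ((f + g) * b) F = (\<lambda>w. rho (f * b) F w + rho (g * b) F w)"
    by (simp add: distrib_right rho_plus fun_eq_iff)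
  also have "\<dots> = rho (f + g) (rho b F)"
    unfolding add by (simp add: rho_plus fun_eq_iff)
  finally show ?case .
qed (simp add: rho_def)

lemma rho_hgen [simp]: "rho (hgen g) F = gact g F"
  by (simp add: hgen_def rho_single)

lemma rho_scal [simp]: "rho (scal z) F = (\<lambda>w. cst z * F w)"
  by (simp add: scal_def rho_single)

lemma rho_one [simp]: "rho 1 F = F"
  using rho_scal[of 1 F] by (simp add: scal_def)

lemma Sact_one [simp]: "Sact 1 F = F"
  by (simp add: Sact_def)

lemma Sact_mult: "Sact u (Sact v F) = Sact (u * v) F"
  by (simp add: Sact_def winv_times mult.assoc)

text \<open>Hence \<open>rho\<close> descends to the Hecke algebra. Commutation of the y's is
  \<open>Yact_commute\<close>; each mixed relation is \<open>Yact_Sact\<close> for one letter, with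
  \<open>scoef\<close> equal to k, 2 \<alpha> or 0.\<close>

lemma rho_ideal: "a \<in> hecke_ideal k \<alpha> \<Longrightarrow> rho a F = (\<lambda>_. 0)"
proof (induction arbitrary: F rule: hecke_ideal.induct)
  case (rel_yy i j)
  then show ?case by (simp add: rho_diff rho_mult fun_eq_iff Yact_commute[of k \<alpha> "Pos i"])
next
  case (rel_ys i)
  have "scoef k \<alpha> i (Pos i) = k"
    using rel_ys nxt_greater[OF rel_ys] by (simp add: scoef_def act_srefl_self kap_def)
  then show ?case using rel_ys
    by (simp add: rho_diff rho_plus rho_mult fun_eq_iff Yact_Sact act_srefl_self)
next
  case rel_ys_last
  have "act (srefl lastix) (Pos lastix) = Neg (lastix :: 'a)"
    by (simp add: act_srefl_Pos)
  moreover from this have "scoef k \<alpha> lastix (Pos (lastix :: 'a)) = 2 * \<alpha>"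
    by (simp add: scoef_def kap_def)
  moreover have "Sact (srefl lastix) (Yact k \<alpha> (Neg lastix) F) w = - Sact (srefl lastix) (Yact k \<alpha> (Pos lastix) F) w"
    for w :: "'a weyl"
    using Yact_bar[of k \<alpha> "Pos lastix" F] by (simp add: Sact_def)
  ultimately show ?case
    by (simp add: rho_diff rho_plus rho_mult rho_uminus fun_eq_iff Yact_Sact)
next
  case (rel_far j i)
  then have "act (srefl i) (Pos j) = Pos j"
    by (auto simp: act_srefl_Pos Transposition.transpose_def)
  moreover from this have "scoef k \<alpha> i (Pos j) = 0" by (simp add: scoef_def)
  ultimately show ?case
    by (simp add: rho_diff rho_mult fun_eq_iff Yact_Sact)
next
  case (ideal_mult a r s)
  then show ?case by (simp add: rho_mult rho_null)
qed (simp_all add: rho_diff rho_plus rho_mult fun_eq_iff Sact_mult)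

section \<open>Scalars and ordered polynomials in the free algebra\<close>

lemma scal_add: "scal (z + z') = scal z + scal z'"
  by (simp add: scal_def single_add)

lemma scal_zero [simp]: "scal 0 = 0" and scal_one [simp]: "scal 1 = 1"
  by (simp_all add: scal_def)

lemma scal_minus: "scal (- z) = - scal z"
  by (simp add: scal_def single_uminus)

lemma scal_commute: "scal z * h = h * scal z"
  by (induction h rule: poly_mapping_add_induct)
     (simp_all add: scal_def mult_single distrib_left distrib_right mult.commute[of z])

lemma hw_scal: "hw u * scal z = scal z * hw u" "hw u * (scal z * h) = scal z * (hw u * h)"
  by (simp_all only: scal_commute[of z "hw u"] mult.assoc[symmetric])

lemma ypoly_free_zero [simp]: "ypoly_free 0 = 0"
  by (simp add: ypoly_free_def)

lemma ypoly_free_add: "ypoly_free (p + q) = ypoly_free p + ypoly_free q"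
  unfolding ypoly_free_def
  by (rule setsum_keys_plus_distrib[of "\<lambda>\<mu> z. scal z *
      prod_list (map (\<lambda>i. hy i ^ Poly_Mapping.lookup \<mu> i) (ilist UNIV))"])
     (simp_all add: scal_add algebra_simps)

lemma ypoly_free_minus: "ypoly_free (- p) = - ypoly_free p"
  using ypoly_free_add[of p "- p"] by (simp add: eq_neg_iff_add_eq_0 add.commute)

lemma ypoly_free_sum: "finite A \<Longrightarrow> ypoly_free (sum p A) = (\<Sum>a\<in>A. ypoly_free (p a))"
  by (induction A rule: finite_induct) (simp_all add: ypoly_free_add)

lemma ypoly_free_single: "ypoly_free (Poly_Mapping.single \<mu> z) =
    scal z * prod_list (map (\<lambda>i. hy i ^ Poly_Mapping.lookup \<mu> i) (ilist UNIV))"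
  by (simp add: ypoly_free_def)

lemma ypoly_free_cst: "ypoly_free (cst z) = scal z"
proof -
  have "prod_list (map (\<lambda>i. 1) xs) = (1 :: 'a free)" for xs :: "'a list"
    by (induction xs) auto
  then show ?thesis by (simp add: ypoly_free_single)
qed

lemma ypoly_free_one: "ypoly_free 1 = 1"
  using ypoly_free_cst[of 1] by simp

fun hys :: "'n bas \<Rightarrow> 'n free" where
  "hys (Pos a) = hy a"
| "hys (Neg a) = - hy a"

lemma hys_bar [simp]: "hys (bar b) = - hys b"
  by (cases b) auto

lemma prod_list_single:
  "distinct xs \<Longrightarrow> prod_list (map (\<lambda>i. x i ^ (if i = a then 1 else 0)) xs)
     = (if a \<in> set xs then x a else (1 :: 'c::monoid_mult))"
  by (induction xs) auto

lemma ypoly_free_ywt [simp]: "ypoly_free (ywt b) = hys b"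
  using prod_list_single[of "ilist UNIV" hy]
  by (cases b) (simp_all add: ypoly_free_minus ypoly_free_single lookup_single when_def eq_commute
      flip: One_nat_def)

lemma single_power: "Poly_Mapping.single \<mu> (1 :: complex) ^ m =
   Poly_Mapping.single (\<Sum>_<m. \<mu>) 1" for \<mu> :: "'a \<Rightarrow>\<^sub>0 nat"
  by (induction m) (simp_all add: mult_single add.commute)

lemma prod_single: "finite A \<Longrightarrow> (\<Prod>a\<in>A. Poly_Mapping.single (f a) (1 :: complex)) =
    Poly_Mapping.single (\<Sum>a\<in>A. f a) 1" for f :: "'b \<Rightarrow> 'a \<Rightarrow>\<^sub>0 nat"
  by (induction A rule: finite_induct) (simp_all add: mult_single)

lemma ymonom_eq: "(\<Prod>i\<in>UNIV. ywt (Pos i) ^ Poly_Mapping.lookup \<mu> i) = Poly_Mapping.single \<mu> 1"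
  for \<mu> :: "'n::finite \<Rightarrow>\<^sub>0 nat"
proof -
  have "(\<Sum>i\<in>UNIV. \<Sum>_<Poly_Mapping.lookup \<mu> i. Poly_Mapping.single i (1::nat)) = \<mu>"
    by (rule poly_mapping_eqI)
       (simp add: lookup_sum lookup_single when_def if_distrib[of "\<lambda>x. _ * x"] cong: if_cong)
  then show ?thesis by (simp add: single_power prod_single)
qed

lemma rho_hy_power: "rho (hy i ^ m) (delta 1 f) = delta 1 (ywt (Pos i) ^ m * f)"
proof (induction m arbitrary: f)
  case (Suc m)
  show ?case by (simp only: power_Suc2 rho_mult rho_hgen gact.simps Yact_delta_one Suc) (simp add: mult.assoc)
qed simp

lemma rho_ymonom: "rho (prod_list (map (\<lambda>i. hy i ^ m i) xs)) (delta 1 f) =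
    delta 1 (prod_list (map (\<lambda>i. ywt (Pos i) ^ m i) xs) * f)"
  by (induction xs arbitrary: f) (simp_all only: list.map prod_list.Nil prod_list.Cons rho_one mult_1 rho_mult rho_hy_power mult.assoc)

text \<open>By \<open>Yact_delta_one\<close> each y_j multiplies the component of 1, so the
  noncommutative monomial chosen in \<open>ypoly_free\<close> acts there as the monomial
  itself.\<close>

lemma rho_ypoly_free: "rho (ypoly_free p) (delta 1 f) = delta 1 (p * f)"
proof (induction p rule: poly_mapping_add_induct)
  case (single \<mu> z)
  have "prod_list (map (\<lambda>i. ywt (Pos i) ^ Poly_Mapping.lookup \<mu> i) (ilist UNIV)) =
    (\<Prod>i\<in>UNIV. ywt (Pos i) ^ Poly_Mapping.lookup \<mu> i)"
    by (subst prod.distinct_set_conv_list[symmetric]) simp_all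
  then show ?case
    by (simp only: ymonom_eq ypoly_free_single rho_mult rho_ymonom rho_scal)
       (simp add: delta_def fun_eq_iff mult_single flip: mult.assoc)
next
  case (add p q)
  then show ?case
    by (simp only: ypoly_free_add rho_plus[abs_def]) (auto simp: delta_def distrib_right)
qed (simp add: delta_def fun_eq_iff)

lemma hecke_zero: "0 \<in> hecke_ideal k \<alpha>"
  using ideal_mult[OF rel_one, where r = 0 and s = 1] by simp

lemma hecke_minus: "a \<in> hecke_ideal k \<alpha> \<Longrightarrow> - a \<in> hecke_ideal k \<alpha>"
  using ideal_mult[of a k \<alpha> "-1" 1] by simp

text \<open>Acting on \<open>delta 1 1\<close> kills the ideal and sends w p_w(y) to
  \<open>delta w (p w)\<close>. Any candidate p is thus forced to be
  \<open>rho h (delta 1 1)\<close>, which is the linear independence behind the definite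
  description.\<close>

lemma normal_form_eqI:
  assumes "h - (\<Sum>w\<in>UNIV. hw w * ypoly_free (p w)) \<in> hecke_ideal k \<alpha>"
  shows "normal_form k \<alpha> h = p"
proof -
  have *: "q = rho h (delta 1 1)" if "h - (\<Sum>w\<in>UNIV. hw w * ypoly_free (q w)) \<in> hecke_ideal k \<alpha>" for q
  proof
    fix v
    have "rho h (delta 1 1) v = (\<Sum>w\<in>UNIV. delta w (q w) v)"
      using fun_cong[OF rho_ideal[OF that, of "delta 1 1"], of v]
      by (simp add: rho_diff rho_sum rho_mult rho_ypoly_free Sact_delta)
    then show "q v = rho h (delta 1 1) v" by (simp add: delta_def)
  qed
  show ?thesis unfolding normal_form_def
    by (rule the_equality, rule assms) (simp only: *[OF assms] *)
qed

section \<open>Congruences modulo the Hecke ideal and the expansion of y_b w\<close>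

definition heq :: "'n::{finite,linorder} free \<Rightarrow> 'n free \<Rightarrow> bool" where
  "heq a b \<longleftrightarrow> a - b \<in> hecke_ideal k \<alpha>"

lemma heq_refl [simp]: "heq a a"
  by (simp add: heq_def hecke_zero)

lemma heq_sym: "heq a b \<Longrightarrow> heq b a"
  unfolding heq_def using hecke_minus by fastforce

lemma heq_trans [trans]: "heq a b \<Longrightarrow> heq b c \<Longrightarrow> heq a c"
  unfolding heq_def using ideal_add[of "a - b" k \<alpha> "b - c"] by simp

lemma heq_add: "heq a b \<Longrightarrow> heq c d \<Longrightarrow> heq (a + c) (b + d)"
  unfolding heq_def using ideal_add[of "a - b" k \<alpha> "c - d"] by (simp add: algebra_simps)

lemma heq_minus: "heq a b \<Longrightarrow> heq (- a) (- b)"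
  unfolding heq_def using hecke_minus by fastforce

lemma heq_left: "heq a b \<Longrightarrow> heq (c * a) (c * b)"
  unfolding heq_def using ideal_mult[of "a - b" k \<alpha> c 1] by (simp add: algebra_simps)

lemma heq_right: "heq a b \<Longrightarrow> heq (a * c) (b * c)"
  unfolding heq_def using ideal_mult[of "a - b" k \<alpha> 1 c] by (simp add: algebra_simps)

lemma heq_sum: "finite A \<Longrightarrow> (\<And>x. x \<in> A \<Longrightarrow> heq (f x) (g x)) \<Longrightarrow> heq (sum f A) (sum g A)"
  by (induction A rule: finite_induct) (simp_all add: heq_add)

lemma heq_hw: "heq (hw u * hw v) (hw (u * v))" "heq (hw 1) 1"
  by (simp_all add: heq_def rel_mult rel_one)

lemma heq_hw_assoc: "heq (hw u * (hw v * h)) (hw (u * v) * h)"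
  using heq_right[OF heq_hw(1)] by (simp add: mult.assoc)

lemma heq_srefl: "heq (hw (srefl i) * (hw (srefl i) * h)) h"
proof -
  have "heq (hw (srefl i) * (hw (srefl i) * h)) (hw 1 * h)"
    using heq_hw_assoc[of "srefl i" "srefl i" h] by (simp add: srefl_srefl)
  also have "heq (hw 1 * h) (1 * h)" by (rule heq_right[OF heq_hw(2)])
  finally show ?thesis by simp
qed

lemma scoef_bar: "scoef k \<alpha> i (bar b) = - scoef k \<alpha> i b"
proof -
  have "act (srefl i) b = b \<or> prec b (act (srefl i) b) = (\<not> prec (act (srefl i) b) b)"
    using prec_total prec_asym by metis
  then show ?thesis by (auto simp: scoef_def act_bar)
qed

lemma heq_hys_srefl:
  "heq (hys b * hw (srefl i)) (hw (srefl i) * hys (act (srefl i) b) + scal (scoef k \<alpha> i b))"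
proof -
  have pos: "heq (hys (Pos a) * hw (srefl i)) (hw (srefl i) * hys (act (srefl i) (Pos a)) + scal (scoef k \<alpha> i (Pos a)))" for a
  proof (cases "i = lastix")
    case True
    show ?thesis
    proof (cases "a = i")
      case a: True
      then have "act (srefl i) (Pos a) = Neg i" "scoef k \<alpha> i (Pos a) = 2 * \<alpha>"
        using True by (simp_all add: act_srefl_Pos scoef_def kap_def)
      then show ?thesis using rel_ys_last[where k = k and \<alpha> = \<alpha>] True a by (simp add: heq_def)
    next
      case False
      then have "act (srefl i) (Pos a) = Pos a" "scoef k \<alpha> i (Pos a) = 0"
        using True by (simp_all add: act_srefl_Pos scoef_def)
      then show ?thesis using rel_far[of a i k \<alpha>] True False
        by (simp add: heq_def) (metis hecke_minus minus_diff_eq)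
    qed
  next
    case i: False
    note gt = nxt_greater[OF i]
    have c: "scoef k \<alpha> i (Pos i) = k" "scoef k \<alpha> i (Pos (nxt i)) = - k"
      using gt act_srefl_self[OF i] act_srefl_nxt[OF i] by (auto simp: scoef_def kap_def)
    have 1: "heq (hy i * hw (srefl i)) (hw (srefl i) * hy (nxt i) + scal k)"
      using rel_ys[OF i] by (simp add: heq_def)
    consider "a = i" | "a = nxt i" | "a \<noteq> i" "a \<noteq> nxt i" by blast
    then show ?thesis
    proof cases
      case 2
      \<comment> \<open>The defining relations treat y_i s_i but not y_{i+1} s_i. Multiplying the
        former by s_i on both sides gives y_{i+1} s_i = s_i y_i - k.\<close>
      let ?s = "hw (srefl i)"
      have "heq (hy (nxt i) * ?s + scal k * 1) (?s * (?s * hy (nxt i)) * ?s + scal k * (?s * (?s * 1)))"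
        by (intro heq_add heq_right[OF heq_sym[OF heq_srefl]] heq_left[OF heq_sym[OF heq_srefl]])
      also have "\<dots> = ?s * (?s * hy (nxt i) + scal k) * ?s"
        by (simp add: distrib_left distrib_right hw_scal mult.assoc)
      also have "heq \<dots> (?s * (hy i * ?s) * ?s)"
        by (intro heq_left heq_right heq_sym[OF 1])
      also have "\<dots> = ?s * hy i * (?s * (?s * 1))"
        by (simp add: mult.assoc)
      also have "heq \<dots> (?s * hy i * 1)"
        by (intro heq_left heq_srefl)
      finally have "heq (hy (nxt i) * ?s) (?s * hy i - scal k)"
        by (simp add: heq_def diff_diff_eq2)
      then show ?thesis using 2 c act_srefl_nxt[OF i] by (simp add: scal_minus)
    next
      case 3
      then have "act (srefl i) (Pos a) = Pos a" "scoef k \<alpha> i (Pos a) = 0"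
        using i by (simp_all add: act_srefl_Pos scoef_def)
      then show ?thesis using rel_far[of a i k \<alpha>] 3
        by (simp add: heq_def) (metis hecke_minus minus_diff_eq)
    qed (use 1 c act_srefl_self[OF i] in simp)
  qed
  show ?thesis
  proof (cases b)
    case (Neg a)
    then have "b = bar (Pos a)" by simp
    then show ?thesis using heq_minus[OF pos[of a]]
      by (simp only: hys_bar act_bar scoef_bar scal_minus) (simp add: algebra_simps)
  qed (use pos in simp)
qed

definition ynf :: "'n::{finite,linorder} bas \<Rightarrow> 'n weyl \<Rightarrow> 'n free" where
  "ynf b w = hw w * hys (act (winv w) b)
     + (\<Sum>b'\<in>UNIV. scal (gcoef k \<alpha> b b' w) * hw (refl b b' * w))"

text \<open>The counterpart of \<open>Yact_Sact\<close> in the quotient: moving y_b past a leading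
  s_i leaves \<open>scoef i b\<close> times w, which is the extra term by which
  \<open>gcoef_srefl\<close> passes from w to s_i w.\<close>

lemma heq_hys_hw: "heq (hys b * hw w) (ynf b w)"
proof (induction w arbitrary: b rule: weyl_induct)
  case one
  have "heq (hys b * hw 1) (hys b * 1)" by (intro heq_left heq_hw)
  also have "heq \<dots> (hw 1 * hys b)" using heq_right[OF heq_sym[OF heq_hw(2)]] by simp
  finally show ?case by (simp add: ynf_def)
next
  case (step i w)
  let ?s = "srefl i"
  let ?r = "\<lambda>b'. refl (act ?s b) b' * w"
  have "heq (hys b * hw (?s * w)) (hys b * (hw ?s * hw w))"
    by (intro heq_left heq_sym[OF heq_hw(1)])
  also have "\<dots> = hys b * hw ?s * hw w" by (simp add: mult.assoc)
  also have "heq \<dots> ((hw ?s * hys (act ?s b) + scal (scoef k \<alpha> i b)) * hw w)"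
    by (intro heq_right heq_hys_srefl)
  also have "\<dots> = hw ?s * (hys (act ?s b) * hw w) + scal (scoef k \<alpha> i b) * hw w"
    by (simp add: algebra_simps)
  also have "heq \<dots> (hw ?s * ynf (act ?s b) w + scal (scoef k \<alpha> i b) * hw w)"
    by (intro heq_add heq_left heq_refl step)
  also have "\<dots> = hw ?s * (hw w * hys (act (winv w) (act ?s b)))
      + (\<Sum>b'\<in>UNIV. scal (gcoef k \<alpha> (act ?s b) b' w) * (hw ?s * hw (?r b')))
      + scal (scoef k \<alpha> i b) * hw w"
    by (simp add: ynf_def distrib_left sum_distrib_left hw_scal)
  also have "heq \<dots> (hw (?s * w) * hys (act (winv w) (act ?s b))
      + (\<Sum>b'\<in>UNIV. scal (gcoef k \<alpha> (act ?s b) b' w) * hw (?s * ?r b'))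
      + scal (scoef k \<alpha> i b) * hw w)"
    by (intro heq_add heq_hw_assoc heq_sum heq_left heq_hw heq_refl) simp
  also have "\<dots> = ynf b (?s * w)"
  proof -
    have "scal (gcoef k \<alpha> b b' (?s * w)) * hw (refl b b' * (?s * w)) =
      scal (gcoef k \<alpha> (act ?s b) (act ?s b') w) * hw (?s * ?r (act ?s b'))
      + (if b' = act ?s b then scal (scoef k \<alpha> i b) * hw w else 0)" for b'
    proof -
      have 1: "refl b b' * (?s * w) = ?s * ?r (act ?s b')" by (rule refl_srefl_mult)
      have 3: "scal (scoef k \<alpha> i b) * hw (refl b b' * (?s * w)) = scal (scoef k \<alpha> i b) * hw w"
        if "b' = act ?s b"
      proof (cases "act ?s b = b")
        case False
        then show ?thesis using srefl_eq_refl[OF False] that by (metis refl_refl_assoc)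
      qed (simp add: scoef_def)
      show ?thesis
      proof (cases "b' = act ?s b")
        case True
        then have 2: "gcoef k \<alpha> b b' (?s * w) = gcoef k \<alpha> (act ?s b) (act ?s b') w + scoef k \<alpha> i b"
          using gcoef_srefl[of k \<alpha> b b' i w] by simp
        show ?thesis unfolding 1[symmetric] 2 scal_add distrib_right 3[OF True] using True by simp
      next
        case False
        then show ?thesis unfolding 1[symmetric] using gcoef_srefl[of k \<alpha> b b' i w] by simp
      qed
    qed
    then show ?thesis
      unfolding ynf_def
      by (subst act_bij_sum[of "\<lambda>b'. scal (gcoef k \<alpha> (act ?s b) b' w) * hw (?s * ?r b')" ?s, symmetric])
         (simp add: sum.distrib winv_times)
  qed
  finally show ?case .
qed

lemma normal_form_hw: "normal_form k \<alpha> (hw u * hw w) = delta (u * w) 1"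
proof (rule normal_form_eqI)
  have "(\<Sum>v\<in>UNIV. hw v * ypoly_free (delta (u * w) 1 v)) =
     (\<Sum>v\<in>UNIV. if v = u * w then hw v * ypoly_free 1 else 0)"
    by (intro sum.cong) (auto simp: delta_def)
  then show "hw u * hw w - (\<Sum>v\<in>UNIV. hw v * ypoly_free (delta (u * w) 1 v)) \<in> hecke_ideal k \<alpha>"
    using rel_mult[of u w k \<alpha>] by (simp add: ypoly_free_one)
qed

lemma normal_form_hy: "normal_form k \<alpha> (hy a * hw w) =
   (\<lambda>v. delta w (ywt (act (winv w) (Pos a))) v
      + (\<Sum>b'\<in>UNIV. delta (refl (Pos a) b' * w) (cst (gcoef k \<alpha> (Pos a) b' w)) v))"
proof (rule normal_form_eqI)
  let ?p = "\<lambda>v. delta w (ywt (act (winv w) (Pos a))) v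
      + (\<Sum>b'\<in>UNIV. delta (refl (Pos a) b' * w) (cst (gcoef k \<alpha> (Pos a) b' w)) v)"
  have *: "(\<Sum>v\<in>UNIV. hw v * ypoly_free (delta u f v)) = hw u * ypoly_free f" for u :: "'a weyl" and f
  proof -
    have "(\<Sum>v\<in>UNIV. hw v * ypoly_free (delta u f v)) =
       (\<Sum>v\<in>UNIV. if v = u then hw v * ypoly_free f else 0)"
      by (intro sum.cong) (auto simp: delta_def)
    then show ?thesis by simp
  qed
  have "(\<Sum>v\<in>UNIV. hw v * ypoly_free (?p v)) = ynf (Pos a) w"
    by (simp add: ypoly_free_add ypoly_free_sum distrib_left sum.distrib sum_distrib_left
        sum.swap[of _ "UNIV :: 'a bas set" "UNIV :: 'a weyl set"] * ynf_def hw_scal ypoly_free_cst)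
  then show "hy a * hw w - (\<Sum>v\<in>UNIV. hw v * ypoly_free (?p v)) \<in> hecke_ideal k \<alpha>"
    using heq_hys_hw[of "Pos a" w] by (simp add: heq_def)
qed

section \<open>Evaluating normal forms: left multiplications as operators on functions on
  W_0\<close>

lemma ypoly_eval_zero [simp]: "ypoly_eval 0 y = 0"
  by (simp add: ypoly_eval_def)

lemma ypoly_eval_add: "ypoly_eval (p + q) y = ypoly_eval p y + ypoly_eval q y"
  unfolding ypoly_eval_def
  by (rule setsum_keys_plus_distrib[of "\<lambda>\<mu> z. z * (\<Prod>i\<in>UNIV. (y $ i) ^ Poly_Mapping.lookup \<mu> i)"])
     (simp_all add: algebra_simps)

lemma ypoly_eval_minus: "ypoly_eval (- p) y = - ypoly_eval p y"
  using ypoly_eval_add[of p "- p" y] by (simp add: eq_neg_iff_add_eq_0 add.commute)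

lemma ypoly_eval_sum: "finite A \<Longrightarrow> ypoly_eval (sum p A) y = (\<Sum>a\<in>A. ypoly_eval (p a) y)"
  by (induction A rule: finite_induct) (simp_all add: ypoly_eval_add)

lemma ypoly_eval_cst [simp]: "ypoly_eval (cst z) y = z"
  by (simp add: ypoly_eval_def)

lemma ypoly_eval_one [simp]: "ypoly_eval 1 y = 1"
  using ypoly_eval_cst[of 1] by simp

fun ysgn :: "'n::finite cvec \<Rightarrow> 'n bas \<Rightarrow> complex" where
  "ysgn y (Pos a) = y $ a"
| "ysgn y (Neg a) = - y $ a"

lemma ypoly_eval_single: "ypoly_eval (Poly_Mapping.single \<mu> z) y =
    z * (\<Prod>i\<in>UNIV. (y $ i) ^ Poly_Mapping.lookup \<mu> i)"
  by (simp add: ypoly_eval_def)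

lemma ypoly_eval_ywt [simp]: "ypoly_eval (ywt b) y = ysgn y b"
proof -
  have "(\<Prod>i\<in>UNIV. (y $ i) ^ Poly_Mapping.lookup (Poly_Mapping.single a 1) i) = y $ a" for a
  proof -
    have "(y $ i) ^ Poly_Mapping.lookup (Poly_Mapping.single a 1) i = (if i = a then y $ i else 1)" for i
      by (auto simp: lookup_single when_def)
    then show ?thesis by simp
  qed
  then show ?thesis
    by (cases b) (simp_all only: ywt.simps ypoly_eval_minus ypoly_eval_single ysgn.simps mult_1)
qed

lemma ypoly_eval_delta: "ypoly_eval (delta w f v) y = (if v = w then ypoly_eval f y else 0)"
  by (simp add: delta_def)

lemma etaL_hw: "etaL k \<alpha> (hw u) y F w = F (winv u * w)"
proof -
  have "v = u * v' \<longleftrightarrow> v' = winv u * v" for v v'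
    by auto
  then show ?thesis
    by (simp add: etaL_def lin_def normal_form_hw ypoly_eval_delta if_distrib cong: if_cong)
qed

lemma etaL_hy: "etaL k \<alpha> (hy a) y F w = ysgn y (act (winv w) (Pos a)) * F w
   + (\<Sum>b'\<in>UNIV. gcoef k \<alpha> (Pos a) b' (refl (Pos a) b' * w) * F (refl (Pos a) b' * w))"
proof -
  have "w = refl b b' * v \<longleftrightarrow> v = refl b b' * w" for v b b'
    by auto
  moreover have "w = v \<longleftrightarrow> v = w" for v by auto
  ultimately show ?thesis
    by (simp add: etaL_def lin_def normal_form_hy ypoly_eval_delta ypoly_eval_add ypoly_eval_sum
        distrib_left sum.distrib sum_distrib_left if_distrib[of "\<lambda>x. _ * x"]
        sum.swap[of _ "UNIV :: 'a bas set" "UNIV :: 'a weyl set"] mult.commute cong: if_cong)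
qed

end


section \<open>The differential operators\<close>

text \<open>The multi-index of the basis vector w (v_1 \<otimes> ... \<otimes> v_n), at which
  \<open>phi F\<close> has coefficient F w. All operators are compared on frames, and shown to
  vanish at the remaining multi-indices.\<close>

definition frame :: "'n weyl \<Rightarrow> 'n \<Rightarrow> 'n bas" where
  "frame w = act w \<circ> Pos"

lemma frame_app [simp]: "frame w i = act w (Pos i)"
  by (simp add: frame_def)

lemma frame_eq_iff [simp]: "frame u = frame w \<longleftrightarrow> u = w"
proof
  assume eq: "frame u = frame w"
  show "u = w"
  proof (rule weyl_eqI)
    fix b
    show "act u b = act w b"
      using fun_cong[OF eq] act_bar[of u "Pos _"] act_bar[of w "Pos _"] by (cases b) auto
  qed
qed simp

lemma tact_vtop: "tact w vtop \<iota> = (if \<iota> = frame w then 1 else 0)"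
proof -
  have "inv (act w) \<circ> \<iota> = Pos \<longleftrightarrow> \<iota> = frame w"
    by (auto simp: inv_act fun_eq_iff act_winv_eq)
  then show ?thesis by (simp add: tact_def vtop_def)
qed

lemma phi_frame [simp]: "phi F (frame w) = F w"
  by (simp add: phi_def lin_def tact_vtop if_distrib[of "\<lambda>x. _ * x"] cong: if_cong)

lemma phi_outside: "\<iota> \<notin> range frame \<Longrightarrow> phi F \<iota> = 0"
  by (simp add: phi_def lin_def tact_vtop image_iff)

lemma V0_eq: "V0 = range phi"
  by (auto simp: V0_def phi_def lin_def[abs_def])

lemma phi_eqI: "(\<And>w. u (frame w) = F w) \<Longrightarrow> (\<And>\<iota>. \<iota> \<notin> range frame \<Longrightarrow> u \<iota> = 0) \<Longrightarrow> u = phi F"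
  by (rule ext) (metis phi_frame phi_outside rangeE)

text \<open>Up to bar, each letter occurs at exactly one position of a frame, so left multiplication
  by a reflection in two letters changes only the positions holding them.\<close>

lemma refl_frame_upd2:
  assumes "i \<noteq> j" "act w (Pos i) = p" "act w (Pos j) = q"
  shows "(frame w)(i := q, j := p) = frame (refl p q * w)"
    and "(frame w)(i := bar q, j := bar p) = frame (refl p (bar q) * w)"
  using assms
  by (auto simp: fun_eq_iff refl.rep_eq simp flip: act_bar)

lemma refl_frame_upd1:
  assumes "act w (Pos i) = p"
  shows "(frame w)(i := bar p) = frame (refl p (bar p) * w)"
  using assms by (auto simp: fun_eq_iff refl.rep_eq simp flip: act_bar)

text \<open>The letter moves made by the operators are undone by moves of the same kind, which
  preserve frames. Here and in \<open>frame_upd2D\<close> this shows that no move leads from outside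
  the frames to a frame, so the operators preserve (V^n)_0.\<close>

lemma frame_upd1D: "\<iota>(i := bar (\<iota> i)) \<in> range frame \<Longrightarrow> \<iota> \<in> range frame"
proof -
  assume "\<iota>(i := bar (\<iota> i)) \<in> range frame"
  then obtain w where w: "frame w = \<iota>(i := bar (\<iota> i))" by auto
  then have "act w (Pos i) = bar (\<iota> i)" by (metis frame_app fun_upd_same)
  from refl_frame_upd1[OF this] show ?thesis unfolding w by simp
qed

lemma frame_upd2D:
  assumes "i \<noteq> j" "\<iota> i = p" "\<iota>(i := q, j := p') \<in> range frame" "\<iota> j = q \<and> p' = p \<or> \<iota> j = bar q \<and> p' = bar p"
  shows "\<iota> \<in> range frame"
proof -
  obtain w where w: "frame w = \<iota>(i := q, j := p')" using assms(3) by auto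
  then have wi: "act w (Pos i) = q" "act w (Pos j) = p'"
    using assms(1) by (metis frame_app fun_upd_other fun_upd_same)+
  from refl_frame_upd2[OF assms(1) wi] have "\<iota>(i := p', j := q) \<in> range frame"
    "\<iota>(i := bar p', j := bar q) \<in> range frame"
    unfolding w using assms(1) by (simp_all add: fun_upd_twist)
  moreover have "\<iota>(i := p', j := q) = \<iota> \<or> \<iota>(i := bar p', j := bar q) = \<iota>"
    using assms by auto
  ultimately show ?thesis by metis
qed

lemma at_pos_unit: "at_pos j (unit p q) u \<iota> = (if \<iota> j = p then u (\<iota>(j := q)) else 0)"
proof -
  have "unit p q (\<iota> j) b * u (\<iota>(j := b)) = (if b = q then if \<iota> j = p then u (\<iota>(j := q)) else 0 else 0)" for b
    by (auto simp: unit_def)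
  then show ?thesis by (simp add: at_pos_def)
qed

lemma at_pos_add: "at_pos j (\<lambda>p q. M p q + N p q) u \<iota> = at_pos j M u \<iota> + at_pos j N u \<iota>"
  by (simp add: at_pos_def distrib_right sum.distrib)

definition symunit :: "'n bas \<Rightarrow> 'n bas \<Rightarrow> 'n mat1" where
  "symunit a b = (\<lambda>p q. unit a b p q + unit (bar a) (bar b) p q)"

lemma Emat_eq: "Emat a b = symunit (Pos a) (Pos b)"
  by (simp add: Emat_def symunit_def)

lemma Ebarmat_eq: "Ebarmat a b = symunit (Pos a) (Neg b)"
  by (simp add: Ebarmat_def symunit_def)

lemma symunit_bar: "symunit (bar a) (bar b) = symunit a b"
  by (simp add: symunit_def add.commute)

lemma at_pos_symunit: "at_pos j (symunit p q) u \<iota> =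
    (if \<iota> j = p then u (\<iota>(j := q)) else 0) + (if \<iota> j = bar p then u (\<iota>(j := bar q)) else 0)"
  by (simp add: symunit_def at_pos_add at_pos_unit)

text \<open>The common shape of X, Y and Z, which arise from the sign choices for p and q. The
  second summand is the first with (p, q) replaced by (bar q, bar p), so one entry computation
  serves both.\<close>

definition pair_op :: "'n::{finite,linorder} bas \<Rightarrow> 'n bas \<Rightarrow> 'n tens \<Rightarrow> 'n tens" where
  "pair_op p q u \<iota> = (\<Sum>(i, j) | i < j.
      at_pos i (unit p q) (at_pos j (symunit q p) u) \<iota>
    + at_pos i (unit (bar q) (bar p)) (at_pos j (symunit p q) u) \<iota>)"

lemma Xop_eq: "Xop a b = pair_op (Pos a) (Pos b)"
  by (simp add: Xop_def pair_op_def Emat_eq fun_eq_iff)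

lemma Yop_eq: "Yop a b = pair_op (Pos a) (Neg b)"
proof -
  have "symunit (Pos b) (Neg a) = symunit (Neg b) (Pos a)"
    using symunit_bar[of "Neg b" "Pos a"] by simp
  then show ?thesis by (intro ext) (simp add: Yop_def pair_op_def Ebarmat_eq)
qed

lemma Zop_eq: "Zop a b = pair_op (Neg a) (Pos b)"
proof -
  have "symunit (Pos a) (Neg b) = symunit (Neg a) (Pos b)"
    using symunit_bar[of "Neg a" "Pos b"] by simp
  then show ?thesis by (intro ext) (simp add: Zop_def pair_op_def Ebarmat_eq)
qed

text \<open>Replacing p by q at position i, and q by p or bar q by bar p at position j, is in either
  case the effect of \<open>refl p q\<close> on the letters.\<close>

lemma pair_entry_frame:
  assumes "i \<noteq> j"
  shows "at_pos i (unit p q) (at_pos j (symunit q p) (phi F)) (frame w) =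
    (if act (winv w) p = Pos i \<and> (act (winv w) q = Pos j \<or> act (winv w) q = Neg j)
     then F (refl p q * w) else 0)"
proof -
  have 0: "act w (Neg l) = bar (act w (Pos l))" for l
    using act_bar[of w "Pos l"] by simp
  have 1: "phi F ((frame w)(i := act w (Pos j), j := act w (Pos i))) = F (refl (act w (Pos i)) (act w (Pos j)) * w)"
    using refl_frame_upd2(1)[OF assms refl refl] by simp
  have 2: "phi F ((frame w)(i := bar (act w (Pos j)), j := bar (act w (Pos i))))
      = F (refl (act w (Pos i)) (bar (act w (Pos j))) * w)"
    using refl_frame_upd2(2)[OF assms refl refl] by simp
  show ?thesis using assms 1 2
    by (auto simp: at_pos_unit at_pos_symunit act_winv_eq 0)
qed

lemma pair_entry_outside:
  assumes "i \<noteq> j" "\<iota> \<notin> range frame"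
  shows "at_pos i (unit p q) (at_pos j (symunit q p) (phi F)) \<iota> = 0"
proof -
  have "phi F (\<iota>(i := q, j := p)) = 0" if "\<iota> i = p" "\<iota> j = q"
    using frame_upd2D[OF assms(1), of \<iota> p q p] that assms(2) by (blast intro: phi_outside)
  moreover have "phi F (\<iota>(i := q, j := bar p)) = 0" if "\<iota> i = p" "\<iota> j = bar q"
    using frame_upd2D[OF assms(1), of \<iota> p q "bar p"] that assms(2) by (blast intro: phi_outside)
  ultimately show ?thesis using assms(1)
    by (auto simp: at_pos_unit at_pos_symunit)
qed

lemma pair_op_outside: "\<iota> \<notin> range frame \<Longrightarrow> pair_op p q (phi F) \<iota> = 0"
  using pair_entry_outside[of _ _ \<iota> p q F] pair_entry_outside[of _ _ \<iota> "bar q" "bar p" F]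
  by (simp add: pair_op_def symunit_bar) (auto intro!: sum.neutral)

lemma sum_less_pair: "(\<Sum>(i, j) | i < j. if a = i \<and> b = j then z else 0) = (if a < b then z else (0::complex))"
  for a b :: "'n::{finite,linorder}"
proof -
  have "(\<Sum>(i, j) | i < j. if a = i \<and> b = j then z else 0) =
    (\<Sum>ij\<in>{(i, j). i < j}. if (a, b) = ij then z else 0)"
    by (intro sum.cong) (auto simp: case_prod_unfold)
  also have "\<dots> = (if a < b then z else 0)"
    by (subst sum.delta') auto
  finally show ?thesis .
qed

text \<open>This is where i < j turns into a positivity condition. Two unbarred positions w^{-1} p,
  w^{-1} q are compared by the first summand and two barred ones by the second; in the mixed case
  Pos, Neg the summands ask for a < b and b < a, one of which holds when a and b differ. For q = p
  or q = bar p no two distinct positions qualify.\<close>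

lemma pair_op_frame:
  "pair_op p q (phi F) (frame w) =
    (if q \<noteq> p \<and> q \<noteq> bar p \<and> prec (act (winv w) p) (act (winv w) q) then F (refl p q * w) else 0)"
proof -
  let ?x = "act (winv w) p" and ?y = "act (winv w) q" and ?z = "F (refl p q * w)"
  have eq: "pair_op p q (phi F) (frame w) = (\<Sum>(i, j) | i < j.
      (if ?x = Pos i \<and> (?y = Pos j \<or> ?y = Neg j) then ?z else 0)
    + (if ?y = Neg i \<and> (?x = Pos j \<or> ?x = Neg j) then ?z else 0))"
  proof -
    have 1: "at_pos i (unit p q) (at_pos j (symunit q p) (phi F)) (frame w)
      = (if ?x = Pos i \<and> (?y = Pos j \<or> ?y = Neg j) then ?z else 0)" if "i < j" for i j
      using pair_entry_frame[of i j] that by auto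
    have 2: "at_pos i (unit (bar q) (bar p)) (at_pos j (symunit p q) (phi F)) (frame w)
      = (if ?y = Neg i \<and> (?x = Pos j \<or> ?x = Neg j) then ?z else 0)" if "i < j" for i j
    proof -
      have "bar b = Pos l \<longleftrightarrow> b = Neg l" "bar b = Neg l \<longleftrightarrow> b = Pos l" for b :: "'a bas" and l
        by (cases b; simp)+
      moreover have "refl (bar q) (bar p) = refl p q"
        by (metis refl_bar refl_commute)
      ultimately show ?thesis
        using pair_entry_frame[of i j "bar q" "bar p" F w] that
        by (auto simp: symunit_bar act_winv_bar)
    qed
    show ?thesis unfolding pair_op_def using 1 2 by (intro sum.cong) auto
  qed
  have *: "(\<Sum>(i, j) | i < j. (if a = i \<and> b = j then ?z else 0) + (if b' = i \<and> a' = j then ?z else 0))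
     = (if a < b then ?z else 0) + (if b' < a' then ?z else 0)" for a b a' b' :: 'a
    using sum_less_pair[of a b ?z] sum_less_pair[of b' a' ?z]
    by (simp add: case_prod_unfold sum.distrib)
  have ne: "?y = ?x \<longleftrightarrow> q = p" "?y = bar ?x \<longleftrightarrow> q = bar p"
    by (simp_all flip: act_winv_bar)
  show ?thesis
  proof (cases ?x; cases ?y)
    fix a b assume "?x = Pos a" "?y = Pos b"
    then show ?thesis unfolding eq using ne sum_less_pair[of a b ?z] by auto
  next
    fix a b assume xy: "?x = Pos a" "?y = Neg b"
    then have "pair_op p q (phi F) (frame w) = (if a < b then ?z else 0) + (if b < a then ?z else 0)"
      unfolding eq using *[of a b b a] by simp
    then show ?thesis using ne xy by auto
  next
    fix a b assume "?x = Neg a" "?y = Pos b"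
    then show ?thesis unfolding eq by simp
  next
    fix a b assume "?x = Neg a" "?y = Neg b"
    then show ?thesis unfolding eq using ne sum_less_pair[of b a ?z] by auto
  qed
qed

lemma sum_Collect: "(\<Sum>p | P p. g p) = (\<Sum>p\<in>UNIV. if P p then g p else 0)" for g :: "'n::finite \<Rightarrow> complex"
  by (simp add: sum.If_cases)

lemma sum_bas: "(\<Sum>b\<in>UNIV. f b) = (\<Sum>a\<in>UNIV. f (Pos a)) + (\<Sum>a\<in>UNIV. f (Neg a))"
  for f :: "'n::finite bas \<Rightarrow> complex"
proof -
  have "(UNIV :: 'n bas set) = range Pos \<union> range Neg"
    by (auto simp: image_iff) (metis bas.exhaust)
  then have "(\<Sum>b\<in>UNIV. f b) = sum f (range Pos \<union> range Neg)" by (rule arg_cong)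
  also have "\<dots> = (\<Sum>a\<in>UNIV. f (Pos a)) + (\<Sum>a\<in>UNIV. f (Neg a))"
    by (subst sum.union_disjoint) (auto simp: sum.reindex inj_def)
  finally show ?thesis .
qed

lemma diag_frame: "(\<Sum>j\<in>UNIV. y $ j * (at_pos j (unit (Pos a) (Pos a)) (phi F) (frame w)
      - at_pos j (unit (Neg a) (Neg a)) (phi F) (frame w))) = ysgn y (act (winv w) (Pos a)) * F w"
proof -
  have "y $ j * (at_pos j (unit (Pos a) (Pos a)) (phi F) (frame w)
      - at_pos j (unit (Neg a) (Neg a)) (phi F) (frame w)) =
     (if act (winv w) (Pos a) = Pos j then y $ j * F w else 0)
     - (if act (winv w) (Pos a) = Neg j then y $ j * F w else 0)" for j
  proof -
    have "act w (Neg j) = bar (act w (Pos j))" using act_bar[of w "Pos j"] by simp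
    moreover have "(frame w)(j := b) = frame w" if "act w (Pos j) = b" for b
      using that by (auto simp: fun_eq_iff)
    ultimately show ?thesis
      by (cases "act w (Pos j)") (auto simp: at_pos_unit act_winv_eq algebra_simps)
  qed
  then show ?thesis
    by (cases "act (winv w) (Pos a)") (simp_all add: sum_subtractf sum_negf)
qed

lemma long_frame: "(\<Sum>j\<in>UNIV. at_pos j (unit p (bar p)) (phi F) (frame w)) =
    (if prec (act (winv w) p) (act (winv w) (bar p)) then F (refl p (bar p) * w) else 0)"
proof -
  have "at_pos j (unit p (bar p)) (phi F) (frame w) =
    (if act (winv w) p = Pos j then F (refl p (bar p) * w) else 0)" for j
    using refl_frame_upd1[of w j p] by (auto simp: at_pos_unit act_winv_eq)
  then show ?thesis
    by (cases "act (winv w) p") (simp_all add: act_winv_bar)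
qed

lemma long_outside: "\<iota> \<notin> range frame \<Longrightarrow> at_pos j (unit p (bar p)) (phi F) \<iota> = 0"
  using frame_upd1D[of \<iota> j] by (auto simp: at_pos_unit intro: phi_outside)

lemma diag_outside: "\<iota> \<notin> range frame \<Longrightarrow> at_pos j (unit p p) (phi F) \<iota> = 0"
proof -
  have "\<iota>(j := p) = \<iota>" if "\<iota> j = p" using that by auto
  then show "\<iota> \<notin> range frame \<Longrightarrow> at_pos j (unit p p) (phi F) \<iota> = 0"
    by (auto simp: at_pos_unit intro: phi_outside)
qed

lemma Ebar_diag_frame: "(\<Sum>j\<in>UNIV. at_pos j (Ebarmat a a) (phi F) (frame w)) = F (refl (Pos a) (Neg a) * w)"
proof -
  have "refl (Neg a) (Pos a) = refl (Pos a) (Neg a)" by (rule refl_commute)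
  moreover have "prec (act (winv w) (Pos a)) (act (winv w) (Neg a)) \<longleftrightarrow>
     \<not> prec (act (winv w) (Neg a)) (act (winv w) (Pos a))"
    using prec_total[of "act (winv w) (Pos a)" "act (winv w) (Neg a)"] prec_asym by auto
  ultimately show ?thesis
    using long_frame[of "Pos a" F w] long_frame[of "Neg a" F w]
    by (simp add: Ebarmat_def at_pos_add sum.distrib)
qed

lemma Aop_outside: "\<iota> \<notin> range frame \<Longrightarrow> Aop k \<alpha> a y (phi F) \<iota> = 0"
  using long_outside[of \<iota> _ "Pos a" F]
  by (simp add: Aop_def diag_outside Xop_eq Yop_eq pair_op_outside)

lemma Bop_outside: "\<iota> \<notin> range frame \<Longrightarrow> Bop k \<alpha> \<beta> a x (phi F) \<iota> = 0"
  using long_outside[of \<iota> _ "Pos a" F] long_outside[of \<iota> _ "Neg a" F]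
  by (simp add: Bop_def Ebarmat_def at_pos_add Xop_eq Yop_eq Zop_eq pair_op_outside)

lemma gcoef_refl: "gcoef k \<alpha> b b' (refl b b' * w) =
   (if prec b b' \<and> prec (act (winv w) b) (act (winv w) b') then kap k \<alpha> b b'
     else if prec b' b \<and> prec (act (winv w) b') (act (winv w) b) then - kap k \<alpha> b b' else 0)"
  by (simp add: gcoef_def winv_times)

text \<open>Letter by letter comparison with \<open>etaL_hy\<close>: b' = Pos p yields X_{ap} for p
  > a and - X_{pa} for p < a, and b' = Neg p yields Y_{ap}. The letter Neg a supplies the 2 \<alpha>
  term, since Y_{aa} vanishes on frames. The reflection in the argument of \<open>gcoef\<close>
  reverses its second comparison into that of \<open>pair_op_frame\<close>.\<close>

lemma Aop_frame: "Aop k \<alpha> a y (phi F) (frame w) = etaL k \<alpha> (hy a) y F w"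
proof -
  let ?x = "act (winv w) (Pos a)"
  let ?f = "\<lambda>b. gcoef k \<alpha> (Pos a) b (refl (Pos a) b * w) * F (refl (Pos a) b * w)"
  have 1: "?f (Pos p) = k * ((if a < p then Xop a p (phi F) (frame w) else 0)
      - (if p < a then Xop p a (phi F) (frame w) else 0))" for p
    unfolding gcoef_refl Xop_eq pair_op_frame refl_commute[of "Pos p" "Pos a"]
    by (cases a p rule: linorder_cases) (auto simp: kap_def)
  have 2: "?f (Neg p) = k * Yop a p (phi F) (frame w)
      + (if p = a then 2 * \<alpha> * (\<Sum>j\<in>UNIV. at_pos j (unit (Pos a) (Neg a)) (phi F) (frame w)) else 0)" for p
    using long_frame[of "Pos a" F w]
    by (auto simp: gcoef_refl Yop_eq pair_op_frame kap_def)
  show ?thesis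
    unfolding etaL_hy sum_bas Aop_def diag_frame 1 2 sum_Collect
    by (simp only: sum.distrib sum_subtractf sum.delta' sum.delta finite_UNIV UNIV_I if_True flip: sum_distrib_left)
       (simp add: algebra_simps)
qed

text \<open>In X_{ap} + X_{pa} and in Y_{ap} + Z_{ap} with p different from a the two order
  conditions are complementary, so each sum is a full reflection without any condition on w. The p =
  a term of the latter sum vanishes on frames.\<close>

lemma Bop_frame: "Bop k \<alpha> \<beta> a x (phi F) (frame w) =
   2 * ((\<alpha> + \<beta> * x $ a) / ((x $ a)^2 - 1)) * F (refl_long a * w)
     + k * ((\<Sum>j | j < a. x $ a / (x $ a - x $ j) * F (refl_minus j a * w))
          + (\<Sum>j | a < j. x $ j / (x $ a - x $ j) * F (refl_minus a j * w))
          + (\<Sum>j | j \<noteq> a. 1 / (x $ a * x $ j - 1) * F (refl_plus a j * w)))"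
proof -
  have tot: "prec (act u b) (act u b') \<longleftrightarrow> \<not> prec (act u b') (act u b)" if "b \<noteq> b'" for u :: "'a weyl" and b b'
    using prec_total[of "act u b" "act u b'"] prec_asym that by auto
  have X: "Xop a p (phi F) (frame w) + Xop p a (phi F) (frame w) = F (refl (Pos a) (Pos p) * w)"
    if "p \<noteq> a" for p
    using that tot[of "Pos a" "Pos p" "winv w"] refl_commute[of "Pos a" "Pos p"]
    by (simp add: Xop_eq pair_op_frame)
  have YZ: "Yop a p (phi F) (frame w) + Zop a p (phi F) (frame w) =
     (if p \<noteq> a then F (refl (Pos a) (Neg p) * w) else 0)" for p
  proof -
    have "prec (act (winv w) (Neg a)) (act (winv w) (Pos p)) \<longleftrightarrow>
        prec (act (winv w) (Neg p)) (act (winv w) (Pos a))"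
      using act_winv_bar[of w "Pos a"] act_winv_bar[of w "Neg p"] by simp
    then show ?thesis
      using tot[of "Pos a" "Neg p" "winv w"] refl_bar[of "Pos a" "Neg p"]
      by (auto simp: Yop_eq Zop_eq pair_op_frame)
  qed
  show ?thesis
    unfolding Bop_def YZ Ebar_diag_frame sum_Collect refl_long_eq
    by (intro arg_cong2[of _ _ _ _ "(+)"] arg_cong2[of _ _ _ _ "(*)"] sum.cong refl)
       (auto simp: X refl_minus_eq refl_plus_eq refl_commute[of _ "Pos a"] refl_commute[of "Neg _" "Pos a"])
qed

lemma refl_winv: "winv (refl_long a) = refl_long a"
  "i \<noteq> j \<Longrightarrow> winv (refl_minus i j) = refl_minus i j"
  "i \<noteq> j \<Longrightarrow> winv (refl_plus i j) = refl_plus i j"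
  by (simp_all add: refl_long_eq refl_minus_eq refl_plus_eq)

lemma AB_phi: "(\<lambda>\<iota>. Aop k \<alpha> a (snd p) (phi F) \<iota> + Bop k \<alpha> \<beta> a (fst p) (phi F) \<iota>) =
   phi (Lop k \<alpha> \<beta> a p F)"
proof (rule phi_eqI)
  fix w
  show "Aop k \<alpha> a (snd p) (phi F) (frame w) + Bop k \<alpha> \<beta> a (fst p) (phi F) (frame w) = Lop k \<alpha> \<beta> a p F w"
    unfolding Aop_frame Bop_frame Lop_def Let_def etaL_hw refl_winv(1)
    by (simp add: refl_winv)
qed (simp add: Aop_outside Bop_outside)


section \<open>The difference operators\<close>

lemma comp_list_simps [simp]:
  "comp_list [] = id" "comp_list (f # fs) = f \<circ> comp_list fs"
  by (simp_all add: comp_list_def)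

lemma comp_list_append [simp]: "comp_list (fs @ gs) = comp_list fs \<circ> comp_list gs"
  by (induction fs) (simp_all add: o_assoc)

lemma comp_list_conj:
  assumes "\<And>i F. i \<in> set L \<Longrightarrow> \<tau> (A i F) = B i (\<tau> F)"
  shows "\<tau> (comp_list (map A L) F) = comp_list (map B L) (\<tau> F)"
  using assms by (induction L) auto

definition inverse_ops :: "('a \<Rightarrow> 'a) \<Rightarrow> ('a \<Rightarrow> 'a) \<Rightarrow> bool" where
  "inverse_ops A B \<longleftrightarrow> (\<forall>F. A (B F) = F) \<and> (\<forall>F. B (A F) = F)"

lemma inverse_ops_comp: "inverse_ops A B \<Longrightarrow> inverse_ops A' B' \<Longrightarrow> inverse_ops (A \<circ> A') (B' \<circ> B)"
  by (simp add: inverse_ops_def)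

lemma inverse_ops_comp_list:
  "(\<And>i. i \<in> set L \<Longrightarrow> inverse_ops (A i) (B i)) \<Longrightarrow>
    inverse_ops (comp_list (map A L)) (comp_list (map B (rev L)))"
  by (induction L) (auto simp: inverse_ops_def)

text \<open>The operators of both systems, transported to functions on \<open>W_0\<close>: \<open>Rop\<close> corresponds to
  \<open>R\<close>, \<open>Sop\<close> to the product of \<open>R\<close> with the flip, and \<open>Kop\<close> to \<open>K\<close>.\<close>

definition Rop :: "complex \<Rightarrow> complex \<Rightarrow> 'n weyl \<Rightarrow> ('n weyl \<Rightarrow> complex) \<Rightarrow> 'n weyl \<Rightarrow> complex" where
  "Rop k z g F w = (z * F w + k * F (w * g)) / (z + k)"

definition Sop :: "complex \<Rightarrow> complex \<Rightarrow> 'n weyl \<Rightarrow> ('n weyl \<Rightarrow> complex) \<Rightarrow> 'n weyl \<Rightarrow> complex" where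
  "Sop k z g F w = (z * F (w * g) + k * F w) / (z + k)"

definition Kop :: "('n bas \<Rightarrow> complex) \<Rightarrow> complex \<Rightarrow> complex \<Rightarrow> 'n \<Rightarrow> ('n weyl \<Rightarrow> complex) \<Rightarrow> 'n weyl \<Rightarrow> complex" where
  "Kop t z b m F w = (z * t (act w (Pos m)) * F (w * refl (Pos m) (Neg m)) + b * F w) / (z + b)"

text \<open>Right translation; for a transposition s of two unbarred letters it corresponds under
  \<open>phi\<close> to the flip of tensor factors, by \<open>frame_transpose\<close>.\<close>

definition tr :: "'n weyl \<Rightarrow> ('n weyl \<Rightarrow> complex) \<Rightarrow> 'n weyl \<Rightarrow> complex" where
  "tr s F w = F (w * s)"

text \<open>The monomial x^{e_b}. It is the entry of T(x) from the letter bar b to b, and also the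
  factor produced when the lattice part of s_0 is moved to the left of a group element.\<close>

fun xlet :: "'n::finite cvec \<Rightarrow> 'n bas \<Rightarrow> complex" where
  "xlet x (Pos a) = x $ a"
| "xlet x (Neg a) = inverse (x $ a)"

lemma xlet_one: "xlet (\<chi> i. 1) = (\<lambda>_. 1)"
proof
  show "xlet (\<chi> i. 1) b = 1" for b :: "'a bas" by (cases b) auto
qed

lemma frame_transpose: "frame w \<circ> Transposition.transpose i j = frame (w * refl (Pos i) (Pos j))"
  by (auto simp: fun_eq_iff Transposition.transpose_def refl.rep_eq)

lemma Rmat_phi: "Rmat k i j z (phi F) = phi (Rop k z (refl (Pos i) (Pos j)) F)"
proof (rule phi_eqI)
  fix w
  show "Rmat k i j z (phi F) (frame w) = Rop k z (refl (Pos i) (Pos j)) F w"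
    by (simp add: Rmat_def flip_def Rop_def frame_transpose)
next
  fix \<iota> :: "'a \<Rightarrow> 'a bas"
  assume *: "\<iota> \<notin> range frame"
  have "\<iota> \<circ> Transposition.transpose i j \<notin> range frame"
  proof
    assume "\<iota> \<circ> Transposition.transpose i j \<in> range frame"
    then obtain w where w: "\<iota> \<circ> Transposition.transpose i j = frame w" by auto
    then have "\<iota> = frame w \<circ> Transposition.transpose i j"
      by (simp add: fun_eq_iff) (metis transpose_involutory)
    then show False using * by (simp add: frame_transpose)
  qed
  then show "Rmat k i j z (phi F) \<iota> = 0"
    using * by (simp add: Rmat_def flip_def phi_outside)
qed

lemma Tmat_eq: "Tmat x p q = (if q = bar p then xlet x p else 0)"
  by (cases p; cases q) auto

lemma at_pos_Kmat: "at_pos m (Kmat z x b) u \<iota> =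
   (z * xlet x (\<iota> m) * u (\<iota>(m := bar (\<iota> m))) + b * u \<iota>) / (z + b)"
proof -
  have "Kmat z x b (\<iota> m) q * u (\<iota>(m := q)) =
     (if q = bar (\<iota> m) then z * xlet x (\<iota> m) * u (\<iota>(m := bar (\<iota> m))) / (z + b) else 0)
     + (if q = \<iota> m then b * u \<iota> / (z + b) else 0)" for q
    by (auto simp: Kmat_def Tmat_eq)
  then show ?thesis by (simp add: at_pos_def sum.distrib add_divide_distrib)
qed

lemma Kmat_phi: "at_pos m (Kmat z x b) (phi F) = phi (Kop (xlet x) z b m F)"
proof (rule phi_eqI)
  fix w
  have "refl (act w (Pos m)) (bar (act w (Pos m))) * w = w * refl (Pos m) (Neg m)"
    using refl_conj[of w "Pos m" "Neg m"] act_bar[of w "Pos m"] by simp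
  then show "at_pos m (Kmat z x b) (phi F) (frame w) = Kop (xlet x) z b m F w"
    using refl_frame_upd1[of w m, OF refl] by (simp add: at_pos_Kmat Kop_def)
next
  fix \<iota> :: "'a \<Rightarrow> 'a bas"
  assume *: "\<iota> \<notin> range frame"
  then have "\<iota>(m := bar (\<iota> m)) \<notin> range frame" by (rule contrapos_nn) (rule frame_upd1D)
  then show "at_pos m (Kmat z x b) (phi F) \<iota> = 0"
    using * by (simp add: at_pos_Kmat phi_outside)
qed

definition Qg :: "complex \<Rightarrow> complex \<Rightarrow> complex \<Rightarrow> complex \<Rightarrow> 'n::{finite,linorder} \<Rightarrow> 'n pt \<Rightarrow>
    ('n weyl \<Rightarrow> complex) \<Rightarrow> 'n weyl \<Rightarrow> complex" where
  "Qg c k \<alpha> \<beta> m p = (let x = fst p; y = ($) (snd p) in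
       comp_list (map (\<lambda>i. Rop k (y m - y i - c) (refl (Pos m) (Pos i))) (rev (ilist {..<m})))
     \<circ> Kop (xlet x) (y m - c/2) \<beta> m
     \<circ> comp_list (map (\<lambda>i. Rop k (y i + y m) (refl (Pos i) (Pos m))) (ilist {..<m}))
     \<circ> comp_list (map (\<lambda>i. Rop k (y m + y i) (refl (Pos m) (Pos i))) (ilist {m<..}))
     \<circ> Kop (\<lambda>_. 1) (y m) \<alpha> m
     \<circ> comp_list (map (\<lambda>i. Rop k (y m - y i) (refl (Pos m) (Pos i))) (rev (ilist {m<..}))))"

lemma comp_list_Rmat:
  "comp_list (map (\<lambda>i. Rmat k (f i) (g i) (z i)) L) (phi F) =
   phi (comp_list (map (\<lambda>i. Rop k (z i) (refl (Pos (f i)) (Pos (g i)))) L) F)"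
  by (induction L) (simp_all add: Rmat_phi)

lemma Qop_phi: "Qop c k \<alpha> \<beta> m p (phi F) = phi (Qg c k \<alpha> \<beta> m p F)"
  unfolding Qop_def Qg_def Let_def o_apply
  by (simp only: comp_list_Rmat Kmat_phi xlet_one)

lemma Sop_eq: "s * s = 1 \<Longrightarrow> Sop k z s F = Rop k z s (tr s F)"
  by (simp add: Sop_def Rop_def tr_def fun_eq_iff mult.assoc)

lemma Sop_eq': "Sop k z s F = tr s (Rop k z s F)" if "s * s = 1"
  by (simp add: Sop_def Rop_def tr_def fun_eq_iff mult.assoc that)

lemma tr_tr: "s * s = 1 \<Longrightarrow> tr s (tr s F) = F"
  by (simp add: tr_def fun_eq_iff mult.assoc)

lemma tr_Rop: "g * s = s * h \<Longrightarrow> tr s (Rop k z h F) = Rop k z g (tr s F)"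
  by (simp add: tr_def Rop_def fun_eq_iff mult.assoc)

lemma tr_Kop: "act s (Pos m) = Pos m' \<Longrightarrow> tr s (Kop t z b m F) = Kop t z b m' (tr s F)"
proof -
  assume *: "act s (Pos m) = Pos m'"
  then have "act s (Neg m) = Neg m'" using act_bar[of s "Pos m"] by simp
  with * have "refl (Pos m') (Neg m') * s = s * refl (Pos m) (Neg m)" by (simp add: refl_conj)
  with * show ?thesis by (simp add: tr_def Kop_def fun_eq_iff mult.assoc)
qed

lemma act_srefl_lt: "j < i \<Longrightarrow> act (srefl i) (Pos j) = Pos j"
proof (cases "i = lastix")
  case False
  assume "j < i"
  then have "j \<noteq> i" "j \<noteq> nxt i" using nxt_greater[OF False] by auto
  then show ?thesis using False by (simp add: act_srefl_Pos)
qed (auto simp: act_srefl_Pos)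

text \<open>Moving all flips to one side turns the products of the \<open>Sop\<close> along adjacent transpositions
  into the products of the \<open>Rop\<close> along the transpositions that involve \<open>m\<close>.\<close>

lemma telescope_up:
  fixes m :: "'n::{finite,linorder}"
  shows "comp_list (map (\<lambda>i. Sop k (a i) (srefl i)) (rev (ilist {..<m})))
     (Kop t z b firstix (comp_list (map (\<lambda>i. Sop k (d i) (srefl i)) (ilist {..<m})) F)) =
   comp_list (map (\<lambda>i. Rop k (a i) (refl (Pos m) (Pos i))) (rev (ilist {..<m})))
     (Kop t z b m (comp_list (map (\<lambda>i. Rop k (d i) (refl (Pos i) (Pos m))) (ilist {..<m})) F))"
proof (induction m arbitrary: F rule: nxt_induct_up)
  case first
  have "{..<firstix} = ({} :: 'n set)" by (auto simp: not_less)
  then show ?case by simp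
next
  case (step m)
  let ?s = "srefl m"
  have s: "?s = refl (Pos m) (Pos (nxt m))" "?s = refl (Pos (nxt m)) (Pos m)"
    using srefl_nonlast[OF step.hyps] refl_commute by metis+
  have 1: "tr ?s (Rop k z (refl (Pos m) (Pos i)) G) = Rop k z (refl (Pos (nxt m)) (Pos i)) (tr ?s G)"
    if "i < m" for i z G
    by (rule tr_Rop) (use act_srefl_self[OF step.hyps] act_srefl_lt[OF that] in \<open>simp add: refl_conj[of ?s]\<close>)
  have 2: "tr ?s (Rop k z (refl (Pos i) (Pos m)) G) = Rop k z (refl (Pos i) (Pos (nxt m))) (tr ?s G)"
    if "i < m" for i z G
    by (rule tr_Rop) (use act_srefl_self[OF step.hyps] act_srefl_lt[OF that] in \<open>simp add: refl_conj[of ?s]\<close>)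
  have c1: "tr ?s (comp_list (map (\<lambda>i. Rop k (a i) (refl (Pos m) (Pos i))) (rev (ilist {..<m}))) G) =
    comp_list (map (\<lambda>i. Rop k (a i) (refl (Pos (nxt m)) (Pos i))) (rev (ilist {..<m}))) (tr ?s G)" for G
    by (rule comp_list_conj[where \<tau> = "tr ?s"]) (simp add: 1)
  have c2: "tr ?s (comp_list (map (\<lambda>i. Rop k (d i) (refl (Pos i) (Pos m))) (ilist {..<m})) G) =
    comp_list (map (\<lambda>i. Rop k (d i) (refl (Pos i) (Pos (nxt m)))) (ilist {..<m})) (tr ?s G)" for G
    by (rule comp_list_conj[where \<tau> = "tr ?s"]) (simp add: 2)
  have "comp_list (map (\<lambda>i. Sop k (a i) (srefl i)) (rev (ilist {..<nxt m})))
     (Kop t z b firstix (comp_list (map (\<lambda>i. Sop k (d i) (srefl i)) (ilist {..<nxt m})) F)) =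
     Sop k (a m) ?s (comp_list (map (\<lambda>i. Sop k (a i) (srefl i)) (rev (ilist {..<m})))
     (Kop t z b firstix (comp_list (map (\<lambda>i. Sop k (d i) (srefl i)) (ilist {..<m})) (Sop k (d m) ?s F))))"
    by (simp add: ilist_lessThan[OF step.hyps])
  \<comment> \<open>The outer \<open>Sop\<close> is split as R after the flip and the inner one as
    the flip after R. The two flips then enclose the shorter product, rename m to
    \<open>nxt m\<close> in it, and cancel.\<close>
  also have "\<dots> = Rop k (a m) ?s (tr ?s (comp_list (map (\<lambda>i. Rop k (a i) (refl (Pos m) (Pos i))) (rev (ilist {..<m})))
     (Kop t z b m (comp_list (map (\<lambda>i. Rop k (d i) (refl (Pos i) (Pos m))) (ilist {..<m}))
       (tr ?s (Rop k (d m) ?s F))))))"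
    by (simp only: step.IH Sop_eq[OF srefl_srefl]) (simp only: Sop_eq[OF srefl_srefl, symmetric] Sop_eq'[OF srefl_srefl, symmetric])
  also have "\<dots> = Rop k (a m) ?s (comp_list (map (\<lambda>i. Rop k (a i) (refl (Pos (nxt m)) (Pos i))) (rev (ilist {..<m})))
     (Kop t z b (nxt m) (comp_list (map (\<lambda>i. Rop k (d i) (refl (Pos i) (Pos (nxt m)))) (ilist {..<m}))
       (Rop k (d m) ?s F))))"
    by (simp only: c1 c2 tr_Kop[OF act_srefl_self[OF step.hyps]] tr_tr[OF srefl_srefl])
  also have "\<dots> = comp_list (map (\<lambda>i. Rop k (a i) (refl (Pos (nxt m)) (Pos i))) (rev (ilist {..<nxt m})))
     (Kop t z b (nxt m) (comp_list (map (\<lambda>i. Rop k (d i) (refl (Pos i) (Pos (nxt m)))) (ilist {..<nxt m})) F))"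
    using s by (simp add: ilist_lessThan[OF step.hyps])
  finally show ?case .
qed

text \<open>Working downwards from \<open>lastix\<close>, \<open>srefl i\<close> becomes the
  transposition joining m with \<open>nxt i\<close>, whereas in \<open>telescope_up\<close> it joins
  m with i. Hence the shifted parameters on the left side.\<close>

lemma telescope_down:
  fixes m :: "'n::{finite,linorder}"
  shows "comp_list (map (\<lambda>i. Sop k (a (nxt i)) (srefl i)) (ilist {m..<lastix}))
     (Kop t z b lastix (comp_list (map (\<lambda>i. Sop k (d (nxt i)) (srefl i)) (rev (ilist {m..<lastix}))) F)) =
   comp_list (map (\<lambda>i. Rop k (a i) (refl (Pos m) (Pos i))) (ilist {m<..}))
     (Kop t z b m (comp_list (map (\<lambda>i. Rop k (d i) (refl (Pos m) (Pos i))) (rev (ilist {m<..}))) F))"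
proof (induction m arbitrary: F rule: nxt_induct_down)
  case last
  have "{lastix<..} = ({} :: 'n set)" by auto
  then show ?case by simp
next
  case (step m)
  let ?s = "srefl m"
  have lt: "m < lastix" using step.hyps by (simp add: order.not_eq_order_implies_strict)
  have s: "?s = refl (Pos m) (Pos (nxt m))"
    using srefl_nonlast[OF step.hyps] .
  have 1: "tr ?s (Rop k z (refl (Pos (nxt m)) (Pos i)) G) = Rop k z (refl (Pos m) (Pos i)) (tr ?s G)"
    if "nxt m < i" for i z G
  proof (rule tr_Rop)
    have "m < i" "nxt m \<noteq> i" using that nxt_greater[OF step.hyps] by auto
    then show "refl (Pos m) (Pos i) * ?s = ?s * refl (Pos (nxt m)) (Pos i)"
      using act_srefl_nxt[OF step.hyps] act_srefl_gt[of m i] by (simp add: refl_conj[of ?s])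
  qed
  have c1: "tr ?s (comp_list (map (\<lambda>i. Rop k (a i) (refl (Pos (nxt m)) (Pos i))) (ilist {nxt m<..})) G) =
    comp_list (map (\<lambda>i. Rop k (a i) (refl (Pos m) (Pos i))) (ilist {nxt m<..})) (tr ?s G)" for G
    by (rule comp_list_conj[where \<tau> = "tr ?s"]) (simp add: 1)
  have c2: "tr ?s (comp_list (map (\<lambda>i. Rop k (d i) (refl (Pos (nxt m)) (Pos i))) (rev (ilist {nxt m<..}))) G) =
    comp_list (map (\<lambda>i. Rop k (d i) (refl (Pos m) (Pos i))) (rev (ilist {nxt m<..}))) (tr ?s G)" for G
    by (rule comp_list_conj[where \<tau> = "tr ?s"]) (simp add: 1)
  have "comp_list (map (\<lambda>i. Sop k (a (nxt i)) (srefl i)) (ilist {m..<lastix}))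
     (Kop t z b lastix (comp_list (map (\<lambda>i. Sop k (d (nxt i)) (srefl i)) (rev (ilist {m..<lastix}))) F)) =
     Sop k (a (nxt m)) ?s (comp_list (map (\<lambda>i. Sop k (a (nxt i)) (srefl i)) (ilist {nxt m..<lastix}))
     (Kop t z b lastix (comp_list (map (\<lambda>i. Sop k (d (nxt i)) (srefl i)) (rev (ilist {nxt m..<lastix})))
       (Sop k (d (nxt m)) ?s F))))"
    by (simp add: ilist_atLeastLessThan[OF lt])
  also have "\<dots> = Rop k (a (nxt m)) ?s (tr ?s (comp_list (map (\<lambda>i. Rop k (a i) (refl (Pos (nxt m)) (Pos i))) (ilist {nxt m<..}))
     (Kop t z b (nxt m) (comp_list (map (\<lambda>i. Rop k (d i) (refl (Pos (nxt m)) (Pos i))) (rev (ilist {nxt m<..})))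
       (tr ?s (Rop k (d (nxt m)) ?s F))))))"
    by (simp only: step.IH Sop_eq[OF srefl_srefl]) (simp only: Sop_eq[OF srefl_srefl, symmetric] Sop_eq'[OF srefl_srefl, symmetric])
  also have "\<dots> = Rop k (a (nxt m)) ?s (comp_list (map (\<lambda>i. Rop k (a i) (refl (Pos m) (Pos i))) (ilist {nxt m<..}))
     (Kop t z b m (comp_list (map (\<lambda>i. Rop k (d i) (refl (Pos m) (Pos i))) (rev (ilist {nxt m<..})))
       (Rop k (d (nxt m)) ?s F))))"
    by (simp only: c1 c2 tr_Kop[OF act_srefl_nxt[OF step.hyps]] tr_tr[OF srefl_srefl])
  also have "\<dots> = comp_list (map (\<lambda>i. Rop k (a i) (refl (Pos m) (Pos i))) (ilist {m<..}))
     (Kop t z b m (comp_list (map (\<lambda>i. Rop k (d i) (refl (Pos m) (Pos i))) (rev (ilist {m<..}))) F))"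
    using s by (simp add: ilist_greaterThan[OF step.hyps])
  finally show ?case .
qed

lemma etaR_waff: "etaR (gel (waff g)) x F w = F (w * winv g)"
proof -
  have "w' * g = w \<longleftrightarrow> w' = w * winv g" for w'
    by (auto simp: mult.assoc)
  moreover have "(\<Sum>h | h \<in> Poly_Mapping.keys (gel (waff g)) \<and> weyl_part (waff w' * h) = w.
      Poly_Mapping.lookup (gel (waff g)) h * xmonom (lattice_part (waff w' * h)) x) =
      (if w' * g = w then 1 else 0)" for w'
  proof -
    have "{h \<in> Poly_Mapping.keys (gel (waff g)). weyl_part (waff w' * h) = w} =
        (if w' * g = w then {waff g} else {})"
      by (auto simp: gel_def waff_def times_aff_def)
    then show ?thesis
      by (simp add: gel_def waff_times[symmetric]) (simp add: waff_def xmonom_def)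
  qed
  ultimately show ?thesis
    by (simp add: etaR_def lin_def if_distrib[of "\<lambda>x. _ * x"] cong: if_cong)
qed

lemma xmonom_signed:
  assumes "\<And>a. \<mu> a = (if Pos a = b then 1 else if Neg a = b then -1 else 0)"
  shows "xmonom \<mu> x = xlet x b"
proof -
  have "(x $ a) powi \<mu> a = (if a = (case b of Pos i \<Rightarrow> i | Neg i \<Rightarrow> i) then xlet x b else 1)" for a
    by (cases b) (auto simp: assms power_int_minus)
  then show ?thesis by (simp add: xmonom_def)
qed

text \<open>The source of w is w' = w r_1, and w' x_1^{-1} r_1 = x^{- w r_1 e_1} w. Since r_1
  negates e_1, the exponent is w e_1.\<close>

lemma etaR_s0: "etaR (gel s0) x F w = xlet x (act w (Pos firstix)) * F (w * refl (Pos firstix) (Neg firstix))"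
proof -
  let ?r = "refl (Pos firstix) (Neg firstix) :: 'a weyl"
  have s0: "s0 = Aff (\<lambda>a. if a = firstix then -1 else 0) ?r"
  proof -
    have "signed (\<lambda>_. 0) b = 0" for b :: "'a bas" by (cases b) auto
    then show ?thesis
      by (auto simp: s0_def xaff_def waff_def times_aff_def refl_long_eq wact_def)
  qed
  have eq: "w' * ?r = w \<longleftrightarrow> w' = w * ?r" for w'
    by (metis mult.assoc mult.right_neutral refl_refl)
  have "(\<Sum>h | h \<in> Poly_Mapping.keys (gel s0) \<and> weyl_part (waff w' * h) = w.
      Poly_Mapping.lookup (gel s0) h * xmonom (lattice_part (waff w' * h)) x) =
      (if w' = w * ?r then xlet x (act w (Pos firstix)) else 0)" for w'
  proof -
    have "{h \<in> Poly_Mapping.keys (gel s0). weyl_part (waff w' * h) = w} =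
        (if w' * ?r = w then {s0} else {})"
      by (auto simp: gel_def waff_def times_aff_def s0)
    moreover have "xmonom (lattice_part (waff (w * ?r) * s0)) x = xlet x (act w (Pos firstix))"
    proof (rule xmonom_signed)
      fix a
      have 1: "signed (\<lambda>a. if a = firstix then -1 else 0) b =
         (if b = Neg firstix then 1 else if b = Pos firstix then -1 else 0)" for b :: "'a bas"
        by (cases b) auto
      have 2: "act (winv w) (Pos a) = Pos firstix \<longleftrightarrow> Pos a = act w (Pos firstix)"
        "act (winv w) (Pos a) = Neg firstix \<longleftrightarrow> Neg a = act w (Pos firstix)"
        by (simp_all add: act_winv_eq) (metis act_bar bar.simps)
      have 3: "act ?r b = Neg firstix \<longleftrightarrow> b = Pos firstix" "act ?r b = Pos firstix \<longleftrightarrow> b = Neg firstix" for b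
        by (metis act_refl_left act_refl_right act_eq_iff)+
      show "lattice_part (waff (w * ?r) * s0) a =
          (if Pos a = act w (Pos firstix) then 1 else if Neg a = act w (Pos firstix) then -1 else 0)"
        by (simp add: s0 times_aff_def waff_def wact_def inv_act winv_times 1 2 3)
    qed
    ultimately show ?thesis by (simp add: gel_def eq)
  qed
  then show ?thesis
    by (simp add: etaR_def lin_def if_distrib[of "\<lambda>x. _ * x"] mult.commute cong: if_cong)
qed

section \<open>The factors of C and their inverses\<close>

lemma Rbar_eq: "Rbar k x i z = Sop k z (srefl i)"
  by (simp add: Rbar_def Sop_def etaR_waff fun_eq_iff)

lemma Knbar_eq: "Knbar \<alpha> x z = Kop (\<lambda>_. 1) z (- \<alpha>) lastix"
  by (simp add: Knbar_def Kop_def etaR_waff fun_eq_iff srefl_last[symmetric])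

lemma K0bar_eq: "K0bar c \<beta> x z = Kop (xlet x) (z + c/2) \<beta> firstix"
  by (simp add: K0bar_def Kop_def etaR_s0 fun_eq_iff add.commute add.left_commute mult.assoc)

text \<open>Unitarity: since s is an involution, (k + z s)(k - z s) = k^2 - z^2, which is also the
  product of the two denominators.\<close>

lemma Sop_inverse:
  assumes "z \<noteq> k" "z \<noteq> - k" "s * s = 1"
  shows "inverse_ops (Sop k z s) (Sop k (- z) s)"
proof -
  have inv: "Sop k z s (Sop k (- z) s F) w = F w" if "z \<noteq> k" "z \<noteq> - k" for z F w
  proof -
    have *: "z + k \<noteq> 0" "k - z \<noteq> 0" using that by (auto simp: eq_neg_iff_add_eq_0)
    show ?thesis using * assms(3)
      by (simp add: Sop_def mult.assoc divide_simps) (simp add: algebra_simps)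
  qed
  moreover have "- z \<noteq> k" using assms(2) by (metis minus_minus)
  ultimately show ?thesis
    using assms inv[of z] inv[of "- z"] by (auto simp: inverse_ops_def fun_eq_iff)
qed

text \<open>The hypothesis on t makes the twisted sign change at position m an involution, so the
  unitarity computation applies with b in place of k.\<close>

lemma Kop_inverse:
  assumes "z \<noteq> b" "z \<noteq> - b" "\<And>l. t l * t (bar l) = 1"
  shows "inverse_ops (Kop t z b m) (Kop t (- z) b m)"
proof -
  have inv: "Kop t z b m (Kop t (- z) b m F) w = F w" if "z \<noteq> b" "z \<noteq> - b" for z F w
  proof -
    have *: "z + b \<noteq> 0" "b - z \<noteq> 0" using that by (auto simp: eq_neg_iff_add_eq_0)
    have "t (act w (Pos m)) * t (act w (Neg m)) = 1"
      using assms(3)[of "act w (Pos m)"] by (simp flip: act_bar)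
    then have "z * t (act w (Pos m)) * (- z * t (act w (Neg m)) * F w) = - z * z * F w"
      by (simp add: algebra_simps)
    then show ?thesis using *
      by (simp add: Kop_def mult.assoc divide_simps) (simp add: algebra_simps)
  qed
  moreover have "- z \<noteq> b" using assms(2) by (metis minus_minus)
  ultimately show ?thesis
    using assms inv[of z] inv[of "- z"] by (auto simp: inverse_ops_def fun_eq_iff)
qed

text \<open>K is homogeneous of degree 0 in (z, b). This converts the inverse of the factor with
  parameter - \<alpha> in C into the factor with + \<alpha> in Q.\<close>

lemma Kop_minus: "Kop t (- z) (- b) m = Kop t z b m"
proof -
  have "(- p - q) / (- z - b) = (p + q) / (z + b)" for p q
    using minus_divide_divide[of "p + q" "z + b"] by simp
  then show ?thesis by (simp add: Kop_def fun_eq_iff)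
qed

lemma xlet_bar: "x \<in> torus \<Longrightarrow> xlet x l * xlet x (bar l) = 1"
  by (cases l) (auto simp: torus_def)

definition good_y :: "complex set \<Rightarrow> 'n::finite cvec \<Rightarrow> bool" where
  "good_y Z y \<longleftrightarrow> (\<forall>z\<in>Z. \<forall>m. y $ m \<noteq> z \<and> (\<forall>i. i \<noteq> m \<longrightarrow> y $ m - y $ i \<noteq> z \<and> y $ m + y $ i \<noteq> z))"

text \<open>The excluded values come from the critical parameters: z = k or - k for R, with the
  shift c in one product, y_m = \<alpha> or - \<alpha> for K_n, and y_m - c/2 = \<beta> or - \<beta>
  for K_0. A single list for all differences, sums and single coordinates keeps the condition
  uniform.\<close>

lemma Cbar_inverse:
  fixes p :: "'n::{finite,linorder} pt"
  assumes x: "fst p \<in> torus"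
    and y: "good_y {k, -k, c + k, c - k, \<alpha>, - \<alpha>, c/2 + \<beta>, c/2 - \<beta>} (snd p)"
  shows "inverse_ops (Cbar c k \<alpha> \<beta> m p) (Qg c k \<alpha> \<beta> m p)"
proof -
  let ?y = "($) (snd p)" and ?x = "fst p"
  \<comment> \<open>The factorwise inverses of \<open>Cbar\<close> in reverse order, still along
    simple reflections. Its two halves are the left sides of \<open>telescope_up\<close> and
    \<open>telescope_down\<close>.\<close>
  define C where "C =
       comp_list (map (\<lambda>i. Sop k (?y m - ?y i - c) (srefl i)) (rev (ilist {..<m})))
     \<circ> Kop (xlet ?x) (?y m - c/2) \<beta> firstix
     \<circ> comp_list (map (\<lambda>i. Sop k (?y i + ?y m) (srefl i)) (ilist {..<m}))
     \<circ> comp_list (map (\<lambda>i. Sop k (?y m + ?y (nxt i)) (srefl i)) (ilist {m..<lastix}))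
     \<circ> Kop (\<lambda>_. 1) (?y m) \<alpha> lastix
     \<circ> comp_list (map (\<lambda>i. Sop k (?y m - ?y (nxt i)) (srefl i)) (rev (ilist {m..<lastix})))"
  have "Qg c k \<alpha> \<beta> m p = C"
    by (rule ext) (simp add: Qg_def C_def Let_def telescope_up[where d = "\<lambda>i. ?y i + ?y m"]
        telescope_down[where a = "\<lambda>i. ?y m + ?y i" and d = "\<lambda>i. ?y m - ?y i"])
  moreover have "inverse_ops (Cbar c k \<alpha> \<beta> m p) C"
  proof -
    have ne: "nxt i \<noteq> m" if "m \<le> i" "i < lastix" for i
      using nxt_greater[OF less_imp_nonlast[OF that(2)]] that by auto
    have y1: "?y m - ?y i \<noteq> z" "?y m + ?y i \<noteq> z" if "i \<noteq> m"
       "z \<in> {k, -k, c + k, c - k, \<alpha>, - \<alpha>, c/2 + \<beta>, c/2 - \<beta>}" for i z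
      using y that unfolding good_y_def by blast+
    have y2: "?y m \<noteq> z" if "z \<in> {k, -k, c + k, c - k, \<alpha>, - \<alpha>, c/2 + \<beta>, c/2 - \<beta>}" for z
      using y that unfolding good_y_def by blast
    have S: "inverse_ops (Sop k u (srefl i)) (Sop k v (srefl i))"
      if "v = - u" "v \<noteq> k" "v \<noteq> - k" for u v i
    proof -
      have "u \<noteq> k" "u \<noteq> - k" using that by auto
      then show ?thesis using Sop_inverse[of u k "srefl i"] that(1) by (simp add: srefl_srefl)
    qed
    have 1: "inverse_ops (comp_list (map (\<lambda>i. Sop k (?y (nxt i) - ?y m) (srefl i)) (ilist {m..<lastix})))
       (comp_list (map (\<lambda>i. Sop k (?y m - ?y (nxt i)) (srefl i)) (rev (ilist {m..<lastix}))))"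
      by (intro inverse_ops_comp_list S) (use y1 ne in auto)
    have 2: "inverse_ops (comp_list (map (\<lambda>i. Sop k (- ?y m - ?y (nxt i)) (srefl i)) (rev (ilist {m..<lastix}))))
       (comp_list (map (\<lambda>i. Sop k (?y m + ?y (nxt i)) (srefl i)) (rev (rev (ilist {m..<lastix})))))"
      by (intro inverse_ops_comp_list S) (use y1 ne in auto)
    have 3: "inverse_ops (comp_list (map (\<lambda>i. Sop k (- ?y i - ?y m) (srefl i)) (rev (ilist {..<m}))))
       (comp_list (map (\<lambda>i. Sop k (?y i + ?y m) (srefl i)) (rev (rev (ilist {..<m})))))"
      by (intro inverse_ops_comp_list S) (use y1 in \<open>auto simp: add.commute[of _ "?y m"]\<close>)
    have 4: "inverse_ops (comp_list (map (\<lambda>i. Sop k (?y i - ?y m + c) (srefl i)) (ilist {..<m})))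
       (comp_list (map (\<lambda>i. Sop k (?y m - ?y i - c) (srefl i)) (rev (ilist {..<m}))))"
    proof (intro inverse_ops_comp_list S)
      fix i assume "i \<in> set (ilist {..<m})"
      then have "i \<noteq> m" by auto
      then have "?y m - ?y i \<noteq> c + k" "?y m - ?y i \<noteq> c - k" using y1 by blast+
      then show "?y m - ?y i - c \<noteq> k" "?y m - ?y i - c \<noteq> - k"
        by (auto simp: algebra_simps)
    qed simp
    have 5: "inverse_ops (Kop (\<lambda>_. 1) (?y m) (- \<alpha>) (lastix :: 'n)) (Kop (\<lambda>_. 1) (?y m) \<alpha> lastix)"
      using Kop_inverse[of "?y m" "- \<alpha>" "\<lambda>_. 1" "lastix :: 'n"] y2[of \<alpha>] y2[of "- \<alpha>"]
        Kop_minus[of "\<lambda>_. 1" "?y m" \<alpha> "lastix :: 'n"] by simp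
    have 6: "inverse_ops (Kop (xlet ?x) (- ?y m + c/2) \<beta> firstix) (Kop (xlet ?x) (?y m - c/2) \<beta> firstix)"
    proof -
      have "?y m \<noteq> c/2 + \<beta>" "?y m \<noteq> c/2 - \<beta>" using y2 by blast+
      then have "- ?y m + c/2 \<noteq> - \<beta>" "- ?y m + c/2 \<noteq> \<beta>" by (auto simp: algebra_simps)
      then show ?thesis
        using Kop_inverse[of "- ?y m + c/2" \<beta> "xlet ?x" firstix, OF _ _ xlet_bar[OF x]] by simp
    qed
    from inverse_ops_comp[OF inverse_ops_comp[OF inverse_ops_comp[OF inverse_ops_comp[OF
        inverse_ops_comp[OF 1 5] 2] 3] 6] 4]
    show ?thesis
      by (simp add: C_def Cbar_def Let_def Rbar_eq Knbar_eq K0bar_eq o_assoc)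
  qed
  ultimately show ?thesis by simp
qed


section \<open>Generic points and meromorphic functions\<close>

lemma closure_Int_dense:
  assumes "open A" "open T" "S \<subseteq> closure A" "T \<subseteq> closure B"
  shows "S \<inter> T \<subseteq> closure (A \<inter> B)"
proof -
  have "A \<inter> T \<subseteq> A \<inter> closure B" using assms(4) by auto
  also have "\<dots> \<subseteq> closure (A \<inter> B)" by (rule open_Int_closure_subset[OF assms(1)])
  finally have "closure (A \<inter> T) \<subseteq> closure (A \<inter> B)" by (simp add: closure_minimal)
  moreover have "T \<inter> closure A \<subseteq> closure (T \<inter> A)" by (rule open_Int_closure_subset[OF assms(2)])
  ultimately show ?thesis using assms(3) by (auto simp: Int_commute)
qed

lemma generic_True: "open D \<Longrightarrow> generic D (\<lambda>_. True)"
  unfolding generic_def by (rule exI[of _ "D \<times> UNIV"]) (auto simp: open_Times closure_subset)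

lemma generic_mono: "generic D P \<Longrightarrow> (\<And>p. fst p \<in> D \<Longrightarrow> P p \<Longrightarrow> Q p) \<Longrightarrow> generic D Q"
  unfolding generic_def by (metis mem_Times_iff subset_iff)

lemma generic_conj:
  assumes "generic D P" "generic D Q"
  shows "generic D (\<lambda>p. P p \<and> Q p)"
proof -
  obtain S T where S: "open S" "S \<subseteq> D \<times> UNIV" "D \<times> UNIV \<subseteq> closure S" "\<forall>p\<in>S. P p"
    and T: "open T" "T \<subseteq> D \<times> UNIV" "D \<times> UNIV \<subseteq> closure T" "\<forall>p\<in>T. Q p"
    using assms unfolding generic_def by blast
  have "S \<subseteq> closure (S \<inter> T)"
    using closure_Int_dense[OF S(1) open_UNIV, of S T] S T
    by (metis Int_absorb2 open_Int_closure_subset subset_trans)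
  then have "closure S \<subseteq> closure (S \<inter> T)" by (simp add: closure_minimal)
  then show ?thesis unfolding generic_def using S T
    by (intro exI[of _ "S \<inter> T"]) auto
qed

lemma generic_ball:
  assumes "open D" "finite I" "\<And>i. i \<in> I \<Longrightarrow> generic D (P i)"
  shows "generic D (\<lambda>p. \<forall>i\<in>I. P i p)"
  using assms(2,3)
proof (induction I rule: finite_induct)
  case (insert i I)
  then show ?case using generic_conj[of D "P i" "\<lambda>p. \<forall>i\<in>I. P i p"] by simp
qed (simp add: generic_True assms(1))

lemma generic_all: "open D \<Longrightarrow> (\<And>i::'i::finite. generic D (P i)) \<Longrightarrow> generic D (\<lambda>p. \<forall>i. P i p)"
  using generic_ball[of D UNIV P] by simp

text \<open>Reduces the comparison of two generic identities to an equivalence at single points of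
  one dense open set.\<close>

lemma generic_cong:
  assumes "generic D P" "\<And>p. fst p \<in> D \<Longrightarrow> P p \<Longrightarrow> A p \<longleftrightarrow> B p"
  shows "generic D A \<longleftrightarrow> generic D B"
proof
  assume "generic D A"
  from generic_mono[OF generic_conj[OF assms(1) this]] show "generic D B" using assms(2) by blast
next
  assume "generic D B"
  from generic_mono[OF generic_conj[OF assms(1) this]] show "generic D A" using assms(2) by blast
qed

text \<open>Along the line through a zero in direction v the function is affine with nonzero slope,
  so an arbitrarily small step leaves the zero set.\<close>

lemma generic_nonzero:
  fixes f :: "'n::finite pt \<Rightarrow> complex"
  assumes D: "open D" and f: "continuous_on UNIV f"
    and d: "\<And>p. fst p \<in> D \<Longrightarrow> d p \<noteq> 0"
    and line: "\<And>p t. fst p \<in> D \<Longrightarrow> f (p + t *\<^sub>R v) = f p + of_real t * d p"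
  shows "generic D (\<lambda>p. f p \<noteq> 0)"
proof -
  let ?T = "D \<times> (UNIV :: 'n cvec set)"
  define S where "S = ?T \<inter> f -` (- {0})"
  have T: "open ?T" using D by (simp add: open_Times)
  have "open S" unfolding S_def
    by (rule continuous_open_preimage[OF _ T]) (use f continuous_on_subset in auto)
  moreover have "?T \<subseteq> closure S"
  proof
    fix p assume p: "p \<in> ?T"
    show "p \<in> closure S"
    proof (cases "f p = 0")
      case True
      have vd: "d p \<noteq> 0" "\<And>t. f (p + t *\<^sub>R v) = f p + of_real t * d p"
        using d[of p] line[of p] p by auto
      obtain e where e: "e > 0" "ball p e \<subseteq> ?T" using T p openE by blast
      show ?thesis unfolding closure_approachable
      proof (intro allI impI)
        fix e' :: real assume e': "e' > 0"
        define t where "t = min e e' / (norm v + 1)"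
        have pos: "0 < norm v + 1" by (simp add: add_nonneg_pos)
        then have t: "t > 0" using e e' by (simp add: t_def)
        have "norm (t *\<^sub>R v) = t * norm v" using t by simp
        also have "\<dots> < t * (norm v + 1)" using t by simp
        also have "\<dots> = min e e'" using pos by (simp add: t_def)
        finally have n: "norm (t *\<^sub>R v) < min e e'" .
        then have "p + t *\<^sub>R v \<in> ball p e" by (simp add: dist_norm)
        then have "p + t *\<^sub>R v \<in> S"
          using e(2) vd(1) vd(2)[of t] True t by (auto simp: S_def simp del: mem_ball)
        moreover have "dist (p + t *\<^sub>R v) p < e'" using n by (simp add: dist_norm)
        ultimately show "\<exists>q\<in>S. dist q p < e'" by blast
      qed
    next
      case False
      then have "p \<in> S" using p by (simp add: S_def)
      then show ?thesis using closure_subset by blast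
    qed
  qed
  ultimately show ?thesis unfolding generic_def by (intro exI[of _ S]) (auto simp: S_def)
qed

lemma generic_good_y:
  fixes D :: "('n::finite cvec) set"
  assumes D: "open D" and Z: "finite Z"
  shows "generic D (\<lambda>p. good_y Z (snd p))"
proof -
  have 1: "generic D (\<lambda>p. snd p $ m - z \<noteq> 0)" for m z
    by (rule generic_nonzero[OF D, where v = "(0, axis m 1)" and d = "\<lambda>_. 1"])
       (auto intro!: continuous_intros simp: scaleR_conv_of_real[where 'a = complex])
  have 2: "generic D (\<lambda>p. snd p $ m - snd p $ i - z \<noteq> 0)" if "i \<noteq> m" for m i z
    by (rule generic_nonzero[OF D, where v = "(0, axis m 1)" and d = "\<lambda>_. 1"])
       (use that in \<open>auto intro!: continuous_intros simp: axis_def scaleR_conv_of_real[where 'a = complex]\<close>)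
  have 3: "generic D (\<lambda>p. snd p $ m + snd p $ i - z \<noteq> 0)" if "i \<noteq> m" for m i z
    by (rule generic_nonzero[OF D, where v = "(0, axis m 1)" and d = "\<lambda>_. 1"])
       (use that in \<open>auto intro!: continuous_intros simp: axis_def scaleR_conv_of_real[where 'a = complex]\<close>)
  have 4: "generic D (\<lambda>p. i \<noteq> m \<longrightarrow> snd p $ m - snd p $ i \<noteq> z \<and> snd p $ m + snd p $ i \<noteq> z)" for m i z
  proof (cases "i = m")
    case False
    from generic_conj[OF 2[OF False, of z] 3[OF False, of z]] show ?thesis
      by (rule generic_mono) simp
  qed (use generic_True[OF D] in simp)
  have "generic D (\<lambda>p. \<forall>z\<in>Z. \<forall>m. snd p $ m - z \<noteq> 0 \<and>
      (\<forall>i. i \<noteq> m \<longrightarrow> snd p $ m - snd p $ i \<noteq> z \<and> snd p $ m + snd p $ i \<noteq> z))"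
    by (intro generic_ball generic_all generic_conj D Z 1 4)
  then show ?thesis by (rule generic_mono) (simp add: good_y_def)
qed

lemma generic_regular:
  fixes D :: "('n::{finite,linorder} cvec) set"
  assumes D: "open D" "D \<subseteq> torus"
  shows "generic D (\<lambda>p. regular_pt (fst p))"
proof -
  have 1: "generic D (\<lambda>p. 1 + fst p $ m \<noteq> 0)" for m
    by (rule generic_nonzero[OF D(1), where v = "(axis m 1, 0)" and d = "\<lambda>_. 1"])
       (auto intro!: continuous_intros simp: scaleR_conv_of_real[where 'a = complex])
  have 2: "generic D (\<lambda>p. 1 - fst p $ m \<noteq> 0)" for m
    by (rule generic_nonzero[OF D(1), where v = "(axis m 1, 0)" and d = "\<lambda>_. -1"])
       (auto intro!: continuous_intros simp: scaleR_conv_of_real[where 'a = complex])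
  have 3: "generic D (\<lambda>p. fst p $ m - fst p $ i \<noteq> 0)" if "m < i" for m i
    by (rule generic_nonzero[OF D(1), where v = "(axis m 1, 0)" and d = "\<lambda>_. 1"])
       (use that in \<open>auto intro!: continuous_intros simp: axis_def scaleR_conv_of_real[where 'a = complex]\<close>)
  \<comment> \<open>In the coordinate x_m the slope is - x_i, nonzero because D lies in the
    torus.\<close>
  have 4: "generic D (\<lambda>p. 1 - fst p $ m * fst p $ i \<noteq> 0)" if "m < i" for m i
    by (rule generic_nonzero[OF D(1), where v = "(axis m 1, 0)" and d = "\<lambda>p. - fst p $ i"])
       (use that D(2) in \<open>auto intro!: continuous_intros
         simp: axis_def torus_def scaleR_conv_of_real[where 'a = complex] algebra_simps\<close>)
  have 5: "generic D (\<lambda>p. m < i \<longrightarrow> (1 - fst p $ m * fst p $ i) * (fst p $ m - fst p $ i) \<noteq> 0)" for m i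
  proof (cases "m < i")
    case True
    from generic_conj[OF 3[OF True] 4[OF True]] show ?thesis by (rule generic_mono) simp
  qed (use generic_True[OF D(1)] in simp)
  have "generic D (\<lambda>p. (\<forall>m. 1 + fst p $ m \<noteq> 0 \<and> 1 - fst p $ m \<noteq> 0) \<and>
      (\<forall>m i. m < i \<longrightarrow> (1 - fst p $ m * fst p $ i) * (fst p $ m - fst p $ i) \<noteq> 0))"
    by (intro generic_all generic_conj D(1) 1 2 5)
  then show ?thesis
    by (rule generic_mono) (use D(2) in \<open>auto simp: regular_pt_def torus_def\<close>)
qed

lemma U_det_nonzero:
  fixes x :: "'n::{finite,linorder} cvec"
  assumes "U_det c k \<alpha> \<beta> D U" "x \<in> D" "regular_pt x"
  shows "U x \<noteq> 0"
proof -
  note * = assms(1)[unfolded U_det_def, THEN conjunct2, THEN bspec, OF assms(2), THEN mp, OF assms(3)]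
  then show ?thesis
  proof (elim exE conjE)
    fix S and l0 l1 l2 :: "'n \<Rightarrow> 'n cvec \<Rightarrow> complex" and l3 :: "'n \<Rightarrow> 'n \<Rightarrow> 'n cvec \<Rightarrow> complex"
    assume "x \<in> S" "\<forall>z\<in>S. U z =
         (\<Prod>p\<in>UNIV. exp ((k * (of_nat CARD('n) - 1) + \<alpha>) / c * l0 p z)
                  * exp ((\<beta> - \<alpha>) / c * l1 p z)
                  * exp (- (\<beta> + \<alpha>) / c * l2 p z))
         * (\<Prod>(p, l) | p < l. exp (- k / c * l3 p l z))"
    then have "U x = (\<Prod>p\<in>UNIV. exp ((k * (of_nat CARD('n) - 1) + \<alpha>) / c * l0 p x)
                  * exp ((\<beta> - \<alpha>) / c * l1 p x)
                  * exp (- (\<beta> + \<alpha>) / c * l2 p x))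
         * (\<Prod>(p, l) | p < l. exp (- k / c * l3 p l x))" by (rule bspec[rotated])
    then show ?thesis by (simp add: prod_zero_iff case_prod_unfold)
  qed
qed

section \<open>Products, inverses and generic holomorphy of meromorphic functions\<close>

lemma holomorphic_pt_continuous: "holomorphic_pt f S \<Longrightarrow> continuous_on S f"
  unfolding holomorphic_pt_def
  by (metis continuous_at_imp_continuous_on has_derivative_continuous)

lemma holomorphic_pt_mult:
  "holomorphic_pt f S \<Longrightarrow> holomorphic_pt g S \<Longrightarrow> holomorphic_pt (\<lambda>p. f p * g p) S"
  unfolding holomorphic_pt_def
proof
  fix p
  assume f: "\<forall>p\<in>S. \<exists>f'. (f has_derivative f') (at p) \<and> (\<forall>t u v. f' (t *s u, t *s v) = t * f' (u, v))"
    and g: "\<forall>p\<in>S. \<exists>f'. (g has_derivative f') (at p) \<and> (\<forall>t u v. f' (t *s u, t *s v) = t * f' (u, v))"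
    and p: "p \<in> S"
  obtain f' g' where "(f has_derivative f') (at p)" "(g has_derivative g') (at p)"
    and "\<And>t u v. f' (t *s u, t *s v) = t * f' (u, v)" "\<And>t u v. g' (t *s u, t *s v) = t * g' (u, v)"
    using f g p by metis
  then show "\<exists>f'. ((\<lambda>p. f p * g p) has_derivative f') (at p) \<and> (\<forall>t u v. f' (t *s u, t *s v) = t * f' (u, v))"
    by (intro exI[of _ "\<lambda>h. f p * g' h + f' h * g p"])
       (auto intro!: derivative_eq_intros simp: algebra_simps)
qed

lemma holomorphic_pt_const: "holomorphic_pt (\<lambda>_. z) S"
  unfolding holomorphic_pt_def by (intro ballI exI[of _ "\<lambda>_. 0"]) auto

lemma holomorphic_pt_subset: "holomorphic_pt f S \<Longrightarrow> T \<subseteq> S \<Longrightarrow> holomorphic_pt f T"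
  unfolding holomorphic_pt_def by blast

lemma open_nonzero: "open S \<Longrightarrow> holomorphic_pt h S \<Longrightarrow> open {q \<in> S. h q \<noteq> 0}"
  using continuous_open_preimage[OF holomorphic_pt_continuous[of h S], of "- {0}"]
  by (simp add: vimage_def Int_def open_Compl)

lemma meroE:
  assumes "mero D f" "p \<in> D \<times> UNIV"
  obtains S n d where "open S" "p \<in> S" "S \<subseteq> D \<times> UNIV" "holomorphic_pt n S" "holomorphic_pt d S"
    "S \<subseteq> closure {q \<in> S. d q \<noteq> 0}" "\<forall>q\<in>S. d q \<noteq> 0 \<longrightarrow> f q = n q / d q"
  using assms(1)[unfolded mero_def, THEN bspec, OF assms(2)] by (elim exE conjE) (rule that)

lemma mero_mult:
  assumes "mero D f" "mero D g"
  shows "mero D (\<lambda>p. f p * g p)"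
  unfolding mero_def
proof
  fix p assume p: "p \<in> D \<times> (UNIV :: 'a cvec set)"
  obtain S n d where S: "open S" "p \<in> S" "S \<subseteq> D \<times> UNIV" "holomorphic_pt n S" "holomorphic_pt d S"
    "S \<subseteq> closure {q \<in> S. d q \<noteq> 0}" "\<forall>q\<in>S. d q \<noteq> 0 \<longrightarrow> f q = n q / d q"
    using assms(1) p by (rule meroE)
  obtain T n' d' where T: "open T" "p \<in> T" "T \<subseteq> D \<times> UNIV" "holomorphic_pt n' T" "holomorphic_pt d' T"
    "T \<subseteq> closure {q \<in> T. d' q \<noteq> 0}" "\<forall>q\<in>T. d' q \<noteq> 0 \<longrightarrow> g q = n' q / d' q"
    using assms(2) p by (rule meroE)
  have "S \<inter> T \<subseteq> closure ({q \<in> S. d q \<noteq> 0} \<inter> {q \<in> T. d' q \<noteq> 0})"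
    using closure_Int_dense[OF open_nonzero[OF S(1,5)] T(1) S(6) T(6)] .
  also have "{q \<in> S. d q \<noteq> 0} \<inter> {q \<in> T. d' q \<noteq> 0} = {q \<in> S \<inter> T. d q * d' q \<noteq> 0}" by auto
  finally have dense: "S \<inter> T \<subseteq> closure {q \<in> S \<inter> T. d q * d' q \<noteq> 0}" .
  have hol: "holomorphic_pt (\<lambda>q. n q * n' q) (S \<inter> T)" "holomorphic_pt (\<lambda>q. d q * d' q) (S \<inter> T)"
    using S(4,5) T(4,5)
    by (auto intro!: holomorphic_pt_mult intro: holomorphic_pt_subset[OF _ Int_lower1] holomorphic_pt_subset[OF _ Int_lower2])
  show "\<exists>S n d. open S \<and> p \<in> S \<and> S \<subseteq> D \<times> UNIV \<and> holomorphic_pt n S \<and> holomorphic_pt d S \<and>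
     S \<subseteq> closure {q \<in> S. d q \<noteq> 0} \<and> (\<forall>q\<in>S. d q \<noteq> 0 \<longrightarrow> f q * g q = n q / d q)"
    using S(1-3,7) T(1,2,7) hol dense
    by (intro exI[of _ "S \<inter> T"] exI[of _ "\<lambda>q. n q * n' q"] exI[of _ "\<lambda>q. d q * d' q"] conjI) auto
qed

lemma mero_zero: "open D \<Longrightarrow> mero D (\<lambda>_. 0)"
  unfolding mero_def
  by (intro ballI exI[of _ "D \<times> UNIV"] exI[of _ "\<lambda>_. 0"] exI[of _ "\<lambda>_. 1"] conjI)
     (simp_all add: open_Times holomorphic_pt_const closure_subset)

text \<open>The local quotient is written d d / (n d) rather than d / n: a nonzero denominator must
  also force d to be nonzero, since only there is f = n / d known. Generic nonvanishing of f makes n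
  d nonzero on a dense set.\<close>

lemma mero_inverse:
  assumes D: "open D" and f: "mero D f" and nz: "generic D (\<lambda>p. f p \<noteq> 0)"
  shows "mero D (\<lambda>p. inverse (f p))"
  unfolding mero_def
proof
  fix p assume p: "p \<in> D \<times> (UNIV :: 'a cvec set)"
  obtain S n d where S: "open S" "p \<in> S" "S \<subseteq> D \<times> UNIV" "holomorphic_pt n S" "holomorphic_pt d S"
    "S \<subseteq> closure {q \<in> S. d q \<noteq> 0}" "\<forall>q\<in>S. d q \<noteq> 0 \<longrightarrow> f q = n q / d q"
    using f p by (rule meroE)
  obtain T where T: "open T" "T \<subseteq> D \<times> UNIV" "D \<times> UNIV \<subseteq> closure T" "\<forall>p\<in>T. f p \<noteq> 0"
    using nz unfolding generic_def by blast
  have "S \<inter> (D \<times> UNIV) \<subseteq> closure ({q \<in> S. d q \<noteq> 0} \<inter> T)"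
    by (rule closure_Int_dense[OF open_nonzero[OF S(1,5)] _ S(6) T(3)]) (use D in \<open>simp add: open_Times\<close>)
  also have "\<dots> \<subseteq> closure {q \<in> S. n q * d q \<noteq> 0}"
    by (rule closure_mono) (use S T in auto)
  finally have "S \<subseteq> closure {q \<in> S. n q * d q \<noteq> 0}" using S(3) by (simp add: Int_absorb2)
  then show "\<exists>S n d. open S \<and> p \<in> S \<and> S \<subseteq> D \<times> UNIV \<and> holomorphic_pt n S \<and> holomorphic_pt d S \<and>
     S \<subseteq> closure {q \<in> S. d q \<noteq> 0} \<and> (\<forall>q\<in>S. d q \<noteq> 0 \<longrightarrow> inverse (f q) = n q / d q)"
    using S(1-5,7)
    by (intro exI[of _ S] exI[of _ "\<lambda>q. d q * d q"] exI[of _ "\<lambda>q. n q * d q"] conjI holomorphic_pt_mult) auto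
qed

text \<open>A representing function may take any values where its local denominators vanish. Off
  these zeros it agrees on an open set with a quotient of holomorphic functions, which gives the
  differentiability required by the product rule.\<close>

lemma mero_generic_holomorphic:
  assumes "open D" "mero D f"
  shows "generic D (\<lambda>p. holomorphic_pt f {p})"
proof -
  define T where "T = \<Union>{S. open S \<and> S \<subseteq> D \<times> UNIV \<and> holomorphic_pt f S}"
  have "D \<times> UNIV \<subseteq> closure T"
  proof
    fix p assume p: "p \<in> D \<times> (UNIV :: 'a cvec set)"
    obtain S n d where S: "open S" "p \<in> S" "S \<subseteq> D \<times> UNIV" "holomorphic_pt n S" "holomorphic_pt d S"
      "S \<subseteq> closure {q \<in> S. d q \<noteq> 0}" "\<forall>q\<in>S. d q \<noteq> 0 \<longrightarrow> f q = n q / d q"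
      using assms(2) p by (rule meroE)
    let ?A = "{q \<in> S. d q \<noteq> 0}"
    have A: "open ?A" by (rule open_nonzero[OF S(1,5)])
    have "holomorphic_pt f ?A"
      unfolding holomorphic_pt_def
    proof
      fix q assume q: "q \<in> ?A"
      obtain n' d' where n': "(n has_derivative n') (at q)" "\<And>t u v. n' (t *s u, t *s v) = t * n' (u, v)"
        and d': "(d has_derivative d') (at q)" "\<And>t u v. d' (t *s u, t *s v) = t * d' (u, v)"
        using S(4,5) q unfolding holomorphic_pt_def by blast
      have "((\<lambda>q. n q / d q) has_derivative
          (\<lambda>h. - n q * (inverse (d q) * d' h * inverse (d q)) + n' h / d q)) (at q)"
        using has_derivative_divide[OF n'(1) d'(1)] q by simp
      then have "(f has_derivative (\<lambda>h. - n q * (inverse (d q) * d' h * inverse (d q)) + n' h / d q)) (at q)"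
        by (rule has_derivative_transform_within_open[OF _ A q]) (use S(7) in auto)
      then show "\<exists>f'. (f has_derivative f') (at q) \<and> (\<forall>t u v. f' (t *s u, t *s v) = t * f' (u, v))"
        using n'(2) d'(2) by (intro exI conjI) (auto simp: algebra_simps)
    qed
    then have "?A \<subseteq> T" using A S(3) unfolding T_def by blast
    then show "p \<in> closure T" using S(2,6) closure_mono by blast
  qed
  then show ?thesis
    unfolding generic_def
    by (intro exI[of _ T]) (auto simp: T_def elim!: holomorphic_pt_subset)
qed

section \<open>Partial derivatives along coordinate lines\<close>

lemma upd_eq: "upd x a t = x + axis a (t - x $ a)"
  by (simp add: upd_def vec_eq_iff axis_def)

lemma upd_self [simp]: "upd x a (x $ a) = x"
  by (simp add: upd_def vec_eq_iff)

lemma has_derivative_upd: "((\<lambda>t. upd x a t) has_derivative (\<lambda>h. axis a h)) (at s)"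
proof -
  have "bounded_linear (\<lambda>h :: complex. axis a h)"
    unfolding linear_conv_bounded_linear[symmetric]
    by (rule linearI) (auto simp: vec_eq_iff axis_def)
  moreover have "((\<lambda>t. t - x $ a) has_derivative (\<lambda>h. h)) (at s)"
    by (auto intro!: derivative_eq_intros)
  ultimately have "((\<lambda>t. axis a (t - x $ a)) has_derivative (\<lambda>h. axis a h)) (at s)"
    by (rule bounded_linear.has_derivative)
  then show ?thesis unfolding upd_eq
    by (auto intro!: derivative_eq_intros)
qed

text \<open>\<open>has_derivative\<close> alone is real-linear. The homogeneity clause makes the
  derivative along a coordinate line multiplication by the complex number f'(axis a 1, 0).\<close>

lemma holomorphic_pt_partial:
  assumes "holomorphic_pt f {(x, y)}"
  shows "(\<lambda>t. f (upd x a t, y)) field_differentiable (at (x $ a))"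
proof -
  obtain f' where f': "(f has_derivative f') (at (x, y))" "\<And>t u v. f' (t *s u, t *s v) = t * f' (u, v)"
    using assms unfolding holomorphic_pt_def by blast
  have "((\<lambda>t. (upd x a t, y)) has_derivative (\<lambda>h. (axis a h, 0))) (at (x $ a))"
    by (intro has_derivative_Pair has_derivative_upd has_derivative_const)
  then have "((\<lambda>t. f (upd x a t, y)) has_derivative (\<lambda>h. f' (axis a h, 0))) (at (x $ a))"
    using has_derivative_compose[of "\<lambda>t. (upd x a t, y)" _ "x $ a" UNIV f f'] f'(1) by simp
  moreover have "(\<lambda>h. f' (axis a h, 0)) = (*) (f' (axis a 1, 0))"
  proof
    fix h
    have "axis a h = h *s axis a 1" "(0 :: 'a cvec) = h *s 0" by (auto simp: vec_eq_iff axis_def)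
    then show "f' (axis a h, 0) = f' (axis a 1, 0) * h" using f'(2)[of h "axis a 1" 0] by simp
  qed
  ultimately show ?thesis
    unfolding field_differentiable_def has_field_derivative_def by auto
qed

lemma pd_mult:
  assumes "(\<lambda>t. u (upd x a t)) field_differentiable (at (x $ a))"
    and "(\<lambda>t. v (upd x a t)) field_differentiable (at (x $ a))"
  shows "pd a (\<lambda>x. u x * v x) x = pd a u x * v x + u x * pd a v x"
  unfolding pd_def using assms by (subst deriv_mult) auto

section \<open>Compatibility with the gauge factor and pointwise equivalence of the
  equations\<close>

definition scale :: "complex \<Rightarrow> ('b \<Rightarrow> complex) \<Rightarrow> 'b \<Rightarrow> complex" where
  "scale z F = (\<lambda>b. z * F b)"

lemma scale_eq_iff: "z \<noteq> 0 \<Longrightarrow> scale z F = scale z G \<longleftrightarrow> F = G"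
  by (simp add: scale_def fun_eq_iff)

lemma Rop_scale: "scale u (Rop k z g F) = Rop k z g (scale u F)"
  and Kop_scale: "scale u (Kop t z b m F) = Kop t z b m (scale u F)"
  by (simp_all add: scale_def Rop_def Kop_def fun_eq_iff algebra_simps add_divide_distrib)

lemma Qg_scale: "scale u (Qg c k \<alpha> \<beta> m p F) = Qg c k \<alpha> \<beta> m p (scale u F)"
proof -
  have *: "scale u (comp_list (map (\<lambda>i. Rop k (z i) (g i)) L) F) = comp_list (map (\<lambda>i. Rop k (z i) (g i)) L) (scale u F)"
    for z :: "'a \<Rightarrow> complex" and g L F
    by (rule comp_list_conj[where \<tau> = "scale u"]) (rule Rop_scale)
  show ?thesis by (simp add: Qg_def Let_def Kop_scale *)
qed

lemma etaL_scale: "etaL k \<alpha> h y (scale u F) w = u * etaL k \<alpha> h y F w"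
  by (simp add: etaL_def lin_def scale_def sum_distrib_left mult.assoc)

lemma Lop_scale: "Lop k \<alpha> \<beta> a p (scale u F) w = u * Lop k \<alpha> \<beta> a p F w"
  by (simp add: Lop_def Let_def etaL_scale distrib_left sum_distrib_left mult.left_commute)

lemma phi_eq_iff: "phi F = phi G \<longleftrightarrow> F = G"
  by (metis ext phi_frame)

lemma gauge_transform_scale: "gauge_transform U G p = scale (U (fst p)) (G p)"
  by (simp add: gauge_transform_def scale_def fun_eq_iff)

text \<open>The factor U depends on x alone, so the shift in y passes through it and it cancels from
  both sides. Inverting \<open>Cbar\<close> then solves the first equation for the shifted
  function.\<close>

lemma shift_equiv:
  assumes "fst p \<in> torus" "U (fst p) \<noteq> 0"
    and "good_y {k, -k, c + k, c - k, \<alpha>, - \<alpha>, c/2 + \<beta>, c/2 - \<beta>} (snd p)"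
  shows "Cbar c k \<alpha> \<beta> m p (shift c m G p) = G p \<longleftrightarrow>
    shift c m (\<lambda>p. phi (gauge_transform U G p)) p = Qop c k \<alpha> \<beta> m p (phi (gauge_transform U G p))"
proof -
  have inv: "inverse_ops (Cbar c k \<alpha> \<beta> m p) (Qg c k \<alpha> \<beta> m p)"
    by (rule Cbar_inverse[OF assms(1,3)])
  have "shift c m (\<lambda>p. phi (gauge_transform U G p)) p = phi (scale (U (fst p)) (shift c m G p))"
    by (simp add: shift_def gauge_transform_scale)
  moreover have "Qop c k \<alpha> \<beta> m p (phi (gauge_transform U G p)) = phi (scale (U (fst p)) (Qg c k \<alpha> \<beta> m p (G p)))"
    by (simp add: Qop_phi gauge_transform_scale Qg_scale)
  moreover have "Cbar c k \<alpha> \<beta> m p (shift c m G p) = G p \<longleftrightarrow> shift c m G p = Qg c k \<alpha> \<beta> m p (G p)"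
    using inv unfolding inverse_ops_def by metis
  ultimately show ?thesis by (simp only: phi_eq_iff scale_eq_iff[OF assms(2)])
qed

text \<open>At a frame, D_a applied to the transformed function is U times the left side of the
  first equation: the product rule creates the derivative of U, which is U times the logarithmic
  term.\<close>

lemma pde_equiv:
  assumes U: "U x \<noteq> 0" "(\<lambda>t. U (upd x a t)) field_differentiable (at (x $ a))"
    and G: "\<And>w. (\<lambda>t. G (upd x a t, y) w) field_differentiable (at (x $ a))"
  shows "(\<forall>w. c * x $ a * pd a (\<lambda>x'. G (x', y) w) x + Lop k \<alpha> \<beta> a (x, y) (G (x, y)) w
        + c * x $ a * (pd a U x / U x) * G (x, y) w = 0) \<longleftrightarrow>
    Dop c k \<alpha> \<beta> a (\<lambda>p. phi (gauge_transform U G p)) (x, y) = (\<lambda>_. 0)"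
proof -
  let ?f = "\<lambda>p. phi (gauge_transform U G p)"
  have AB: "Aop k \<alpha> a y (?f (x, y)) \<iota> + Bop k \<alpha> \<beta> a x (?f (x, y)) \<iota> =
      phi (Lop k \<alpha> \<beta> a (x, y) (scale (U x) (G (x, y)))) \<iota>" for \<iota>
    using fun_cong[OF AB_phi[of k \<alpha> a "(x, y)" _ \<beta>]] by (simp add: gauge_transform_scale)
  have frame: "Dop c k \<alpha> \<beta> a ?f (x, y) (frame w) = U x * (c * x $ a * pd a (\<lambda>x'. G (x', y) w) x
      + Lop k \<alpha> \<beta> a (x, y) (G (x, y)) w + c * x $ a * (pd a U x / U x) * G (x, y) w)" for w
  proof -
    have "Dop c k \<alpha> \<beta> a ?f (x, y) (frame w) = c * x $ a * pd a (\<lambda>x'. U x' * G (x', y) w) x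
      + U x * Lop k \<alpha> \<beta> a (x, y) (G (x, y)) w"
      using AB[of "frame w"] by (simp add: Dop_def Lop_scale gauge_transform_def add.assoc)
    also have "pd a (\<lambda>x'. U x' * G (x', y) w) x = pd a U x * G (x, y) w + U x * pd a (\<lambda>x'. G (x', y) w) x"
      by (rule pd_mult[OF U(2) G])
    finally have "Dop c k \<alpha> \<beta> a ?f (x, y) (frame w) = c * x $ a * (pd a U x * G (x, y) w
       + U x * pd a (\<lambda>x'. G (x', y) w) x) + U x * Lop k \<alpha> \<beta> a (x, y) (G (x, y)) w" .
    then show ?thesis using U(1) by (simp only:) (simp add: field_simps)
  qed
  \<comment> \<open>Off the frames the coordinate of \<open>phi\<close> is zero for every x, so its
    derivative vanishes together with the A and B terms.\<close>
  have outside: "Dop c k \<alpha> \<beta> a ?f (x, y) \<iota> = 0" if "\<iota> \<notin> range frame" for \<iota>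
    using AB[of \<iota>] that by (simp add: Dop_def phi_outside pd_def add.assoc)
  show ?thesis (is "?L \<longleftrightarrow> ?R")
  proof
    assume L: ?L
    show ?R
    proof
      fix \<iota>
      show "Dop c k \<alpha> \<beta> a ?f (x, y) \<iota> = 0"
        by (cases "\<iota> \<in> range frame") (use L outside in \<open>auto simp: frame\<close>)
    qed
  next
    assume R: ?R
    show ?L
    proof
      fix w
      show "c * x $ a * pd a (\<lambda>x'. G (x', y) w) x + Lop k \<alpha> \<beta> a (x, y) (G (x, y)) w
        + c * x $ a * (pd a U x / U x) * G (x, y) w = 0"
        using fun_cong[OF R, of "frame w"] U(1) by (simp only: frame mult_eq_0_iff) simp
    qed
  qed
qed

text \<open>To make the equivalence cover all of (V^n)_0, the middle conjunct states that the gauge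
  map is onto and injective up to generic equality; the last one makes restricting the second system
  to (V^n)_0 meaningful.\<close>

theorem proposition4p9:
  fixes c k \<alpha> \<beta> :: complex
    and D :: "('n::{finite,linorder} cvec) set"
    and U :: "'n cvec \<Rightarrow> complex"
  assumes "c \<noteq> 0" "k \<noteq> 0" "\<alpha> \<noteq> 0" "\<beta> \<noteq> 0"
    and "open D" "D \<subseteq> torus"
    and "U_det c k \<alpha> \<beta> D U"
  shows
    "(\<forall>Gbar. mero_vec D Gbar \<longrightarrow>
        mero_vec D (gauge_transform U Gbar) \<and>
        mero_V0 D (\<lambda>p. phi (gauge_transform U Gbar p)) \<and>
        (first_system c k \<alpha> \<beta> D U Gbar \<longleftrightarrow>
         second_system c k \<alpha> \<beta> D (\<lambda>p. phi (gauge_transform U Gbar p)))) \<and>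
     (\<forall>f. mero_V0 D f \<longrightarrow>
        (\<exists>Gbar. mero_vec D Gbar \<and> generic D (\<lambda>p. phi (gauge_transform U Gbar p) = f p) \<and>
           (\<forall>G'. mero_vec D G' \<and> generic D (\<lambda>p. phi (gauge_transform U G' p) = f p)
              \<longrightarrow> generic D (\<lambda>p. G' p = Gbar p)))) \<and>
     (\<forall>m a (p :: 'n pt). \<forall>u\<in>V0. Qop c k \<alpha> \<beta> m p u \<in> V0 \<and>
        (\<lambda>\<iota>. Aop k \<alpha> a (snd p) u \<iota> + Bop k \<alpha> \<beta> a (fst p) u \<iota>) \<in> V0)"
proof -
  note D = \<open>open D\<close> and U = \<open>U_det c k \<alpha> \<beta> D U\<close>
  have U_mero: "mero D (\<lambda>p. U (fst p))" using U by (simp add: U_det_def)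
  have U_nz: "generic D (\<lambda>p. U (fst p) \<noteq> 0)"
    using generic_regular[OF D \<open>D \<subseteq> torus\<close>] by (rule generic_mono) (rule U_det_nonzero[OF U])
  have gauge: "mero_vec D (gauge_transform U G)" if "mero_vec D G" for G :: "'n pt \<Rightarrow> 'n weyl \<Rightarrow> complex"
    using that mero_mult[OF U_mero] unfolding mero_vec_def gauge_transform_def by blast
  have phi_gauge: "mero_V0 D (\<lambda>p. phi (gauge_transform U G p))" if "mero_vec D G" for G
  proof -
    have "mero D (\<lambda>p. phi (gauge_transform U G p) \<iota>)" for \<iota>
    proof (cases "\<iota> \<in> range frame")
      case True
      then show ?thesis using gauge[OF that] by (auto simp: mero_vec_def)
    qed (simp add: phi_outside mero_zero[OF D])
    then show ?thesis
      unfolding mero_V0_def mero_vec_def V0_eq using generic_True[OF D] by simp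
  qed
  have equiv: "first_system c k \<alpha> \<beta> D U G \<longleftrightarrow> second_system c k \<alpha> \<beta> D (\<lambda>p. phi (gauge_transform U G p))"
    if G: "mero_vec D G" for G
  proof -
    let ?Z = "{k, -k, c + k, c - k, \<alpha>, - \<alpha>, c/2 + \<beta>, c/2 - \<beta>}"
    have good: "generic D (\<lambda>p. good_y ?Z (snd p))" by (rule generic_good_y[OF D]) simp
    have shift: "generic D (\<lambda>p. Cbar c k \<alpha> \<beta> m p (shift c m G p) = G p) \<longleftrightarrow>
      generic D (\<lambda>p. shift c m (\<lambda>p. phi (gauge_transform U G p)) p
        = Qop c k \<alpha> \<beta> m p (phi (gauge_transform U G p)))" for m
      by (rule generic_cong[OF generic_conj[OF U_nz good]], rule shift_equiv) (use \<open>D \<subseteq> torus\<close> in auto)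
    \<comment> \<open>One dense open set serves all components because W_0 is finite.\<close>
    have hol: "generic D (\<lambda>p. \<forall>w. holomorphic_pt (\<lambda>p. G p w) {p})"
      using G unfolding mero_vec_def by (intro generic_all[OF D] mero_generic_holomorphic[OF D]) blast
    have pde: "generic D (\<lambda>(x, y). \<forall>w. c * x $ a * pd a (\<lambda>x'. G (x', y) w) x
        + Lop k \<alpha> \<beta> a (x, y) (G (x, y)) w + c * x $ a * (pd a U x / U x) * G (x, y) w = 0) \<longleftrightarrow>
      generic D (\<lambda>p. Dop c k \<alpha> \<beta> a (\<lambda>p. phi (gauge_transform U G p)) p = (\<lambda>_. 0))" for a
    proof (rule generic_cong[OF generic_conj[OF U_nz generic_conj[OF hol mero_generic_holomorphic[OF D U_mero]]]])
      fix p :: "'n pt"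
      assume p: "U (fst p) \<noteq> 0 \<and> (\<forall>w. holomorphic_pt (\<lambda>p. G p w) {p}) \<and> holomorphic_pt (\<lambda>p. U (fst p)) {p}"
      obtain x y where xy: "p = (x, y)" by (cases p)
      show "(case p of (x, y) \<Rightarrow> \<forall>w. c * x $ a * pd a (\<lambda>x'. G (x', y) w) x
        + Lop k \<alpha> \<beta> a (x, y) (G (x, y)) w + c * x $ a * (pd a U x / U x) * G (x, y) w = 0) \<longleftrightarrow>
        Dop c k \<alpha> \<beta> a (\<lambda>p. phi (gauge_transform U G p)) p = (\<lambda>_. 0)"
        unfolding xy prod.case
        by (rule pde_equiv)
           (use p holomorphic_pt_partial[of "\<lambda>p. U (fst p)" x y a] holomorphic_pt_partial[of "\<lambda>p. G p _" x y a] in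
             \<open>auto simp: xy\<close>)
    qed
    show ?thesis unfolding first_system_def second_system_def by (simp only: shift pde)
  qed
  have ex: "\<exists>Gbar. mero_vec D Gbar \<and> generic D (\<lambda>p. phi (gauge_transform U Gbar p) = f p) \<and>
           (\<forall>G'. mero_vec D G' \<and> generic D (\<lambda>p. phi (gauge_transform U G' p) = f p)
              \<longrightarrow> generic D (\<lambda>p. G' p = Gbar p))" if f: "mero_V0 D f" for f
  proof -
    \<comment> \<open>On (V^n)_0 the inverse of \<open>phi\<close> reads off the coordinates at the
      frames, and the inverse of U is meromorphic because U is generically nonzero.\<close>
    define Gbar where "Gbar = (\<lambda>p w. inverse (U (fst p)) * f p (frame w))"
    have "mero_vec D Gbar"
      using f mero_mult[OF mero_inverse[OF D U_mero U_nz]]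
      unfolding mero_vec_def Gbar_def mero_V0_def by blast
    moreover have eq: "generic D (\<lambda>p. phi (gauge_transform U Gbar p) = f p)"
    proof (rule generic_mono[OF generic_conj[OF U_nz]])
      show "generic D (\<lambda>p. f p \<in> V0)" using f by (simp add: mero_V0_def)
      fix p assume p: "U (fst p) \<noteq> 0 \<and> f p \<in> V0"
      then obtain F where F: "f p = phi F" by (auto simp: V0_eq)
      have "gauge_transform U Gbar p = F"
        using p by (simp add: gauge_transform_def Gbar_def F fun_eq_iff)
      then show "phi (gauge_transform U Gbar p) = f p" using F by simp
    qed
    moreover have "generic D (\<lambda>p. G' p = Gbar p)"
      if "generic D (\<lambda>p. phi (gauge_transform U G' p) = f p)" for G'
      by (rule generic_mono[OF generic_conj[OF U_nz generic_conj[OF eq that]]])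
         (metis gauge_transform_scale phi_eq_iff scale_eq_iff)
    ultimately show ?thesis by blast
  qed
  have V0: "Qop c k \<alpha> \<beta> m p u \<in> V0 \<and>
        (\<lambda>\<iota>. Aop k \<alpha> a (snd p) u \<iota> + Bop k \<alpha> \<beta> a (fst p) u \<iota>) \<in> V0" if "u \<in> V0" for m a and p :: "'n pt" and u
    using that by (auto simp: V0_eq Qop_phi AB_phi)
  show ?thesis
    by (intro conjI allI impI ballI)
       (rule gauge phi_gauge equiv ex V0[THEN conjunct1] V0[THEN conjunct2], assumption)+
qed

end
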